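(* If the theory $\textrm{LAP}$ proves the sequent $\alpha_1,\dots,\alpha_k\rightarrow\beta_1,\dots,\beta_\ell$, then $\overline{V\oplus L}$ proves the sequent $\alpha_1^\sigma,\dots,\alpha_k^\sigma\rightarrow\beta_1^\sigma,\dots,\beta_\ell^\sigma$, where $\sigma$ is the translation of $\textrm{LAP}$ into $\overline{V\oplus L}$ (field $=\mathbb Z_2$).
   Context: $\textrm{LAP}$ (Soltys; Soltys–Cook, "The proof complexity of linear algebra") is a quantifier-free three-sorted theory with sorts index (natural numbers), field elements, and matrices over the field, with symbols $0,1,+,*,\dot-,{\rm div},{\rm rem},{\rm r},{\rm c}$ (index), $0,1,+,*,-,{}^{-1},{\rm e},\Sigma$ (field), $\le,=$, ${\rm cond}_{\rm index},{\rm cond}_{\rm field}$, lambda terms $\lambda_{ij}\langle m,n,t\rangle$ (the $m\times n$ matrix with $(i,j)$ entry $t(i,j)$) and powering ${\rm P}(n,A)=A^n$; ${\rm r}(A),{\rm c}(A)$ are the numbers of rows/columns, ${\rm e}(A,i,j)=A_{ij}$ (rows/columns numbered from $1$; out-of-range entries are $0$), $\Sigma(A)$ is the sum of all entries. Proofs are propositional LK sequent proofs with Soltys's nonlogical axioms A1–A36 (equality, index, field (including $a\ne0\rightarrow a*a^{-1}=1$), matrix axioms for ${\rm r},{\rm c},{\rm e},\Sigma$, and ${\rm P}(0,A)=I_{{\rm r}(A)}$, ${\rm P}(n+1,A)={\rm P}(n,A)*A$), the induction rule (from $\Gamma,\alpha(i)\rightarrow\alpha(i+1),\Delta$ infer $\Gamma,\alpha(0)\rightarrow\alpha(n),\Delta$),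 and the matrix equality rule (from equal entries, equal ${\rm r}$, equal ${\rm c}$ infer $T=U$). $\overline{V\oplus L}$ is the two-sorted (numbers in $\mathbb N$, strings = finite subsets of $\mathbb N$) universally axiomatized theory for the class ${\oplus L}$: it is a conservative extension of $V^0(2)$ plus an axiom asserting existence of iterated matrix powers over $\mathbb Z_2$, has function symbols for all $F{\oplus L}$ functions (including parity ${\it PAR}(X)$: $X$ has an odd number of elements, and ${\it Pow}_2$: matrix powering over $\mathbb Z_2$), and proves the $\Sigma^B_0$-induction scheme in its vocabulary. Write $\langle x,y\rangle=(x+y)(x+y+1)+2y$ and $X(x,y)=X(\langle x,y\rangle)$. Translation $\sigma$: index terms go to number terms ($0,1$, variables, $+,\cdot$ unchanged; $\dot-$ is cutoff subtraction; ${\rm div}(x,y)$ with ${\rm div}(x,0)=0$; ${\rm rem}(x,y)=x-y\,{\rm div}(x,y)$; ${\rm cond}_{\rm index}(\alpha,m,n)$ is $m^\sigma$ if $\alpha^\sigma$, else $n^\sigma$). An $a\times b$ matrix $A$ over $\mathbb Z_2$ is coded by the string whose only elements are $\langle0,\langle a,b\rangle\rangle$ and those $\langle i,j\rangle$ with $1\le i\le a$, $1\le j\le b$, $A_{ij}=1$; ${\it isMatrix}_2(X)$ says $X$ is such a code. ${\rm r}(T)^\sigma,{\rm c}(T)^\sigma$ are the row/column numbers coded by $T^\sigma$ ($0$ if not a code). Field terms go to formulas: $0\mapsto\bot$, $1\mapsto\top$, field variable $a\mapsto X_a(1,1)$, $t+u$ and $t-u\mapsto t^\sigma\oplus u^\sigma$,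 $t*u\mapsto t^\sigma\wedge u^\sigma$, $t^{-1}\mapsto t^\sigma$, ${\rm cond}_{\rm field}(\alpha,t,u)\mapsto(\alpha^\sigma\wedge t^\sigma)\vee(\neg\alpha^\sigma\wedge u^\sigma)$, ${\rm e}(T,m,n)\mapsto T^\sigma(m^\sigma,n^\sigma)\wedge m^\sigma>0\wedge n^\sigma>0\wedge{\it isMatrix}_2(T^\sigma)$, $\Sigma(T)\mapsto\neg{\it PAR}(T^\sigma)\wedge{\it isMatrix}_2(T^\sigma)$. Matrix terms go to strings: matrix variables to string variables; $\lambda_{ij}\langle m,n,t\rangle$ to the code of the $m^\sigma\times n^\sigma$ matrix with $(i,j)$ entry $t^\sigma(i,j)$; ${\rm P}(m,T)$ to the code of: the $0\times0$ matrix if $\neg{\it isMatrix}_2(T^\sigma)$; the ${\rm r}\times{\rm r}$ identity if $m^\sigma=0$; otherwise the ${\rm r}\times{\rm c}$ truncation of the $m^\sigma$-th power over $\mathbb Z_2$ of the matrix coded by $T^\sigma$ zero-padded to a square of size $\max({\rm r},{\rm c})$. Atomic formulas: $m=n\mapsto m^\sigma=n^\sigma$, $m\le n\mapsto m^\sigma\le n^\sigma$, $t=u\mapsto(t^\sigma\leftrightarrow u^\sigma)$, $T=U\mapsto({\rm r}(T)={\rm r}(U))^\sigma\wedge({\rm c}(T)={\rm c}(U))^\sigma\wedge\forall i,j\le|T^\sigma|+|U^\sigma|\,({\rm e}(T,i,j)={\rm e}(U,i,j))^\sigma$. $\sigma$ commutes with $\wedge,\vee,\neg$ and is applied formula-by-formula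 to sequents. *)

theory Defs
  imports Main "HOL-Library.More_List"
begin

section \<open>The theory LAP\<close>

text \<open>
  Bound index variables are de Bruijn indices: in \<open>MLam m n t\<close>, i.e. \<open>\<lambda>\<^sub>i\<^sub>j\<langle>m,n,t\<rangle>\<close>, the term \<open>t\<close>
  (but not \<open>m\<close>, \<open>n\<close>) is under two binders, and inside \<open>t\<close> variable 1 is \<open>i\<close> (the row), variable 0
  is \<open>j\<close> (the column) and variable \<open>k + 2\<close> is the outer variable \<open>k\<close>.  As in the source of LAP, the
  condition of \<open>cond\<close> is a Boolean combination of atomic formulas between index terms.
  Field subtraction is binary; the unary \<open>- a\<close> of the axioms is \<open>0 - a\<close>.
\<close>

datatype lidx =
    IVar nat | IZero | IOne
  | IAdd lidx lidx | IMul lidx lidx | IMinus lidx lidx | IDiv lidx lidx | IRem lidx lidx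
  | IRow lmat | ICol lmat
  | ICond lcnd lidx lidx
and lfld =
    KVar nat | KZero | KOne
  | KAdd lfld lfld | KMul lfld lfld | KSub lfld lfld | KInv lfld
  | KEntry lmat lidx lidx | KSum lmat
  | KCond lcnd lfld lfld
and lmat =
    MVar nat
  | MLam lidx lidx lfld
  | MPow lidx lmat
and lcnd =
    CEq lidx lidx | CLe lidx lidx | CNot lcnd | CAnd lcnd lcnd | COr lcnd lcnd

datatype lfml =
    LEqI lidx lidx | LLe lidx lidx | LEqK lfld lfld | LEqM lmat lmat
  | LNot lfml | LAnd lfml lfml | LOr lfml lfml

primrec fml_of_cnd :: "lcnd \<Rightarrow> lfml" where
  "fml_of_cnd (CEq m n) = LEqI m n"
| "fml_of_cnd (CLe m n) = LLe m n"
| "fml_of_cnd (CNot a) = LNot (fml_of_cnd a)"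
| "fml_of_cnd (CAnd a b) = LAnd (fml_of_cnd a) (fml_of_cnd b)"
| "fml_of_cnd (COr a b) = LOr (fml_of_cnd a) (fml_of_cnd b)"

subsection \<open>Renaming and substitution of index variables\<close>

definition ren_up2 :: "(nat \<Rightarrow> nat) \<Rightarrow> nat \<Rightarrow> nat" where
  "ren_up2 r k = (if k < 2 then k else r (k - 2) + 2)"

primrec iren :: "(nat \<Rightarrow> nat) \<Rightarrow> lidx \<Rightarrow> lidx"
  and kren :: "(nat \<Rightarrow> nat) \<Rightarrow> lfld \<Rightarrow> lfld"
  and mren :: "(nat \<Rightarrow> nat) \<Rightarrow> lmat \<Rightarrow> lmat"
  and cren :: "(nat \<Rightarrow> nat) \<Rightarrow> lcnd \<Rightarrow> lcnd" where
  "iren r (IVar k) = IVar (r k)"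
| "iren r IZero = IZero"
| "iren r IOne = IOne"
| "iren r (IAdd m n) = IAdd (iren r m) (iren r n)"
| "iren r (IMul m n) = IMul (iren r m) (iren r n)"
| "iren r (IMinus m n) = IMinus (iren r m) (iren r n)"
| "iren r (IDiv m n) = IDiv (iren r m) (iren r n)"
| "iren r (IRem m n) = IRem (iren r m) (iren r n)"
| "iren r (IRow A) = IRow (mren r A)"
| "iren r (ICol A) = ICol (mren r A)"
| "iren r (ICond a m n) = ICond (cren r a) (iren r m) (iren r n)"
| "kren r (KVar k) = KVar k"
| "kren r KZero = KZero"
| "kren r KOne = KOne"
| "kren r (KAdd t u) = KAdd (kren r t) (kren r u)"
| "kren r (KMul t u) = KMul (kren r t) (kren r u)"
| "kren r (KSub t u) = KSub (kren r t) (kren r u)"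
| "kren r (KInv t) = KInv (kren r t)"
| "kren r (KEntry A m n) = KEntry (mren r A) (iren r m) (iren r n)"
| "kren r (KSum A) = KSum (mren r A)"
| "kren r (KCond a t u) = KCond (cren r a) (kren r t) (kren r u)"
| "mren r (MVar k) = MVar k"
| "mren r (MLam m n t) = MLam (iren r m) (iren r n) (kren (ren_up2 r) t)"
| "mren r (MPow m A) = MPow (iren r m) (mren r A)"
| "cren r (CEq m n) = CEq (iren r m) (iren r n)"
| "cren r (CLe m n) = CLe (iren r m) (iren r n)"
| "cren r (CNot a) = CNot (cren r a)"
| "cren r (CAnd a b) = CAnd (cren r a) (cren r b)"
| "cren r (COr a b) = COr (cren r a) (cren r b)"

definition sub_up2 :: "(nat \<Rightarrow> lidx) \<Rightarrow> nat \<Rightarrow> lidx" where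
  "sub_up2 s k = (if k < 2 then IVar k else iren (\<lambda>i. i + 2) (s (k - 2)))"

primrec isub :: "(nat \<Rightarrow> lidx) \<Rightarrow> lidx \<Rightarrow> lidx"
  and ksub :: "(nat \<Rightarrow> lidx) \<Rightarrow> lfld \<Rightarrow> lfld"
  and msub :: "(nat \<Rightarrow> lidx) \<Rightarrow> lmat \<Rightarrow> lmat"
  and csub :: "(nat \<Rightarrow> lidx) \<Rightarrow> lcnd \<Rightarrow> lcnd" where
  "isub s (IVar k) = s k"
| "isub s IZero = IZero"
| "isub s IOne = IOne"
| "isub s (IAdd m n) = IAdd (isub s m) (isub s n)"
| "isub s (IMul m n) = IMul (isub s m) (isub s n)"
| "isub s (IMinus m n) = IMinus (isub s m) (isub s n)"
| "isub s (IDiv m n) = IDiv (isub s m) (isub s n)"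
| "isub s (IRem m n) = IRem (isub s m) (isub s n)"
| "isub s (IRow A) = IRow (msub s A)"
| "isub s (ICol A) = ICol (msub s A)"
| "isub s (ICond a m n) = ICond (csub s a) (isub s m) (isub s n)"
| "ksub s (KVar k) = KVar k"
| "ksub s KZero = KZero"
| "ksub s KOne = KOne"
| "ksub s (KAdd t u) = KAdd (ksub s t) (ksub s u)"
| "ksub s (KMul t u) = KMul (ksub s t) (ksub s u)"
| "ksub s (KSub t u) = KSub (ksub s t) (ksub s u)"
| "ksub s (KInv t) = KInv (ksub s t)"
| "ksub s (KEntry A m n) = KEntry (msub s A) (isub s m) (isub s n)"
| "ksub s (KSum A) = KSum (msub s A)"
| "ksub s (KCond a t u) = KCond (csub s a) (ksub s t) (ksub s u)"
| "msub s (MVar k) = MVar k"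
| "msub s (MLam m n t) = MLam (isub s m) (isub s n) (ksub (sub_up2 s) t)"
| "msub s (MPow m A) = MPow (isub s m) (msub s A)"
| "csub s (CEq m n) = CEq (isub s m) (isub s n)"
| "csub s (CLe m n) = CLe (isub s m) (isub s n)"
| "csub s (CNot a) = CNot (csub s a)"
| "csub s (CAnd a b) = CAnd (csub s a) (csub s b)"
| "csub s (COr a b) = COr (csub s a) (csub s b)"

primrec lsub :: "(nat \<Rightarrow> lidx) \<Rightarrow> lfml \<Rightarrow> lfml" where
  "lsub s (LEqI m n) = LEqI (isub s m) (isub s n)"
| "lsub s (LLe m n) = LLe (isub s m) (isub s n)"
| "lsub s (LEqK t u) = LEqK (ksub s t) (ksub s u)"
| "lsub s (LEqM A B) = LEqM (msub s A) (msub s B)"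
| "lsub s (LNot a) = LNot (lsub s a)"
| "lsub s (LAnd a b) = LAnd (lsub s a) (lsub s b)"
| "lsub s (LOr a b) = LOr (lsub s a) (lsub s b)"

abbreviation ilift2 :: "lidx \<Rightarrow> lidx" where "ilift2 \<equiv> iren (\<lambda>k. k + 2)"
abbreviation mlift2 :: "lmat \<Rightarrow> lmat" where "mlift2 \<equiv> mren (\<lambda>k. k + 2)"
abbreviation llift :: "nat \<Rightarrow> lfml \<Rightarrow> lfml" where "llift d \<equiv> lsub (\<lambda>k. IVar (k + d))"

text \<open>\<open>linst m a\<close> replaces variable 0 by \<open>m\<close> and lowers the other index variables.\<close>

abbreviation linst :: "lidx \<Rightarrow> lfml \<Rightarrow> lfml" where
  "linst m \<equiv> lsub (case_nat m IVar)"

text \<open>\<open>kinst2 p q t\<close> is \<open>t(p,q)\<close>, for \<open>t\<close> in the scope of \<open>\<lambda>\<^sub>i\<^sub>j\<close>.\<close>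

abbreviation kinst2 :: "lidx \<Rightarrow> lidx \<Rightarrow> lfld \<Rightarrow> lfld" where
  "kinst2 p q \<equiv> ksub (case_nat q (case_nat p IVar))"

subsection \<open>Axioms and proofs\<close>

definition LLt :: "lidx \<Rightarrow> lidx \<Rightarrow> lfml" where
  "LLt m n = LAnd (LLe m n) (LNot (LEqI m n))"

definition lap_id :: "lidx \<Rightarrow> lmat" where
  "lap_id m = MLam m m (KCond (CEq (IVar 1) (IVar 0)) KOne KZero)"

definition lap_transpose :: "lmat \<Rightarrow> lmat" where
  "lap_transpose A = MLam (ICol A) (IRow A) (KEntry (mlift2 A) (IVar 0) (IVar 1))"

text \<open>Matrix product \<open>\<lambda>\<^sub>i\<^sub>j\<langle>r(A), c(B), \<Sigma>(\<lambda>\<^sub>k\<^sub>l\<langle>c(A), 1, A\<^sub>i\<^sub>k * B\<^sub>k\<^sub>j\<rangle>)\<rangle>\<close>: innermost,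
  \<open>l\<close>, \<open>k\<close>, \<open>j\<close>, \<open>i\<close> are the variables 0, 1, 2, 3.\<close>

definition lap_mult :: "lmat \<Rightarrow> lmat \<Rightarrow> lmat" where
  "lap_mult A B = MLam (IRow A) (ICol B)
     (KSum (MLam (ilift2 (ICol A)) IOne
        (KMul (KEntry (mlift2 (mlift2 A)) (IVar 3) (IVar 1))
              (KEntry (mlift2 (mlift2 B)) (IVar 1) (IVar 2)))))"

text \<open>The four blocks of a matrix cut after its first row and column are \<open>A\<^sub>1\<^sub>1\<close>, \<open>R(A)\<close>, \<open>S(A)\<close>, \<open>M(A)\<close>.\<close>

definition lap_R :: "lmat \<Rightarrow> lmat" where
  "lap_R A = MLam IOne (IMinus (ICol A) IOne) (KEntry (mlift2 A) IOne (IAdd (IVar 0) IOne))"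

definition lap_S :: "lmat \<Rightarrow> lmat" where
  "lap_S A = MLam (IMinus (IRow A) IOne) IOne (KEntry (mlift2 A) (IAdd (IVar 1) IOne) IOne)"

definition lap_M :: "lmat \<Rightarrow> lmat" where
  "lap_M A = MLam (IMinus (IRow A) IOne) (IMinus (ICol A) IOne)
     (KEntry (mlift2 A) (IAdd (IVar 1) IOne) (IAdd (IVar 0) IOne))"

text \<open>Every substitution instance of an axiom is an axiom.\<close>

inductive LAP_axiom :: "lfml list \<Rightarrow> lfml list \<Rightarrow> bool" where
  A1_idx: "LAP_axiom [] [LEqI m m]"
| A1_fld: "LAP_axiom [] [LEqK t t]"
| A1_mat: "LAP_axiom [] [LEqM T T]"
| A2_idx: "LAP_axiom [LEqI m n] [LEqI n m]"
| A2_fld: "LAP_axiom [LEqK t u] [LEqK u t]"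
| A2_mat: "LAP_axiom [LEqM T U] [LEqM U T]"
| A3_idx: "LAP_axiom [LAnd (LEqI m n) (LEqI n p)] [LEqI m p]"
| A3_fld: "LAP_axiom [LAnd (LEqK t u) (LEqK u v)] [LEqK t v]"
| A3_mat: "LAP_axiom [LAnd (LEqM T U) (LEqM U V)] [LEqM T V]"
| A4_iadd: "LAP_axiom [LEqI m m', LEqI n n'] [LEqI (IAdd m n) (IAdd m' n')]"
| A4_imul: "LAP_axiom [LEqI m m', LEqI n n'] [LEqI (IMul m n) (IMul m' n')]"
| A4_iminus: "LAP_axiom [LEqI m m', LEqI n n'] [LEqI (IMinus m n) (IMinus m' n')]"
| A4_div: "LAP_axiom [LEqI m m', LEqI n n'] [LEqI (IDiv m n) (IDiv m' n')]"
| A4_rem: "LAP_axiom [LEqI m m', LEqI n n'] [LEqI (IRem m n) (IRem m' n')]"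
| A4_row: "LAP_axiom [LEqM T U] [LEqI (IRow T) (IRow U)]"
| A4_col: "LAP_axiom [LEqM T U] [LEqI (ICol T) (ICol U)]"
| A4_icond: "LAP_axiom [LEqI m m', LEqI n n'] [LEqI (ICond \<alpha> m n) (ICond \<alpha> m' n')]"
| A4_kadd: "LAP_axiom [LEqK t t', LEqK u u'] [LEqK (KAdd t u) (KAdd t' u')]"
| A4_kmul: "LAP_axiom [LEqK t t', LEqK u u'] [LEqK (KMul t u) (KMul t' u')]"
| A4_ksub: "LAP_axiom [LEqK t t', LEqK u u'] [LEqK (KSub t u) (KSub t' u')]"
| A4_kinv: "LAP_axiom [LEqK t t'] [LEqK (KInv t) (KInv t')]"
| A4_entry: "LAP_axiom [LEqM T U, LEqI m m', LEqI n n'] [LEqK (KEntry T m n) (KEntry U m' n')]"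
| A4_sum: "LAP_axiom [LEqM T U] [LEqK (KSum T) (KSum U)]"
| A4_kcond: "LAP_axiom [LEqK t t', LEqK u u'] [LEqK (KCond \<alpha> t u) (KCond \<alpha> t' u')]"
| A4_pow: "LAP_axiom [LEqI m m', LEqM T U] [LEqM (MPow m T) (MPow m' U)]"
| A5: "LAP_axiom [LEqI m m', LEqI n n', LLe m n] [LLe m' n']"
| A6: "LAP_axiom [] [LNot (LEqI (IAdd i IOne) IZero)]"
| A7: "LAP_axiom [] [LEqI (IMul i (IAdd j IOne)) (IAdd (IMul i j) i)]"
| A8: "LAP_axiom [LEqI (IAdd i IOne) (IAdd j IOne)] [LEqI i j]"
| A9: "LAP_axiom [] [LLe i (IAdd i j)]"
| A10: "LAP_axiom [] [LEqI (IAdd i IZero) i]"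
| A11: "LAP_axiom [] [LLe i j, LLe j i]"
| A12: "LAP_axiom [] [LEqI (IAdd i (IAdd j IOne)) (IAdd (IAdd i j) IOne)]"
| A13: "LAP_axiom [LLe i j, LLe j i] [LEqI i j]"
| A14: "LAP_axiom [] [LEqI (IMul i IZero) IZero]"
| A15a: "LAP_axiom [LLe i j, LEqI (IAdd i k) j] [LEqI (IMinus j i) k]"
| A15b: "LAP_axiom [LNot (LLe i j)] [LEqI (IMinus j i) IZero]"
| A16a: "LAP_axiom [LNot (LEqI j IZero)] [LLt (IRem i j) j]"
| A16b: "LAP_axiom [LNot (LEqI j IZero)] [LEqI i (IAdd (IMul j (IDiv i j)) (IRem i j))]"
| A17a: "LAP_axiom [fml_of_cnd \<alpha>] [LEqI (ICond \<alpha> i j) i]"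
| A17b: "LAP_axiom [LNot (fml_of_cnd \<alpha>)] [LEqI (ICond \<alpha> i j) j]"
| A18: "LAP_axiom [] [LAnd (LNot (LEqK KZero KOne)) (LEqK (KAdd a KZero) a)]"
| A19a: "LAP_axiom [] [LEqK (KAdd a (KSub KZero a)) KZero]"
| A19b: "LAP_axiom [] [LEqK (KSub a b) (KAdd a (KSub KZero b))]"
| A20: "LAP_axiom [] [LEqK (KMul KOne a) a]"
| A21: "LAP_axiom [LNot (LEqK a KZero)] [LEqK (KMul a (KInv a)) KOne]"
| A22: "LAP_axiom [] [LEqK (KAdd a b) (KAdd b a)]"
| A23: "LAP_axiom [] [LEqK (KMul a b) (KMul b a)]"
| A24: "LAP_axiom [] [LEqK (KAdd a (KAdd b c)) (KAdd (KAdd a b) c)]"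
| A25: "LAP_axiom [] [LEqK (KMul a (KMul b c)) (KMul (KMul a b) c)]"
| A26: "LAP_axiom [] [LEqK (KMul a (KAdd b c)) (KAdd (KMul a b) (KMul a c))]"
| A27a: "LAP_axiom [fml_of_cnd \<alpha>] [LEqK (KCond \<alpha> a b) a]"
| A27b: "LAP_axiom [LNot (fml_of_cnd \<alpha>)] [LEqK (KCond \<alpha> a b) b]"
| A28: "LAP_axiom [LOr (LEqI i IZero) (LOr (LLt (IRow T) i) (LOr (LEqI j IZero) (LLt (ICol T) j)))]
          [LEqK (KEntry T i j) KZero]"
| A29a: "LAP_axiom [] [LEqI (IRow (MLam m n t)) m]"
| A29b: "LAP_axiom [] [LEqI (ICol (MLam m n t)) n]"
| A29c: "LAP_axiom [LLe IOne i, LLe i m, LLe IOne j, LLe j n]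
           [LEqK (KEntry (MLam m n t) i j) (kinst2 i j t)]"
| A30: "LAP_axiom [LEqI (IRow T) IOne, LEqI (ICol T) IOne] [LEqK (KSum T) (KEntry T IOne IOne)]"
| A31: "LAP_axiom [LEqI (IRow T) IOne, LLt IOne (ICol T)]
          [LEqK (KSum T)
             (KAdd (KSum (MLam IOne (IMinus (ICol T) IOne) (KEntry (mlift2 T) (IVar 1) (IVar 0))))
                   (KEntry T IOne (ICol T)))]"
| A32: "LAP_axiom [LEqI (ICol T) IOne] [LEqK (KSum T) (KSum (lap_transpose T))]"
| A33: "LAP_axiom [LLt IOne (IRow T), LLt IOne (ICol T)]
          [LEqK (KSum T)
             (KAdd (KAdd (KAdd (KEntry T IOne IOne) (KSum (lap_R T))) (KSum (lap_S T))) (KSum (lap_M T)))]"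
| A34: "LAP_axiom [LOr (LEqI (IRow T) IZero) (LEqI (ICol T) IZero)] [LEqK (KSum T) KZero]"
| A35: "LAP_axiom [] [LEqM (MPow IZero T) (lap_id (IRow T))]"
| A36: "LAP_axiom [] [LEqM (MPow (IAdd n IOne) T) (lap_mult (MPow n T) T)]"

text \<open>The rule \<open>structural\<close> comprises weakening, exchange and contraction.  In \<open>induction\<close> the
  eigenvariable \<open>i\<close> is variable 0 of the premise, in \<open>matrix_eq\<close> the eigenvariables \<open>i\<close>, \<open>j\<close> are the
  variables 1, 0; lifting the side formulas makes them fresh.\<close>

inductive LAP_proves :: "lfml list \<Rightarrow> lfml list \<Rightarrow> bool" where
  "axiom": "LAP_axiom \<Gamma> \<Delta> \<Longrightarrow> LAP_proves \<Gamma> \<Delta>"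
| initial: "LAP_proves [\<alpha>] [\<alpha>]"
| structural: "LAP_proves \<Gamma> \<Delta> \<Longrightarrow> set \<Gamma> \<subseteq> set \<Gamma>' \<Longrightarrow> set \<Delta> \<subseteq> set \<Delta>' \<Longrightarrow> LAP_proves \<Gamma>' \<Delta>'"
| cut: "LAP_proves \<Gamma> (\<alpha> # \<Delta>) \<Longrightarrow> LAP_proves (\<alpha> # \<Gamma>) \<Delta> \<Longrightarrow> LAP_proves \<Gamma> \<Delta>"
| not_left: "LAP_proves \<Gamma> (\<alpha> # \<Delta>) \<Longrightarrow> LAP_proves (LNot \<alpha> # \<Gamma>) \<Delta>"
| not_right: "LAP_proves (\<alpha> # \<Gamma>) \<Delta> \<Longrightarrow> LAP_proves \<Gamma> (LNot \<alpha> # \<Delta>)"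
| and_left: "LAP_proves (\<alpha> # \<beta> # \<Gamma>) \<Delta> \<Longrightarrow> LAP_proves (LAnd \<alpha> \<beta> # \<Gamma>) \<Delta>"
| and_right: "LAP_proves \<Gamma> (\<alpha> # \<Delta>) \<Longrightarrow> LAP_proves \<Gamma> (\<beta> # \<Delta>) \<Longrightarrow> LAP_proves \<Gamma> (LAnd \<alpha> \<beta> # \<Delta>)"
| or_left: "LAP_proves (\<alpha> # \<Gamma>) \<Delta> \<Longrightarrow> LAP_proves (\<beta> # \<Gamma>) \<Delta> \<Longrightarrow> LAP_proves (LOr \<alpha> \<beta> # \<Gamma>) \<Delta>"
| or_right: "LAP_proves \<Gamma> (\<alpha> # \<beta> # \<Delta>) \<Longrightarrow> LAP_proves \<Gamma> (LOr \<alpha> \<beta> # \<Delta>)"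
| induction:
    "LAP_proves (\<alpha> # map (llift 1) \<Gamma>)
                (lsub (case_nat (IAdd (IVar 0) IOne) (\<lambda>k. IVar (Suc k))) \<alpha> # map (llift 1) \<Delta>)
     \<Longrightarrow> LAP_proves (linst IZero \<alpha> # \<Gamma>) (linst n \<alpha> # \<Delta>)"
| matrix_eq:
    "LAP_proves (map (llift 2) \<Gamma>)
       (LEqK (KEntry (mlift2 T) (IVar 1) (IVar 0)) (KEntry (mlift2 U) (IVar 1) (IVar 0))
          # map (llift 2) \<Delta>)
     \<Longrightarrow> LAP_proves \<Gamma> (LEqI (IRow T) (IRow U) # \<Delta>)
     \<Longrightarrow> LAP_proves \<Gamma> (LEqI (ICol T) (ICol U) # \<Delta>)
     \<Longrightarrow> LAP_proves \<Gamma> (LEqM T U # \<Delta>)"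


section \<open>The theory V-parity-L-bar\<close>

subsection \<open>Vocabulary\<close>

text \<open>
  The vocabulary is \<open>[0, 1, +, \<cdot>, | |; \<in>, \<le>, =, =]\<close>, the string functions \<open>Parity(x,X)\<close> (partial
  parities of \<open>X\<close> up to \<open>x\<close>) and \<open>PowSeq\<^sub>2(n,k,X)\<close> (the powers \<open>0..k\<close> of an \<open>n \<times> n\<close> matrix), closed
  under the introduction, for every open formula \<open>\<phi>(z,x,X)\<close> and number term \<open>b(x,X)\<close>, of
    the number function \<open>f\<^sub>\<phi>\<^sub>,\<^sub>b(x,X)\<close>, the least \<open>z < b(x,X)\<close> with \<open>\<phi>(z,x,X)\<close>, or \<open>b(x,X)\<close> if there is none, and
    the string function \<open>F\<^sub>\<phi>\<^sub>,\<^sub>b(x,X)\<close>, the set of all \<open>z < b(x,X)\<close> with \<open>\<phi>(z,x,X)\<close>.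
  \<open>NMin \<phi> b ns Xs\<close> and \<open>SComp \<phi> b ns Xs\<close> are applications of these symbols to lists of arguments: in
  \<open>\<phi>\<close>, variable 0 is \<open>z\<close> and number variable \<open>k + 1\<close> is the parameter \<open>ns ! k\<close>; in \<open>b\<close>, number variable
  \<open>k\<close> is \<open>ns ! k\<close>; in both, string variable \<open>k\<close> is \<open>Xs ! k\<close>.  Variables beyond the list of arguments
  stand for 0 and the empty string, so every expression is meaningful.
\<close>

datatype ntrm =
    NVar nat | NZero | NOne
  | NAdd ntrm ntrm (infixl "\<^bold>+" 65) | NMul ntrm ntrm (infixl "\<^bold>*" 70)
  | Len strm
  | NMin oform ntrm "ntrm list" "strm list"
and strm =
    SVar nat
  | SComp oform ntrm "ntrm list" "strm list"
  | SParity ntrm strm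
  | SPowSeq ntrm ntrm strm
and atom = EqN ntrm ntrm | EqS strm strm | Le ntrm ntrm | Mem ntrm strm
and oform =
    OAtom atom | OFalse | OTrue
  | ONot oform ("\<^bold>\<not> _" [40] 40)
  | OAnd oform oform (infixr "\<^bold>\<and>" 35)
  | OOr oform oform (infixr "\<^bold>\<or>" 30)

datatype form =
    FAtom atom | FFalse | FTrue | FNot form | FAnd form form | FOr form form
  | FAllN form | FExN form | FAllS form | FExS form

primrec form_of :: "oform \<Rightarrow> form" where
  "form_of (OAtom a) = FAtom a"
| "form_of OFalse = FFalse"
| "form_of OTrue = FTrue"
| "form_of (\<^bold>\<not> p) = FNot (form_of p)"
| "form_of (p \<^bold>\<and> q) = FAnd (form_of p) (form_of q)"
| "form_of (p \<^bold>\<or> q) = FOr (form_of p) (form_of q)"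

abbreviation oeq (infix "\<^bold>=" 50) where "t \<^bold>= u \<equiv> OAtom (EqN t u)"
abbreviation oeqs (infix "\<^bold>=\<^bold>=" 50) where "X \<^bold>=\<^bold>= Y \<equiv> OAtom (EqS X Y)"
abbreviation ole (infix "\<^bold>\<le>" 50) where "t \<^bold>\<le> u \<equiv> OAtom (Le t u)"
abbreviation omem (infix "\<^bold>\<in>" 50) where "t \<^bold>\<in> X \<equiv> OAtom (Mem t X)"
abbreviation olt (infix "\<^bold><" 50) where "t \<^bold>< u \<equiv> t \<^bold>\<le> u \<^bold>\<and> \<^bold>\<not> t \<^bold>= u"
abbreviation oimp (infixr "\<^bold>\<longrightarrow>" 25) where "p \<^bold>\<longrightarrow> q \<equiv> \<^bold>\<not> p \<^bold>\<or> q"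
abbreviation oiff (infix "\<^bold>\<longleftrightarrow>" 25) where "p \<^bold>\<longleftrightarrow> q \<equiv> (p \<^bold>\<longrightarrow> q) \<^bold>\<and> (q \<^bold>\<longrightarrow> p)"
abbreviation oxor (infix "\<^bold>\<oplus>" 32) where "p \<^bold>\<oplus> q \<equiv> p \<^bold>\<and> \<^bold>\<not> q \<^bold>\<or> \<^bold>\<not> p \<^bold>\<and> q"

text \<open>Simultaneous substitution.  The formula and bound indexing a function symbol are part of the
  symbol and are not substituted into.\<close>

primrec nsub :: "(nat \<Rightarrow> ntrm) \<Rightarrow> (nat \<Rightarrow> strm) \<Rightarrow> ntrm \<Rightarrow> ntrm"
  and ssub :: "(nat \<Rightarrow> ntrm) \<Rightarrow> (nat \<Rightarrow> strm) \<Rightarrow> strm \<Rightarrow> strm"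
  and asub :: "(nat \<Rightarrow> ntrm) \<Rightarrow> (nat \<Rightarrow> strm) \<Rightarrow> atom \<Rightarrow> atom"
  and osub :: "(nat \<Rightarrow> ntrm) \<Rightarrow> (nat \<Rightarrow> strm) \<Rightarrow> oform \<Rightarrow> oform" where
  "nsub f g (NVar k) = f k"
| "nsub f g NZero = NZero"
| "nsub f g NOne = NOne"
| "nsub f g (t \<^bold>+ u) = nsub f g t \<^bold>+ nsub f g u"
| "nsub f g (t \<^bold>* u) = nsub f g t \<^bold>* nsub f g u"
| "nsub f g (Len X) = Len (ssub f g X)"
| "nsub f g (NMin p b ns Xs) = NMin p b (map (nsub f g) ns) (map (ssub f g) Xs)"
| "ssub f g (SVar k) = g k"
| "ssub f g (SComp p b ns Xs) = SComp p b (map (nsub f g) ns) (map (ssub f g) Xs)"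
| "ssub f g (SParity t X) = SParity (nsub f g t) (ssub f g X)"
| "ssub f g (SPowSeq n k X) = SPowSeq (nsub f g n) (nsub f g k) (ssub f g X)"
| "asub f g (EqN t u) = EqN (nsub f g t) (nsub f g u)"
| "asub f g (EqS X Y) = EqS (ssub f g X) (ssub f g Y)"
| "asub f g (Le t u) = Le (nsub f g t) (nsub f g u)"
| "asub f g (Mem t X) = Mem (nsub f g t) (ssub f g X)"
| "osub f g (OAtom a) = OAtom (asub f g a)"
| "osub f g OFalse = OFalse"
| "osub f g OTrue = OTrue"
| "osub f g (\<^bold>\<not> p) = (\<^bold>\<not> osub f g p)"
| "osub f g (p \<^bold>\<and> q) = (osub f g p \<^bold>\<and> osub f g q)"
| "osub f g (p \<^bold>\<or> q) = (osub f g p \<^bold>\<or> osub f g q)"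

abbreviation nlift :: "nat \<Rightarrow> ntrm \<Rightarrow> ntrm" where "nlift d \<equiv> nsub (\<lambda>k. NVar (k + d)) SVar"
abbreviation slift :: "nat \<Rightarrow> strm \<Rightarrow> strm" where "slift d \<equiv> ssub (\<lambda>k. NVar (k + d)) SVar"
abbreviation olift :: "nat \<Rightarrow> oform \<Rightarrow> oform" where "olift d \<equiv> osub (\<lambda>k. NVar (k + d)) SVar"

definition upN :: "(nat \<Rightarrow> ntrm) \<Rightarrow> nat \<Rightarrow> ntrm" where
  "upN f = case_nat (NVar 0) (\<lambda>k. nlift 1 (f k))"

definition upS :: "(nat \<Rightarrow> strm) \<Rightarrow> nat \<Rightarrow> strm" where
  "upS g = case_nat (SVar 0) (\<lambda>k. ssub NVar (\<lambda>i. SVar (i + 1)) (g k))"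

primrec fsub :: "(nat \<Rightarrow> ntrm) \<Rightarrow> (nat \<Rightarrow> strm) \<Rightarrow> form \<Rightarrow> form" where
  "fsub f g (FAtom a) = FAtom (asub f g a)"
| "fsub f g FFalse = FFalse"
| "fsub f g FTrue = FTrue"
| "fsub f g (FNot p) = FNot (fsub f g p)"
| "fsub f g (FAnd p q) = FAnd (fsub f g p) (fsub f g q)"
| "fsub f g (FOr p q) = FOr (fsub f g p) (fsub f g q)"
| "fsub f g (FAllN p) = FAllN (fsub (upN f) (\<lambda>k. slift 1 (g k)) p)"
| "fsub f g (FExN p) = FExN (fsub (upN f) (\<lambda>k. slift 1 (g k)) p)"
| "fsub f g (FAllS p) = FAllS (fsub (\<lambda>k. nsub NVar (\<lambda>i. SVar (i + 1)) (f k)) (upS g) p)"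
| "fsub f g (FExS p) = FExS (fsub (\<lambda>k. nsub NVar (\<lambda>i. SVar (i + 1)) (f k)) (upS g) p)"

abbreviation fliftN :: "form \<Rightarrow> form" where "fliftN \<equiv> fsub (\<lambda>k. NVar (Suc k)) SVar"
abbreviation fliftS :: "form \<Rightarrow> form" where "fliftS \<equiv> fsub NVar (\<lambda>k. SVar (Suc k))"
abbreviation finstN :: "ntrm \<Rightarrow> form \<Rightarrow> form" where "finstN t \<equiv> fsub (case_nat t NVar) SVar"
abbreviation finstS :: "strm \<Rightarrow> form \<Rightarrow> form" where "finstS X \<equiv> fsub NVar (case_nat X SVar)"

subsection \<open>Abbreviations for minimization, bounded quantification and comprehension\<close>

text \<open>\<open>nvb\<close> and \<open>svb\<close> bound the number and string variables occurring in an expression.\<close>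

primrec nvb_n :: "ntrm \<Rightarrow> nat" and nvb_s :: "strm \<Rightarrow> nat" and nvb_a :: "atom \<Rightarrow> nat"
  and nvb_o :: "oform \<Rightarrow> nat" where
  "nvb_n (NVar k) = Suc k"
| "nvb_n NZero = 0"
| "nvb_n NOne = 0"
| "nvb_n (t \<^bold>+ u) = max (nvb_n t) (nvb_n u)"
| "nvb_n (t \<^bold>* u) = max (nvb_n t) (nvb_n u)"
| "nvb_n (Len X) = nvb_s X"
| "nvb_n (NMin p b ns Xs) = max (foldr max (map nvb_n ns) 0) (foldr max (map nvb_s Xs) 0)"
| "nvb_s (SVar k) = 0"
| "nvb_s (SComp p b ns Xs) = max (foldr max (map nvb_n ns) 0) (foldr max (map nvb_s Xs) 0)"
| "nvb_s (SParity t X) = max (nvb_n t) (nvb_s X)"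
| "nvb_s (SPowSeq n k X) = max (nvb_n n) (max (nvb_n k) (nvb_s X))"
| "nvb_a (EqN t u) = max (nvb_n t) (nvb_n u)"
| "nvb_a (EqS X Y) = max (nvb_s X) (nvb_s Y)"
| "nvb_a (Le t u) = max (nvb_n t) (nvb_n u)"
| "nvb_a (Mem t X) = max (nvb_n t) (nvb_s X)"
| "nvb_o (OAtom a) = nvb_a a"
| "nvb_o OFalse = 0"
| "nvb_o OTrue = 0"
| "nvb_o (\<^bold>\<not> p) = nvb_o p"
| "nvb_o (p \<^bold>\<and> q) = max (nvb_o p) (nvb_o q)"
| "nvb_o (p \<^bold>\<or> q) = max (nvb_o p) (nvb_o q)"

primrec svb_n :: "ntrm \<Rightarrow> nat" and svb_s :: "strm \<Rightarrow> nat" and svb_a :: "atom \<Rightarrow> nat"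
  and svb_o :: "oform \<Rightarrow> nat" where
  "svb_n (NVar k) = 0"
| "svb_n NZero = 0"
| "svb_n NOne = 0"
| "svb_n (t \<^bold>+ u) = max (svb_n t) (svb_n u)"
| "svb_n (t \<^bold>* u) = max (svb_n t) (svb_n u)"
| "svb_n (Len X) = svb_s X"
| "svb_n (NMin p b ns Xs) = max (foldr max (map svb_n ns) 0) (foldr max (map svb_s Xs) 0)"
| "svb_s (SVar k) = Suc k"
| "svb_s (SComp p b ns Xs) = max (foldr max (map svb_n ns) 0) (foldr max (map svb_s Xs) 0)"
| "svb_s (SParity t X) = max (svb_n t) (svb_s X)"
| "svb_s (SPowSeq n k X) = max (svb_n n) (max (svb_n k) (svb_s X))"
| "svb_a (EqN t u) = max (svb_n t) (svb_n u)"
| "svb_a (EqS X Y) = max (svb_s X) (svb_s Y)"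
| "svb_a (Le t u) = max (svb_n t) (svb_n u)"
| "svb_a (Mem t X) = max (svb_n t) (svb_s X)"
| "svb_o (OAtom a) = svb_a a"
| "svb_o OFalse = 0"
| "svb_o OTrue = 0"
| "svb_o (\<^bold>\<not> p) = svb_o p"
| "svb_o (p \<^bold>\<and> q) = max (svb_o p) (svb_o q)"
| "svb_o (p \<^bold>\<or> q) = max (svb_o p) (svb_o q)"

text \<open>
  In the following, \<open>p\<close> is in the scope of one more number variable than \<open>b\<close>: its variable 0 is the
  bound one and its variable \<open>k + 1\<close> is variable \<open>k\<close> of the context.  All other variables of \<open>p\<close> and
  \<open>b\<close> become explicit arguments of the symbol \<open>f\<^sub>p\<^sub>,\<^sub>b\<close> or \<open>F\<^sub>p\<^sub>,\<^sub>b\<close>.  Bounded quantifiers can thus be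
  written as open formulas: \<open>\<exists>z<b. p\<close> is \<open>f\<^sub>p\<^sub>,\<^sub>b < b\<close>.
\<close>

definition mu :: "ntrm \<Rightarrow> oform \<Rightarrow> ntrm" where
  "mu b p = NMin p b (map NVar [0..<max (nvb_n b) (nvb_o p)]) (map SVar [0..<max (svb_n b) (svb_o p)])"

definition compr :: "ntrm \<Rightarrow> oform \<Rightarrow> strm" where
  "compr b p = SComp p b (map NVar [0..<max (nvb_n b) (nvb_o p)]) (map SVar [0..<max (svb_n b) (svb_o p)])"

definition obex :: "ntrm \<Rightarrow> oform \<Rightarrow> oform" where
  "obex b p = (mu b p \<^bold>< b)"

definition oball :: "ntrm \<Rightarrow> oform \<Rightarrow> oform" where
  "oball b p = (\<^bold>\<not> obex b (\<^bold>\<not> p))"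

subsection \<open>Functions occurring in the axioms\<close>

definition pair :: "ntrm \<Rightarrow> ntrm \<Rightarrow> ntrm" where
  "pair x y = (x \<^bold>+ y) \<^bold>* (x \<^bold>+ y \<^bold>+ NOne) \<^bold>+ (NOne \<^bold>+ NOne) \<^bold>* y"

abbreviation bit2 :: "strm \<Rightarrow> ntrm \<Rightarrow> ntrm \<Rightarrow> oform" where
  "bit2 X x y \<equiv> pair x y \<^bold>\<in> X"

definition SEmpty :: strm where
  "SEmpty = SComp OFalse NZero [] []"

definition npd :: "ntrm \<Rightarrow> ntrm" where
  "npd x = NMin (NVar 0 \<^bold>+ NOne \<^bold>= NVar 1) (NVar 0) [x] []"

text \<open>The first place where two strings differ below \<open>|X|\<close>.\<close>

definition nse :: "strm \<Rightarrow> strm \<Rightarrow> ntrm" where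
  "nse X Y = NMin (NVar 0 \<^bold>\<in> SVar 0 \<^bold>\<oplus> NVar 0 \<^bold>\<in> SVar 1) (Len (SVar 0)) [] [X, Y]"

definition nleft :: "ntrm \<Rightarrow> ntrm" where
  "nleft z = NMin (obex (NVar 1 \<^bold>+ NOne) (NVar 2 \<^bold>= pair (NVar 1) (NVar 0))) (NVar 0 \<^bold>+ NOne) [z] []"

definition nright :: "ntrm \<Rightarrow> ntrm" where
  "nright z = NMin (obex (NVar 1 \<^bold>+ NOne) (NVar 2 \<^bold>= pair (NVar 0) (NVar 1))) (NVar 0 \<^bold>+ NOne) [z] []"

definition Row :: "ntrm \<Rightarrow> strm \<Rightarrow> strm" where
  "Row x Z = SComp (bit2 (SVar 0) (NVar 1) (NVar 0)) (Len (SVar 0)) [x] [Z]"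

definition PAR :: "strm \<Rightarrow> oform" where
  "PAR X = (Len X \<^bold>\<in> SParity (Len X) X)"

text \<open>Here \<open>n \<times> n\<close> matrices over \<open>Z\<^sub>2\<close> are strings \<open>X\<close> with entries \<open>X(i,j)\<close>, \<open>i, j < n\<close>.\<close>

definition ID :: "ntrm \<Rightarrow> strm" where
  "ID n = SComp (obex (NVar 1) (NVar 1 \<^bold>= pair (NVar 0) (NVar 0))) (pair (NVar 0) (NVar 0)) [n] []"

text \<open>\<open>InnerProd n i j X Y\<close> is the set of all \<open>b < n\<close> with \<open>X(i,b)\<close> and \<open>Y(b,j)\<close>.\<close>

definition InnerProd :: "ntrm \<Rightarrow> ntrm \<Rightarrow> ntrm \<Rightarrow> strm \<Rightarrow> strm \<Rightarrow> strm" where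
  "InnerProd n i j X Y =
     SComp (bit2 (SVar 0) (NVar 2) (NVar 0) \<^bold>\<and> bit2 (SVar 1) (NVar 0) (NVar 3)) (NVar 0) [n, i, j] [X, Y]"

definition Prod2 :: "ntrm \<Rightarrow> strm \<Rightarrow> strm \<Rightarrow> strm" where
  "Prod2 n X Y =
     SComp (obex (NVar 1) (obex (NVar 2)
              (NVar 2 \<^bold>= pair (NVar 1) (NVar 0) \<^bold>\<and>
               PAR (InnerProd (NVar 3) (NVar 1) (NVar 0) (SVar 0) (SVar 1)))))
           (pair (NVar 0) (NVar 0)) [n] [X, Y]"

definition Pow2 :: "ntrm \<Rightarrow> ntrm \<Rightarrow> strm \<Rightarrow> strm" where
  "Pow2 n k X = Row k (SPowSeq n k X)"

subsection \<open>Axioms and proofs\<close>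

definition argN :: "ntrm list \<Rightarrow> nat \<Rightarrow> ntrm" where
  "argN ns = nth_default NZero ns"

definition argS :: "strm list \<Rightarrow> nat \<Rightarrow> strm" where
  "argS Xs = nth_default SEmpty Xs"

text \<open>
  Universal axioms, closed under substitution of terms for their variables: 2-BASIC with its
  existential axioms in Skolem form, the defining axioms of \<open>f\<^sub>p\<^sub>,\<^sub>b\<close> and \<open>F\<^sub>p\<^sub>,\<^sub>b\<close> (comprehension), of
  \<open>Parity\<close> (giving \<open>V\<^sup>0(2)\<close>) and of \<open>PowSeq\<^sub>2\<close> (iterated matrix powers).
\<close>

inductive VParL_axiom :: "oform \<Rightarrow> bool" where
  B1: "VParL_axiom (\<^bold>\<not> x \<^bold>+ NOne \<^bold>= NZero)"
| B2: "VParL_axiom (x \<^bold>+ NOne \<^bold>= y \<^bold>+ NOne \<^bold>\<longrightarrow> x \<^bold>= y)"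
| B3: "VParL_axiom (x \<^bold>+ NZero \<^bold>= x)"
| B4: "VParL_axiom (x \<^bold>+ (y \<^bold>+ NOne) \<^bold>= (x \<^bold>+ y) \<^bold>+ NOne)"
| B5: "VParL_axiom (x \<^bold>* NZero \<^bold>= NZero)"
| B6: "VParL_axiom (x \<^bold>* (y \<^bold>+ NOne) \<^bold>= (x \<^bold>* y) \<^bold>+ x)"
| B7: "VParL_axiom (x \<^bold>\<le> y \<^bold>\<and> y \<^bold>\<le> x \<^bold>\<longrightarrow> x \<^bold>= y)"
| B8: "VParL_axiom (x \<^bold>\<le> x \<^bold>+ y)"
| B9: "VParL_axiom (NZero \<^bold>\<le> x)"
| B10: "VParL_axiom (x \<^bold>\<le> y \<^bold>\<or> y \<^bold>\<le> x)"
| B11: "VParL_axiom (x \<^bold>\<le> y \<^bold>\<longleftrightarrow> x \<^bold>< y \<^bold>+ NOne)"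
| B12a: "VParL_axiom (npd NZero \<^bold>= NZero)"
| B12b: "VParL_axiom (\<^bold>\<not> x \<^bold>= NZero \<^bold>\<longrightarrow> npd x \<^bold>+ NOne \<^bold>= x)"
| L1: "VParL_axiom (y \<^bold>\<in> X \<^bold>\<longrightarrow> y \<^bold>< Len X)"
| L2: "VParL_axiom (y \<^bold>+ NOne \<^bold>= Len X \<^bold>\<longrightarrow> y \<^bold>\<in> X)"
| SE: "VParL_axiom (Len X \<^bold>= Len Y \<^bold>\<and>
         (nse X Y \<^bold>< Len X \<^bold>\<longrightarrow> (nse X Y \<^bold>\<in> X \<^bold>\<longleftrightarrow> nse X Y \<^bold>\<in> Y)) \<^bold>\<longrightarrow> X \<^bold>=\<^bold>= Y)"
| min_le: "VParL_axiom (NMin p b ns Xs \<^bold>\<le> nsub (argN ns) (argS Xs) b)"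
| min_holds: "VParL_axiom (NMin p b ns Xs \<^bold>< nsub (argN ns) (argS Xs) b
         \<^bold>\<longrightarrow> osub (case_nat (NMin p b ns Xs) (argN ns)) (argS Xs) p)"
| min_least: "VParL_axiom (z \<^bold>< NMin p b ns Xs \<^bold>\<longrightarrow> \<^bold>\<not> osub (case_nat z (argN ns)) (argS Xs) p)"
| comp: "VParL_axiom (z \<^bold>\<in> SComp p b ns Xs \<^bold>\<longleftrightarrow>
         z \<^bold>< nsub (argN ns) (argS Xs) b \<^bold>\<and> osub (case_nat z (argN ns)) (argS Xs) p)"
| parity_bound: "VParL_axiom (Len (SParity x X) \<^bold>\<le> x \<^bold>+ NOne)"
| parity_0: "VParL_axiom (\<^bold>\<not> NZero \<^bold>\<in> SParity x X)"
| parity_Suc: "VParL_axiom (z \<^bold>< x \<^bold>\<longrightarrow>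
         (z \<^bold>+ NOne \<^bold>\<in> SParity x X \<^bold>\<longleftrightarrow> (z \<^bold>\<in> X \<^bold>\<oplus> z \<^bold>\<in> SParity x X)))"
| powseq_bound: "VParL_axiom (Len (SPowSeq n k X) \<^bold>\<le> pair k (pair n n) \<^bold>+ NOne)"
| powseq_pairs: "VParL_axiom (z \<^bold>\<in> SPowSeq n k X \<^bold>\<longrightarrow> z \<^bold>= pair (nleft z) (nright z) \<^bold>\<and> nleft z \<^bold>\<le> k)"
| powseq_0: "VParL_axiom (Row NZero (SPowSeq n k X) \<^bold>=\<^bold>= ID n)"
| powseq_Suc: "VParL_axiom (z \<^bold>< k \<^bold>\<longrightarrow>
         Row (z \<^bold>+ NOne) (SPowSeq n k X) \<^bold>=\<^bold>= Prod2 n (Row z (SPowSeq n k X)) X)"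

text \<open>Two-sorted sequent calculus with equality.  Eigenvariables are the variables 0 of the premises.\<close>

inductive VParL_proves :: "form list \<Rightarrow> form list \<Rightarrow> bool" where
  "axiom": "VParL_axiom p \<Longrightarrow> VParL_proves [] [form_of p]"
| initial: "VParL_proves [A] [A]"
| structural: "VParL_proves \<Gamma> \<Delta> \<Longrightarrow> set \<Gamma> \<subseteq> set \<Gamma>' \<Longrightarrow> set \<Delta> \<subseteq> set \<Delta>' \<Longrightarrow> VParL_proves \<Gamma>' \<Delta>'"
| cut: "VParL_proves \<Gamma> (A # \<Delta>) \<Longrightarrow> VParL_proves (A # \<Gamma>) \<Delta> \<Longrightarrow> VParL_proves \<Gamma> \<Delta>"
| false_left: "VParL_proves [FFalse] []"
| true_right: "VParL_proves [] [FTrue]"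
| not_left: "VParL_proves \<Gamma> (A # \<Delta>) \<Longrightarrow> VParL_proves (FNot A # \<Gamma>) \<Delta>"
| not_right: "VParL_proves (A # \<Gamma>) \<Delta> \<Longrightarrow> VParL_proves \<Gamma> (FNot A # \<Delta>)"
| and_left: "VParL_proves (A # B # \<Gamma>) \<Delta> \<Longrightarrow> VParL_proves (FAnd A B # \<Gamma>) \<Delta>"
| and_right: "VParL_proves \<Gamma> (A # \<Delta>) \<Longrightarrow> VParL_proves \<Gamma> (B # \<Delta>) \<Longrightarrow> VParL_proves \<Gamma> (FAnd A B # \<Delta>)"
| or_left: "VParL_proves (A # \<Gamma>) \<Delta> \<Longrightarrow> VParL_proves (B # \<Gamma>) \<Delta> \<Longrightarrow> VParL_proves (FOr A B # \<Gamma>) \<Delta>"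
| or_right: "VParL_proves \<Gamma> (A # B # \<Delta>) \<Longrightarrow> VParL_proves \<Gamma> (FOr A B # \<Delta>)"
| allN_left: "VParL_proves (finstN t A # \<Gamma>) \<Delta> \<Longrightarrow> VParL_proves (FAllN A # \<Gamma>) \<Delta>"
| allN_right: "VParL_proves (map fliftN \<Gamma>) (A # map fliftN \<Delta>) \<Longrightarrow> VParL_proves \<Gamma> (FAllN A # \<Delta>)"
| exN_left: "VParL_proves (A # map fliftN \<Gamma>) (map fliftN \<Delta>) \<Longrightarrow> VParL_proves (FExN A # \<Gamma>) \<Delta>"
| exN_right: "VParL_proves \<Gamma> (finstN t A # \<Delta>) \<Longrightarrow> VParL_proves \<Gamma> (FExN A # \<Delta>)"
| allS_left: "VParL_proves (finstS X A # \<Gamma>) \<Delta> \<Longrightarrow> VParL_proves (FAllS A # \<Gamma>) \<Delta>"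
| allS_right: "VParL_proves (map fliftS \<Gamma>) (A # map fliftS \<Delta>) \<Longrightarrow> VParL_proves \<Gamma> (FAllS A # \<Delta>)"
| exS_left: "VParL_proves (A # map fliftS \<Gamma>) (map fliftS \<Delta>) \<Longrightarrow> VParL_proves (FExS A # \<Gamma>) \<Delta>"
| exS_right: "VParL_proves \<Gamma> (finstS X A # \<Delta>) \<Longrightarrow> VParL_proves \<Gamma> (FExS A # \<Delta>)"
| eqN_refl: "VParL_proves [] [FAtom (EqN t t)]"
| eqN_subst: "VParL_proves [FAtom (EqN t u), finstN t A] [finstN u A]"
| eqS_refl: "VParL_proves [] [FAtom (EqS X X)]"
| eqS_subst: "VParL_proves [FAtom (EqS X Y), finstS X A] [finstS Y A]"


section \<open>The translation\<close>

subsection \<open>Functions of the target theory used by the translation\<close>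

definition nmonus :: "ntrm \<Rightarrow> ntrm \<Rightarrow> ntrm" where
  "nmonus x y = NMin (NVar 1 \<^bold>\<le> NVar 2 \<^bold>+ NVar 0) (NVar 0) [x, y] []"

definition ndiv :: "ntrm \<Rightarrow> ntrm \<Rightarrow> ntrm" where
  "ndiv x y = NMin (NVar 2 \<^bold>= NZero \<^bold>\<or> NVar 1 \<^bold>< NVar 2 \<^bold>* (NVar 0 \<^bold>+ NOne)) (NVar 0 \<^bold>+ NOne) [x, y] []"

definition nrem :: "ntrm \<Rightarrow> ntrm \<Rightarrow> ntrm" where
  "nrem x y = nmonus x (y \<^bold>* ndiv x y)"

definition nmax :: "ntrm \<Rightarrow> ntrm \<Rightarrow> ntrm" where
  "nmax x y = NMin (NVar 1 \<^bold>\<le> NVar 0 \<^bold>\<and> NVar 2 \<^bold>\<le> NVar 0) (NVar 0 \<^bold>+ NVar 1 \<^bold>+ NOne) [x, y] []"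

definition ncond :: "oform \<Rightarrow> ntrm \<Rightarrow> ntrm \<Rightarrow> ntrm" where
  "ncond p m n = mu (m \<^bold>+ n \<^bold>+ NOne)
     (olift 1 p \<^bold>\<and> NVar 0 \<^bold>= nlift 1 m \<^bold>\<or> \<^bold>\<not> olift 1 p \<^bold>\<and> NVar 0 \<^bold>= nlift 1 n)"

definition scond :: "oform \<Rightarrow> strm \<Rightarrow> strm \<Rightarrow> strm" where
  "scond p X Y = compr (Len X \<^bold>+ Len Y)
     (olift 1 p \<^bold>\<and> NVar 0 \<^bold>\<in> slift 1 X \<^bold>\<or> \<^bold>\<not> olift 1 p \<^bold>\<and> NVar 0 \<^bold>\<in> slift 1 Y)"

text \<open>\<open>z = \<langle>i,j\<rangle>\<close> for some \<open>1 \<le> i \<le> m\<close>, \<open>1 \<le> j \<le> n\<close> with \<open>p\<close>.  As under \<open>\<lambda>\<^sub>i\<^sub>j\<close>, in \<open>p\<close> variable 1 is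
  \<open>i\<close> and variable 0 is \<open>j\<close>.\<close>

definition in_cells :: "ntrm \<Rightarrow> ntrm \<Rightarrow> ntrm \<Rightarrow> oform \<Rightarrow> oform" where
  "in_cells m n z p = obex (m \<^bold>+ NOne) (obex (nlift 1 n \<^bold>+ NOne)
     (NZero \<^bold>< NVar 1 \<^bold>\<and> NZero \<^bold>< NVar 0 \<^bold>\<and> nlift 2 z \<^bold>= pair (NVar 1) (NVar 0) \<^bold>\<and> p))"

text \<open>For some \<open>a\<close>, \<open>b\<close>: \<open>X\<close> contains \<open>\<langle>0,\<langle>a,b\<rangle>\<rangle>\<close>, and any other element is some \<open>\<langle>i,j\<rangle>\<close> with
  \<open>1 \<le> i \<le> a\<close>, \<open>1 \<le> j \<le> b\<close>.\<close>

definition isMatrix2 :: "strm \<Rightarrow> oform" where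
  "isMatrix2 X = osub NVar (\<lambda>_. X)
     (obex (Len (SVar 0) \<^bold>+ NOne) (obex (Len (SVar 0) \<^bold>+ NOne)
        (bit2 (SVar 0) NZero (pair (NVar 1) (NVar 0)) \<^bold>\<and>
         oball (Len (SVar 0)) (NVar 0 \<^bold>\<in> SVar 0 \<^bold>\<longrightarrow>
           NVar 0 \<^bold>= pair NZero (pair (NVar 2) (NVar 1)) \<^bold>\<or>
           in_cells (NVar 2) (NVar 1) (NVar 0) OTrue))))"

definition nrow :: "strm \<Rightarrow> ntrm" where
  "nrow X = NMin
     (isMatrix2 (SVar 0) \<^bold>\<and> obex (Len (SVar 0) \<^bold>+ NOne) (bit2 (SVar 0) NZero (pair (NVar 1) (NVar 0)))
      \<^bold>\<or> \<^bold>\<not> isMatrix2 (SVar 0) \<^bold>\<and> NVar 0 \<^bold>= NZero)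
     (Len (SVar 0) \<^bold>+ NOne) [] [X]"

definition ncol :: "strm \<Rightarrow> ntrm" where
  "ncol X = NMin
     (isMatrix2 (SVar 0) \<^bold>\<and> obex (Len (SVar 0) \<^bold>+ NOne) (bit2 (SVar 0) NZero (pair (NVar 0) (NVar 1)))
      \<^bold>\<or> \<^bold>\<not> isMatrix2 (SVar 0) \<^bold>\<and> NVar 0 \<^bold>= NZero)
     (Len (SVar 0) \<^bold>+ NOne) [] [X]"

text \<open>The code of the \<open>m \<times> n\<close> matrix with \<open>(i,j)\<close> entry \<open>p\<close>; the renaming of \<open>p\<close> makes room for the
  element variable of the comprehension.\<close>

definition smatrix :: "ntrm \<Rightarrow> ntrm \<Rightarrow> oform \<Rightarrow> strm" where
  "smatrix m n p = compr (pair NZero (pair m n) \<^bold>+ NOne)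
     (NVar 0 \<^bold>= pair NZero (pair (nlift 1 m) (nlift 1 n)) \<^bold>\<or>
      in_cells (nlift 1 m) (nlift 1 n) (NVar 0)
        (osub (\<lambda>k. NVar (if k < 2 then k else Suc k)) SVar p))"

definition oentry :: "strm \<Rightarrow> ntrm \<Rightarrow> ntrm \<Rightarrow> oform" where
  "oentry X m n = (bit2 X m n \<^bold>\<and> NZero \<^bold>< m \<^bold>\<and> NZero \<^bold>< n \<^bold>\<and> isMatrix2 X)"

text \<open>The coded matrix, padded with zeros to an \<open>s \<times> s\<close> matrix indexed from 0 as required by \<open>Pow2\<close>.\<close>

definition spad :: "ntrm \<Rightarrow> strm \<Rightarrow> strm" where
  "spad s X =
     SComp (obex (NVar 1) (obex (NVar 2)
              (NVar 2 \<^bold>= pair (NVar 1) (NVar 0) \<^bold>\<and> bit2 (SVar 0) (NVar 1 \<^bold>+ NOne) (NVar 0 \<^bold>+ NOne))))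
           (pair (NVar 0) (NVar 0)) [s] [X]"

definition spower :: "ntrm \<Rightarrow> strm \<Rightarrow> strm" where
  "spower m X =
     scond (\<^bold>\<not> isMatrix2 X) (smatrix NZero NZero OFalse)
    (scond (m \<^bold>= NZero) (smatrix (nrow X) (nrow X) (NVar 1 \<^bold>= NVar 0))
       (let s = nlift 2 (nmax (nrow X) (ncol X)) in
        smatrix (nrow X) (ncol X)
          (bit2 (Pow2 s (nlift 2 m) (spad s (slift 2 X))) (npd (NVar 1)) (npd (NVar 0)))))"

subsection \<open>Terms and formulas\<close>

text \<open>The index variable \<open>k\<close> becomes the number variable \<open>k\<close>; field and matrix variables become the
  string variables with even and odd numbers.\<close>

primrec tr_idx :: "lidx \<Rightarrow> ntrm"
  and tr_fld :: "lfld \<Rightarrow> oform"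
  and tr_mat :: "lmat \<Rightarrow> strm"
  and tr_cnd :: "lcnd \<Rightarrow> oform" where
  "tr_idx (IVar k) = NVar k"
| "tr_idx IZero = NZero"
| "tr_idx IOne = NOne"
| "tr_idx (IAdd m n) = tr_idx m \<^bold>+ tr_idx n"
| "tr_idx (IMul m n) = tr_idx m \<^bold>* tr_idx n"
| "tr_idx (IMinus m n) = nmonus (tr_idx m) (tr_idx n)"
| "tr_idx (IDiv m n) = ndiv (tr_idx m) (tr_idx n)"
| "tr_idx (IRem m n) = nrem (tr_idx m) (tr_idx n)"
| "tr_idx (IRow T) = nrow (tr_mat T)"
| "tr_idx (ICol T) = ncol (tr_mat T)"
| "tr_idx (ICond a m n) = ncond (tr_cnd a) (tr_idx m) (tr_idx n)"
| "tr_fld (KVar k) = bit2 (SVar (2 * k)) NOne NOne"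
| "tr_fld KZero = OFalse"
| "tr_fld KOne = OTrue"
| "tr_fld (KAdd t u) = (tr_fld t \<^bold>\<oplus> tr_fld u)"
| "tr_fld (KMul t u) = (tr_fld t \<^bold>\<and> tr_fld u)"
| "tr_fld (KSub t u) = (tr_fld t \<^bold>\<oplus> tr_fld u)"
| "tr_fld (KInv t) = tr_fld t"
| "tr_fld (KEntry T m n) = oentry (tr_mat T) (tr_idx m) (tr_idx n)"
| "tr_fld (KSum T) = (\<^bold>\<not> PAR (tr_mat T) \<^bold>\<and> isMatrix2 (tr_mat T))"
| "tr_fld (KCond a t u) = (tr_cnd a \<^bold>\<and> tr_fld t \<^bold>\<or> \<^bold>\<not> tr_cnd a \<^bold>\<and> tr_fld u)"
| "tr_mat (MVar k) = SVar (2 * k + 1)"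
| "tr_mat (MLam m n t) = smatrix (tr_idx m) (tr_idx n) (tr_fld t)"
| "tr_mat (MPow m T) = spower (tr_idx m) (tr_mat T)"
| "tr_cnd (CEq m n) = (tr_idx m \<^bold>= tr_idx n)"
| "tr_cnd (CLe m n) = (tr_idx m \<^bold>\<le> tr_idx n)"
| "tr_cnd (CNot a) = (\<^bold>\<not> tr_cnd a)"
| "tr_cnd (CAnd a b) = (tr_cnd a \<^bold>\<and> tr_cnd b)"
| "tr_cnd (COr a b) = (tr_cnd a \<^bold>\<or> tr_cnd b)"

text \<open>\<open>\<forall>x\<le>b. A\<close>, where \<open>A\<close> is in the scope of the quantifier but \<open>b\<close> is not.\<close>

definition fball_le :: "ntrm \<Rightarrow> form \<Rightarrow> form" where
  "fball_le b A = FAllN (FOr (FNot (FAtom (Le (NVar 0) (nlift 1 b)))) A)"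

definition feq_mat :: "strm \<Rightarrow> strm \<Rightarrow> form" where
  "feq_mat X Y =
     FAnd (FAtom (EqN (nrow X) (nrow Y))) (FAnd (FAtom (EqN (ncol X) (ncol Y)))
       (fball_le (Len X \<^bold>+ Len Y) (fball_le (nlift 1 (Len X \<^bold>+ Len Y))
          (form_of (oentry (slift 2 X) (NVar 1) (NVar 0) \<^bold>\<longleftrightarrow> oentry (slift 2 Y) (NVar 1) (NVar 0))))))"

primrec tr_fml :: "lfml \<Rightarrow> form" where
  "tr_fml (LEqI m n) = FAtom (EqN (tr_idx m) (tr_idx n))"
| "tr_fml (LLe m n) = FAtom (Le (tr_idx m) (tr_idx n))"
| "tr_fml (LEqK t u) = form_of (tr_fld t \<^bold>\<longleftrightarrow> tr_fld u)"
| "tr_fml (LEqM T U) = feq_mat (tr_mat T) (tr_mat U)"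
| "tr_fml (LNot a) = FNot (tr_fml a)"
| "tr_fml (LAnd a b) = FAnd (tr_fml a) (tr_fml b)"
| "tr_fml (LOr a b) = FOr (tr_fml a) (tr_fml b)"

end

theory Submission
  imports Defs "HOL-Library.Countable_Set"
begin

text \<open>
  Instead of building derivations in the target theory, we argue semantically.  The target theory is
  universal, so a maximal set of open formulas that refutes a given open sequent already yields a
  countable term model; hence an open sequent that is true in all such models is derivable.  In a model,
  induction for open formulas makes the number sort a discretely ordered semiring, every string is
  determined by its set of elements, and parity is additive on disjoint unions and invariant under
  injections whose graph is a string.  These facts suffice to check every axiom of LAP, the ones on
  \<open>\<Sigma>\<close> by decomposing the set of cells of a matrix.  Only the translation of matrix equations
  contains quantifiers; it is provably equivalent to an open formula, because the least counterexample
  to a bounded universal statement is a term.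
\<close>

section \<open>Substitution\<close>

text \<open>Two obstacles shape the argument. The models have induction only for open formulas of
  the vocabulary, with parameters. So every inductive claim must be written as such a formula, and a
  set or a map may enter one only if comprehension turns it, or its graph, into a string;
  \<open>intern\<close> keeps track of this. For the same reason parities are studied through the
  running parities given by \<open>SParity\<close>, and index maps are described by terms. The other
  obstacle is the coding. The header of a code is an element of its own, so the parity of a code is
  opposite to the sum of the entries. Strings that are not codes count as having no rows and no
  columns. The powers of the target theory are taken of square matrices indexed from 0, those of LAP
  of rectangular ones indexed from 1, and the power with exponent 0 has as many columns as rows. In
  the recursion equation of powers, the inner sums may therefore have another length than those
  computed on the padded matrix; only zero terms make the difference.\<close>

lemma sub_sub:
  "nsub f g (nsub f' g' t) = nsub (\<lambda>k. nsub f g (f' k)) (\<lambda>k. ssub f g (g' k)) t"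
  "ssub f g (ssub f' g' X) = ssub (\<lambda>k. nsub f g (f' k)) (\<lambda>k. ssub f g (g' k)) X"
  "asub f g (asub f' g' a) = asub (\<lambda>k. nsub f g (f' k)) (\<lambda>k. ssub f g (g' k)) a"
  "osub f g (osub f' g' p) = osub (\<lambda>k. nsub f g (f' k)) (\<lambda>k. ssub f g (g' k)) p"
  by (induction t and X and a and p) simp_all

lemma sub_id:
  "nsub NVar SVar t = t" "ssub NVar SVar X = X" "asub NVar SVar a = a" "osub NVar SVar p = p"
  by (induction t and X and a and p) (simp_all add: map_idI)

lemma foldr_max_le_iff: "foldr max xs (0::nat) \<le> n \<longleftrightarrow> (\<forall>x\<in>set xs. x \<le> n)"
  by (induction xs) auto

text \<open>Only finitely many variables matter to an expression. This lets substitutions be changed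
  one variable at a time in finitely many steps, and lets all variables of a formula be packed into
  the argument list of a function symbol.\<close>

lemma sub_cong:
  "(\<And>k. k < nvb_n t \<Longrightarrow> f k = f' k) \<Longrightarrow> (\<And>k. k < svb_n t \<Longrightarrow> g k = g' k) \<Longrightarrow> nsub f g t = nsub f' g' t"
  "(\<And>k. k < nvb_s X \<Longrightarrow> f k = f' k) \<Longrightarrow> (\<And>k. k < svb_s X \<Longrightarrow> g k = g' k) \<Longrightarrow> ssub f g X = ssub f' g' X"
  "(\<And>k. k < nvb_a a \<Longrightarrow> f k = f' k) \<Longrightarrow> (\<And>k. k < svb_a a \<Longrightarrow> g k = g' k) \<Longrightarrow> asub f g a = asub f' g' a"
  "(\<And>k. k < nvb_o p \<Longrightarrow> f k = f' k) \<Longrightarrow> (\<And>k. k < svb_o p \<Longrightarrow> g k = g' k) \<Longrightarrow> osub f g p = osub f' g' p"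
proof (induction t and X and a and p)
  case (NMin p b ns Xs)
  have le: "nvb_n t \<le> nvb_n (NMin p b ns Xs)" "svb_n t \<le> svb_n (NMin p b ns Xs)" if "t \<in> set ns" for t
    using that foldr_max_le_iff[of "map nvb_n ns"] foldr_max_le_iff[of "map svb_n ns"]
    by (auto simp: le_max_iff_disj)
  have le': "nvb_s t \<le> nvb_n (NMin p b ns Xs)" "svb_s t \<le> svb_n (NMin p b ns Xs)" if "t \<in> set Xs" for t
    using that foldr_max_le_iff[of "map nvb_s Xs"] foldr_max_le_iff[of "map svb_s Xs"]
    by (auto simp: le_max_iff_disj)
  have "nsub f g t = nsub f' g' t" if "t \<in> set ns" for t
    using NMin.IH(3)[OF that] NMin.prems le[OF that] by (meson less_le_trans)
  moreover have "ssub f g t = ssub f' g' t" if "t \<in> set Xs" for t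
    using NMin.IH(4)[OF that] NMin.prems le'[OF that] by (meson less_le_trans)
  ultimately show ?case by simp
next
  case (SComp p b ns Xs)
  have le: "nvb_n t \<le> nvb_s (SComp p b ns Xs)" "svb_n t \<le> svb_s (SComp p b ns Xs)" if "t \<in> set ns" for t
    using that foldr_max_le_iff[of "map nvb_n ns"] foldr_max_le_iff[of "map svb_n ns"]
    by (auto simp: le_max_iff_disj)
  have le': "nvb_s t \<le> nvb_s (SComp p b ns Xs)" "svb_s t \<le> svb_s (SComp p b ns Xs)" if "t \<in> set Xs" for t
    using that foldr_max_le_iff[of "map nvb_s Xs"] foldr_max_le_iff[of "map svb_s Xs"]
    by (auto simp: le_max_iff_disj)
  have "nsub f g t = nsub f' g' t" if "t \<in> set ns" for t
    using SComp.IH(3)[OF that] SComp.prems le[OF that] by (meson less_le_trans)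
  moreover have "ssub f g t = ssub f' g' t" if "t \<in> set Xs" for t
    using SComp.IH(4)[OF that] SComp.prems le'[OF that] by (meson less_le_trans)
  ultimately show ?case by simp
qed auto

lemma fsub_form_of [simp]: "fsub f g (form_of p) = form_of (osub f g p)"
  by (induction p) simp_all


text \<open>Needed to represent the classes of number terms by natural numbers.\<close>

instance ntrm :: countable
  by countable_datatype

section \<open>Completeness for open sequents\<close>

definition oprov :: "oform list \<Rightarrow> oform list \<Rightarrow> bool" where
  "oprov \<Gamma> \<Delta> \<longleftrightarrow> VParL_proves (map form_of \<Gamma>) (map form_of \<Delta>)"

lemma oprov_structural:
  "oprov \<Gamma> \<Delta> \<Longrightarrow> set \<Gamma> \<subseteq> set \<Gamma>' \<Longrightarrow> set \<Delta> \<subseteq> set \<Delta>' \<Longrightarrow> oprov \<Gamma>' \<Delta>'"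
  unfolding oprov_def by (erule VParL_proves.structural) auto

lemma oprov_cut:
  assumes "oprov \<Gamma> (p # \<Delta>)" "oprov (p # \<Gamma>') \<Delta>" shows "oprov (\<Gamma> @ \<Gamma>') \<Delta>"
proof -
  have "oprov (\<Gamma> @ \<Gamma>') (p # \<Delta>)" "oprov (p # \<Gamma> @ \<Gamma>') \<Delta>"
    by (rule oprov_structural[OF assms(1)] oprov_structural[OF assms(2)]; auto)+
  then show ?thesis
    unfolding oprov_def using VParL_proves.cut by fastforce
qed

text \<open>\<open>M\<close> is the set of open formulas that are true in a term model, with free
  variables acting as constants. Without quantifiers no witnesses have to be supplied, so deciding
  negations and disjunctions is all that truth requires.\<close>

locale truth_set =
  fixes M :: "oform set"
  assumes axiom_mem: "VParL_axiom p \<Longrightarrow> p \<in> M"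
    and false_mem [simp]: "OFalse \<notin> M"
    and true_mem [simp]: "OTrue \<in> M"
    and not_mem [simp]: "(\<^bold>\<not> p) \<in> M \<longleftrightarrow> p \<notin> M"
    and and_mem [simp]: "(p \<^bold>\<and> q) \<in> M \<longleftrightarrow> p \<in> M \<and> q \<in> M"
    and or_mem [simp]: "(p \<^bold>\<or> q) \<in> M \<longleftrightarrow> p \<in> M \<or> q \<in> M"
    and eqN_refl_mem: "(t \<^bold>= t) \<in> M"
    and eqS_refl_mem: "(X \<^bold>=\<^bold>= X) \<in> M"
    and eqN_subst_mem: "(t \<^bold>= u) \<in> M \<Longrightarrow> osub (case_nat t NVar) SVar p \<in> M
      \<Longrightarrow> osub (case_nat u NVar) SVar p \<in> M"
    and eqS_subst_mem: "(X \<^bold>=\<^bold>= Y) \<in> M \<Longrightarrow> osub NVar (case_nat X SVar) p \<in> M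
      \<Longrightarrow> osub NVar (case_nat Y SVar) p \<in> M"

theorem open_completeness:
  assumes "\<And>M. truth_set M \<Longrightarrow> set \<Gamma> \<subseteq> M \<Longrightarrow> set \<Delta> \<inter> M = {} \<Longrightarrow> False"
  shows "VParL_proves (map form_of \<Gamma>) (map form_of \<Delta>)"
proof (rule ccontr)
  assume "\<not> VParL_proves (map form_of \<Gamma>) (map form_of \<Delta>)"
  then have unprov: "\<not> oprov \<Gamma> \<Delta>" by (simp add: oprov_def)
  \<comment> \<open>\<Delta> stays fixed on the right: a set is consistent if no finite part of it
    proves \<Delta>. A maximal consistent set then contains no formula of \<Delta>.\<close>
  define \<A> where "\<A> = {S. set \<Gamma> \<subseteq> S \<and> (\<forall>L. set L \<subseteq> S \<longrightarrow> \<not> oprov L \<Delta>)}"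
  have "\<exists>M\<in>\<A>. \<forall>S\<in>\<A>. M \<subseteq> S \<longrightarrow> S = M"
  proof (rule subset_Zorn_nonempty)
    show "\<A> \<noteq> {}"
      using unprov oprov_structural[of _ \<Delta> \<Gamma> \<Delta>] by (auto simp: \<A>_def)
  next
    fix \<C> assume C: "\<C> \<noteq> {}" "subset.chain \<A> \<C>"
    have "\<not> oprov L \<Delta>" if L: "set L \<subseteq> \<Union>\<C>" for L
    proof -
      from finite_subset_Union_chain[OF _ L C] obtain S where "S \<in> \<C>" "set L \<subseteq> S" by auto
      with C show ?thesis by (auto simp: \<A>_def subset.chain_def)
    qed
    moreover obtain S where "S \<in> \<C>" using C by blast
    moreover have "S \<in> \<A>" using C \<open>S \<in> \<C>\<close> by (auto simp: subset.chain_def)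
    ultimately show "\<Union>\<C> \<in> \<A>"
      by (auto simp: \<A>_def)
  qed
  then obtain M where M: "M \<in> \<A>" and maximal: "\<And>S. S \<in> \<A> \<Longrightarrow> M \<subseteq> S \<Longrightarrow> S = M" by blast
  have consistent: "\<not> oprov L \<Delta>" if "set L \<subseteq> M" for L
    using M that by (auto simp: \<A>_def)
  have refuted: "\<exists>L. set L \<subseteq> M \<and> oprov (p # L) \<Delta>" if "p \<notin> M" for p
  proof -
    have "insert p M \<notin> \<A>" using maximal[of "insert p M"] that by auto
    with M obtain L where L: "set L \<subseteq> insert p M" "oprov L \<Delta>" by (auto simp: \<A>_def)
    then have "oprov (p # filter (\<lambda>q. q \<noteq> p) L) \<Delta>"
      by (auto intro: oprov_structural)
    moreover have "set (filter (\<lambda>q. q \<noteq> p) L) \<subseteq> M" using L by auto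
    ultimately show ?thesis by blast
  qed
  have closed: "p \<in> M" if "set L \<subseteq> M" "oprov L (p # \<Delta>)" for p L
  proof (rule ccontr)
    assume "p \<notin> M"
    then obtain L' where "set L' \<subseteq> M" "oprov (p # L') \<Delta>" using refuted by blast
    with that consistent[of "L @ L'"] oprov_cut show False by auto
  qed
  have deduct: "p \<in> M" if "set L \<subseteq> M" "VParL_proves (map form_of L) [form_of p]" for p L
    using that oprov_structural[of L "[p]" L "p # \<Delta>"] by (intro closed[of L]) (auto simp: oprov_def)
  have init: "VParL_proves \<Gamma>' \<Delta>'" if "A \<in> set \<Gamma>'" "A \<in> set \<Delta>'" for A \<Gamma>' \<Delta>'
    using that by (intro VParL_proves.structural[OF VParL_proves.initial[of A]]) auto
  have "truth_set M"
  proof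
    fix p q :: oform and t u X Y
    show "p \<in> M" if "VParL_axiom p"
      using deduct[of "[]" p] VParL_proves.axiom[OF that] by simp
    show "OFalse \<notin> M"
    proof
      assume "OFalse \<in> M"
      moreover have "oprov [OFalse] \<Delta>"
        using oprov_structural[of "[OFalse]" "[]" "[OFalse]" \<Delta>] VParL_proves.false_left
        by (simp add: oprov_def)
      ultimately show False using consistent[of "[OFalse]"] by simp
    qed
    show "OTrue \<in> M"
      using deduct[of "[]" OTrue] VParL_proves.true_right by simp
    show "(\<^bold>\<not> p) \<in> M \<longleftrightarrow> p \<notin> M"
    proof
      show "p \<notin> M" if "(\<^bold>\<not> p) \<in> M"
      proof
        assume "p \<in> M"
        moreover have "oprov [\<^bold>\<not> p, p] \<Delta>"
          unfolding oprov_def by (simp, rule VParL_proves.not_left, rule init) auto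
        ultimately show False using that consistent[of "[\<^bold>\<not> p, p]"] by simp
      qed
      show "(\<^bold>\<not> p) \<in> M" if "p \<notin> M"
        using refuted[OF that] closed[of _ "\<^bold>\<not> p"] VParL_proves.not_right[of "form_of p"]
        by (auto simp: oprov_def)
    qed
    show "(p \<^bold>\<and> q) \<in> M \<longleftrightarrow> p \<in> M \<and> q \<in> M"
    proof (intro iffI conjI)
      assume "(p \<^bold>\<and> q) \<in> M"
      moreover have "VParL_proves [form_of (p \<^bold>\<and> q)] [form_of p]"
        "VParL_proves [form_of (p \<^bold>\<and> q)] [form_of q]"
        by (simp, rule VParL_proves.and_left, rule init; auto)+
      ultimately show "p \<in> M" "q \<in> M"
        using deduct[of "[p \<^bold>\<and> q]" p] deduct[of "[p \<^bold>\<and> q]" q] by simp_all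
    next
      assume "p \<in> M \<and> q \<in> M"
      moreover have "VParL_proves [form_of p, form_of q] [form_of (p \<^bold>\<and> q)]"
        by (simp, rule VParL_proves.and_right; rule init) auto
      ultimately show "(p \<^bold>\<and> q) \<in> M" using deduct[of "[p, q]" "p \<^bold>\<and> q"] by simp
    qed
    show "(p \<^bold>\<or> q) \<in> M \<longleftrightarrow> p \<in> M \<or> q \<in> M"
    proof
      assume pq: "(p \<^bold>\<or> q) \<in> M"
      show "p \<in> M \<or> q \<in> M"
      proof (rule ccontr)
        assume "\<not> (p \<in> M \<or> q \<in> M)"
        then obtain L L' where L: "set L \<subseteq> M" "oprov (p # L) \<Delta>" "set L' \<subseteq> M" "oprov (q # L') \<Delta>"
          using refuted by meson
        then have "oprov (p # L @ L') \<Delta>" "oprov (q # L @ L') \<Delta>"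
          by (auto intro: oprov_structural)
        then have "oprov ((p \<^bold>\<or> q) # L @ L') \<Delta>"
          by (auto simp: oprov_def intro: VParL_proves.or_left)
        then show False using consistent[of "(p \<^bold>\<or> q) # L @ L'"] pq L by auto
      qed
    next
      have "VParL_proves [form_of p] [form_of (p \<^bold>\<or> q)]" "VParL_proves [form_of q] [form_of (p \<^bold>\<or> q)]"
        by (simp, rule VParL_proves.or_right, rule init[of "form_of p"], simp, simp)
           (simp, rule VParL_proves.or_right, rule init[of "form_of q"], simp, simp)
      then show "p \<in> M \<or> q \<in> M \<Longrightarrow> (p \<^bold>\<or> q) \<in> M"
        using deduct[of "[p]" "p \<^bold>\<or> q"] deduct[of "[q]" "p \<^bold>\<or> q"] by auto
    qed
    show "(t \<^bold>= t) \<in> M" "(X \<^bold>=\<^bold>= X) \<in> M"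
      using deduct[of "[]" "t \<^bold>= t"] deduct[of "[]" "X \<^bold>=\<^bold>= X"]
        VParL_proves.eqN_refl VParL_proves.eqS_refl by simp_all
    show "osub (case_nat u NVar) SVar p \<in> M" if "(t \<^bold>= u) \<in> M" "osub (case_nat t NVar) SVar p \<in> M"
      using deduct[of "[t \<^bold>= u, osub (case_nat t NVar) SVar p]" "osub (case_nat u NVar) SVar p"] that
        VParL_proves.eqN_subst[of t u "form_of p"] by simp
    show "osub NVar (case_nat Y SVar) p \<in> M" if "(X \<^bold>=\<^bold>= Y) \<in> M" "osub NVar (case_nat X SVar) p \<in> M"
      using deduct[of "[X \<^bold>=\<^bold>= Y, osub NVar (case_nat X SVar) p]" "osub NVar (case_nat Y SVar) p"] that
        VParL_proves.eqS_subst[of X Y "form_of p"] by simp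
  qed
  moreover have "set \<Gamma> \<subseteq> M" using M by (simp add: \<A>_def)
  moreover have "set \<Delta> \<inter> M = {}"
  proof -
    have "p \<notin> M" if "p \<in> set \<Delta>" for p
      using consistent[of "[p]"] init[of "form_of p" "[form_of p]" "map form_of \<Delta>"] that
      by (auto simp: oprov_def)
    then show ?thesis by auto
  qed
  ultimately show False by (rule assms)
qed

lemma inst_lift [simp]:
  "nsub (case_nat t f) g (nsub (\<lambda>k. NVar (Suc k)) SVar u) = nsub f g u"
  "ssub (case_nat t f) g (ssub (\<lambda>k. NVar (Suc k)) SVar X) = ssub f g X"
  "osub (case_nat t f) g (osub (\<lambda>k. NVar (Suc k)) SVar p) = osub f g p"
  by (simp_all add: sub_sub)

context truth_set
begin

text \<open>The equality axioms of the calculus, strengthened to simultaneous replacement of all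
  arguments by provably equal ones.\<close>

lemma osub_cong_mem:
  assumes "\<And>k. (f k \<^bold>= f' k) \<in> M" "\<And>k. (g k \<^bold>=\<^bold>= g' k) \<in> M" "osub f g p \<in> M"
  shows "osub f' g' p \<in> M"
proof -
  \<comment> \<open>The substitution axioms replace one variable only, so the variables are treated one by one.\<close>
  have "osub (\<lambda>k. if k < n then f' k else f k) g p \<in> M" for n
  proof (induction n)
    case 0
    with assms(3) show ?case by simp
  next
    case (Suc n)
    \<comment> \<open>Variable 0 is a placeholder for the argument exchanged in this step; the other
      arguments are lifted so that it is fresh.\<close>
    let ?h = "\<lambda>k. if k = n then NVar 0 else nlift 1 (if k < n then f' k else f k)"
    have "osub (case_nat (f n) NVar) SVar (osub ?h (\<lambda>k. slift 1 (g k)) p) \<in> M"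
      using Suc by (simp add: sub_sub sub_id if_distrib[of "nsub _ _"] cong: if_cong)
         (erule back_subst[of "\<lambda>p. p \<in> M"], rule sub_cong, auto)
    then have "osub (case_nat (f' n) NVar) SVar (osub ?h (\<lambda>k. slift 1 (g k)) p) \<in> M"
      using eqN_subst_mem assms(1) by blast
    then show ?case
      by (simp add: sub_sub sub_id if_distrib[of "nsub _ _"] cong: if_cong)
         (erule back_subst[of "\<lambda>p. p \<in> M"], rule sub_cong, auto)
  qed
  \<comment> \<open>No variable from \<open>nvb_o p\<close> on occurs in \<open>p\<close>, so all
    occurring variables have been treated.\<close>
  from this[of "nvb_o p"] have f': "osub f' g p \<in> M"
    by (rule back_subst[of "\<lambda>p. p \<in> M"]) (rule sub_cong, auto)
  have "osub f' (\<lambda>k. if k < n then g' k else g k) p \<in> M" for n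
  proof (induction n)
    case 0
    with f' show ?case by simp
  next
    case (Suc n)
    let ?up = "ssub NVar (\<lambda>k. SVar (Suc k))"
    let ?h = "\<lambda>k. if k = n then SVar 0 else ?up (if k < n then g' k else g k)"
    let ?q = "osub (\<lambda>k. nsub NVar (\<lambda>k. SVar (Suc k)) (f' k)) ?h p"
    have "osub NVar (case_nat (g n) SVar) ?q \<in> M"
      using Suc by (simp add: sub_sub sub_id if_distrib[of "ssub _ _"] cong: if_cong)
         (erule back_subst[of "\<lambda>p. p \<in> M"], rule sub_cong, auto)
    then have "osub NVar (case_nat (g' n) SVar) ?q \<in> M"
      using eqS_subst_mem assms(2) by blast
    then show ?case
      by (simp add: sub_sub sub_id if_distrib[of "ssub _ _"] cong: if_cong)
         (erule back_subst[of "\<lambda>p. p \<in> M"], rule sub_cong, auto)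
  qed
  from this[of "svb_o p"] show ?thesis
    by (rule back_subst[of "\<lambda>p. p \<in> M"]) (rule sub_cong, auto)
qed

lemma eqN_sym_mem: "(t \<^bold>= u) \<in> M \<Longrightarrow> (u \<^bold>= t) \<in> M"
  using eqN_subst_mem[of t u "NVar 0 \<^bold>= nlift (Suc 0) t"] eqN_refl_mem[of t] by (simp add: sub_id)

lemma eqN_trans_mem: "(t \<^bold>= u) \<in> M \<Longrightarrow> (u \<^bold>= v) \<in> M \<Longrightarrow> (t \<^bold>= v) \<in> M"
  using eqN_subst_mem[of u v "nlift (Suc 0) t \<^bold>= NVar 0"] by (simp add: sub_id)

lemma eqS_sym_mem:
  assumes "(X \<^bold>=\<^bold>= Y) \<in> M" shows "(Y \<^bold>=\<^bold>= X) \<in> M"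
  using eqS_subst_mem[OF assms, of "SVar 0 \<^bold>=\<^bold>= ssub NVar (\<lambda>k. SVar (Suc k)) X"] eqS_refl_mem[of X]
  by (simp add: sub_sub sub_id)

lemma sub_cong_mem:
  assumes "\<And>k. (f k \<^bold>= f' k) \<in> M" "\<And>k. (g k \<^bold>=\<^bold>= g' k) \<in> M"
  shows "(nsub f g t \<^bold>= nsub f' g' t) \<in> M" "(ssub f g X \<^bold>=\<^bold>= ssub f' g' X) \<in> M"
    "osub f g p \<in> M \<longleftrightarrow> osub f' g' p \<in> M"
proof -
  \<comment> \<open>Two copies of the term, with even and odd variables, reduce equations to the case of formulas.\<close>
  let ?even = "\<lambda>k. 2 * k" and ?odd = "\<lambda>k. 2 * k + 1"
  let ?f = "\<lambda>k. if even k then f (k div 2) else f' (k div 2)"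
  let ?g = "\<lambda>k. if even k then g (k div 2) else g' (k div 2)"
  have h: "(f (k div 2) \<^bold>= ?f k) \<in> M" "(g (k div 2) \<^bold>=\<^bold>= ?g k) \<in> M" for k
    using assms eqN_refl_mem eqS_refl_mem by auto
  note c = osub_cong_mem[of "\<lambda>k. f (k div 2)" ?f "\<lambda>k. g (k div 2)" ?g, OF h]
  show "(nsub f g t \<^bold>= nsub f' g' t) \<in> M"
    using c[of "nsub (\<lambda>k. NVar (?even k)) (\<lambda>k. SVar (?even k)) t \<^bold>=
        nsub (\<lambda>k. NVar (?odd k)) (\<lambda>k. SVar (?odd k)) t"] eqN_refl_mem[of "nsub f g t"]
    by (simp add: sub_sub)
  show "(ssub f g X \<^bold>=\<^bold>= ssub f' g' X) \<in> M"
    using c[of "ssub (\<lambda>k. NVar (?even k)) (\<lambda>k. SVar (?even k)) X \<^bold>=\<^bold>=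
        ssub (\<lambda>k. NVar (?odd k)) (\<lambda>k. SVar (?odd k)) X"] eqS_refl_mem[of "ssub f g X"]
    by (simp add: sub_sub)
  show "osub f g p \<in> M \<longleftrightarrow> osub f' g' p \<in> M"
    using osub_cong_mem[of f f' g g' p, OF assms]
      osub_cong_mem[of f' f g' g p, OF eqN_sym_mem[OF assms(1)] eqS_sym_mem[OF assms(2)]] by blast
qed

end

text \<open>
  The quotient of the number terms by the equations in \<open>M\<close> is represented by a whole type \<open>'n\<close> and a
  surjection onto it, so that the type class locales of ordered semirings can be interpreted.  It is
  infinite and countable; hence \<open>'n = nat\<close> is always possible.
\<close>

locale vmodel = truth_set M for M :: "oform set" +
  fixes qn :: "ntrm \<Rightarrow> 'n"
  assumes surj_qn: "surj qn"
    and qn_eq_iff: "qn t = qn u \<longleftrightarrow> (t \<^bold>= u) \<in> M"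

text \<open>B1 and B2 make the numerals pairwise different, so there are infinitely many classes. A
  countably infinite set has an enumeration onto all natural numbers, as surjectivity of
  \<open>qn\<close> demands.\<close>

lemma (in truth_set) ex_vmodel: "\<exists>qn :: ntrm \<Rightarrow> nat. vmodel M qn"
proof -
  define c where "c t = {u. (t \<^bold>= u) \<in> M}" for t
  have c_eq: "c t = c u \<longleftrightarrow> (t \<^bold>= u) \<in> M" for t u
  proof
    assume "c t = c u"
    with eqN_refl_mem[of u] show "(t \<^bold>= u) \<in> M" by (auto simp: c_def)
  next
    assume tu: "(t \<^bold>= u) \<in> M"
    show "c t = c u"
      unfolding c_def using eqN_trans_mem[OF tu] eqN_trans_mem[OF eqN_sym_mem[OF tu]] by blast
  qed
  define num where "num = rec_nat NZero (\<lambda>_ t. t \<^bold>+ NOne)"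
  have num: "num 0 = NZero" "num (Suc n) = num n \<^bold>+ NOne" for n
    by (simp_all add: num_def)
  have Suc_ne: "c (t \<^bold>+ NOne) \<noteq> c NZero" for t
    using axiom_mem[OF B1, of t] by (simp add: c_eq)
  have Suc_inj: "c (t \<^bold>+ NOne) = c (u \<^bold>+ NOne) \<Longrightarrow> c t = c u" for t u
    using axiom_mem[OF B2, of t u] by (simp add: c_eq)
  have "c (num m) = c (num n) \<Longrightarrow> m = n" for m n
  proof (induction m arbitrary: n)
    case 0
    then show ?case using Suc_ne[THEN not_sym] by (cases n) (simp_all add: num)
  next
    case (Suc m)
    show ?case
    proof (cases n)
      case 0
      with Suc.prems Suc_ne[of "num m"] show ?thesis by (simp add: num)
    next
      case (Suc k)
      with Suc.prems have "c (num m) = c (num k)" by - (rule Suc_inj, simp add: num)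
      with Suc.IH[of k] Suc show ?thesis by blast
    qed
  qed
  then have "inj (c \<circ> num)" unfolding inj_on_def o_apply by blast
  then have inf: "infinite (range c)"
    using finite_subset[of "range (c \<circ> num)" "range c"] range_inj_infinite[of "c \<circ> num"] by fastforce
  then have bij: "bij_betw (to_nat_on (range c)) (range c) UNIV"
    using to_nat_on_infinite[of "range c"] by simp
  have "surj (to_nat_on (range c) \<circ> c)"
    using bij by (metis bij_betw_imp_surj_on image_comp)
  moreover have "inj_on (to_nat_on (range c)) (range c)"
    using bij by (simp add: bij_betw_def)
  ultimately have "vmodel M (to_nat_on (range c) \<circ> c)"
    using c_eq by (intro_locales, intro vmodel_axioms.intro) (simp_all only: o_apply inj_on_eq_iff[OF _ rangeI rangeI])
  then show ?thesis by blast
qed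

theorem open_model_completeness:
  assumes "\<And>M (qn :: ntrm \<Rightarrow> nat). vmodel M qn \<Longrightarrow> set \<Gamma> \<subseteq> M \<Longrightarrow> set \<Delta> \<inter> M \<noteq> {}"
  shows "VParL_proves (map form_of \<Gamma>) (map form_of \<Delta>)"
proof (rule open_completeness)
  fix M assume M: "truth_set M" "set \<Gamma> \<subseteq> M" "set \<Delta> \<inter> M = {}"
  then obtain qn :: "ntrm \<Rightarrow> nat" where "vmodel M qn" using truth_set.ex_vmodel by blast
  with assms M show False by blast
qed

section \<open>Arithmetic of the number sort\<close>

context vmodel
begin

text \<open>A choice of representatives. The operations below are defined through it; congruence of
  equality makes the choice immaterial.\<close>

definition rn :: "'n \<Rightarrow> ntrm" where "rn = inv qn"

lemma qn_rn [simp]: "qn (rn x) = x"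
  by (simp add: rn_def surj_f_inv_f surj_qn)

lemma qn_cong: "(\<And>k. qn (f k) = qn (f' k)) \<Longrightarrow> (\<And>k. (g k \<^bold>=\<^bold>= g' k) \<in> M) \<Longrightarrow> qn (nsub f g t) = qn (nsub f' g' t)"
  unfolding qn_eq_iff by (rule sub_cong_mem)

lemma mem_cong: "(\<And>k. qn (f k) = qn (f' k)) \<Longrightarrow> (\<And>k. (g k \<^bold>=\<^bold>= g' k) \<in> M) \<Longrightarrow> osub f g p \<in> M \<longleftrightarrow> osub f' g' p \<in> M"
  unfolding qn_eq_iff by (rule sub_cong_mem)

definition nzero :: 'n ("\<zero>") where "\<zero> = qn NZero"
definition none :: 'n ("\<one>") where "\<one> = qn NOne"
definition nplus :: "'n \<Rightarrow> 'n \<Rightarrow> 'n" (infixl "\<oplus>" 65) where "x \<oplus> y = qn (rn x \<^bold>+ rn y)"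
definition ntimes :: "'n \<Rightarrow> 'n \<Rightarrow> 'n" (infixl "\<otimes>" 70) where "x \<otimes> y = qn (rn x \<^bold>* rn y)"
definition nle :: "'n \<Rightarrow> 'n \<Rightarrow> bool" (infix "\<sqsubseteq>" 50) where "x \<sqsubseteq> y \<longleftrightarrow> (rn x \<^bold>\<le> rn y) \<in> M"
definition nless :: "'n \<Rightarrow> 'n \<Rightarrow> bool" (infix "\<sqsubset>" 50) where "x \<sqsubset> y \<longleftrightarrow> x \<sqsubseteq> y \<and> x \<noteq> y"

lemma qn_add [simp]: "qn (t \<^bold>+ u) = qn t \<oplus> qn u"
  using qn_cong[of "case_nat t (\<lambda>_. u)" "case_nat (rn (qn t)) (\<lambda>_. rn (qn u))" SVar SVar
      "NVar 0 \<^bold>+ NVar (Suc 0)"] eqS_refl_mem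
  by (simp add: nplus_def split: nat.split)

lemma qn_mult [simp]: "qn (t \<^bold>* u) = qn t \<otimes> qn u"
  using qn_cong[of "case_nat t (\<lambda>_. u)" "case_nat (rn (qn t)) (\<lambda>_. rn (qn u))" SVar SVar
      "NVar 0 \<^bold>* NVar (Suc 0)"] eqS_refl_mem
  by (simp add: ntimes_def split: nat.split)

lemma qn_const [simp]: "qn NZero = \<zero>" "qn NOne = \<one>"
  by (simp_all add: nzero_def none_def)

lemma eq_mem_iff [simp]: "(t \<^bold>= u) \<in> M \<longleftrightarrow> qn t = qn u"
  by (simp add: qn_eq_iff)

lemma le_mem_iff [simp]: "(t \<^bold>\<le> u) \<in> M \<longleftrightarrow> qn t \<sqsubseteq> qn u"
  using mem_cong[of "case_nat t (\<lambda>_. u)" "case_nat (rn (qn t)) (\<lambda>_. rn (qn u))" SVar SVar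
      "NVar 0 \<^bold>\<le> NVar (Suc 0)"] eqS_refl_mem
  by (simp add: nle_def split: nat.split)

lemma lt_mem_iff [simp]: "qn t \<sqsubseteq> qn u \<and> qn t \<noteq> qn u \<longleftrightarrow> qn t \<sqsubset> qn u"
  by (simp add: nless_def)

lemma
  shows B1: "x \<oplus> \<one> \<noteq> \<zero>" and B2: "x \<oplus> \<one> = y \<oplus> \<one> \<Longrightarrow> x = y"
    and B3: "x \<oplus> \<zero> = x" and B4: "x \<oplus> (y \<oplus> \<one>) = (x \<oplus> y) \<oplus> \<one>"
    and B5: "x \<otimes> \<zero> = \<zero>" and B6: "x \<otimes> (y \<oplus> \<one>) = (x \<otimes> y) \<oplus> x"
    and B7: "x \<sqsubseteq> y \<Longrightarrow> y \<sqsubseteq> x \<Longrightarrow> x = y" and B8: "x \<sqsubseteq> x \<oplus> y" and B9: "\<zero> \<sqsubseteq> x"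
    and B10: "x \<sqsubseteq> y \<or> y \<sqsubseteq> x" and B11: "x \<sqsubseteq> y \<longleftrightarrow> x \<sqsubset> y \<oplus> \<one>"
  using axiom_mem[OF VParL_axiom.B1, of "rn x"] axiom_mem[OF VParL_axiom.B2, of "rn x" "rn y"]
    axiom_mem[OF VParL_axiom.B3, of "rn x"] axiom_mem[OF VParL_axiom.B4, of "rn x" "rn y"]
    axiom_mem[OF VParL_axiom.B5, of "rn x"] axiom_mem[OF VParL_axiom.B6, of "rn x" "rn y"]
    axiom_mem[OF VParL_axiom.B7, of "rn x" "rn y"] axiom_mem[OF VParL_axiom.B8, of "rn x" "rn y"]
    axiom_mem[OF VParL_axiom.B9, of "rn x"] axiom_mem[OF VParL_axiom.B10, of "rn x" "rn y"]
    axiom_mem[OF VParL_axiom.B11, of "rn x" "rn y"]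
  by (simp_all del: lt_mem_iff) (auto simp: nless_def)

lemma pred_exists: "x \<noteq> \<zero> \<Longrightarrow> \<exists>y. x = y \<oplus> \<one>"
  using axiom_mem[OF VParL_axiom.B12b, of "rn x"] by simp metis

lemma nle_refl: "x \<sqsubseteq> x"
  using B8[of x "\<zero>"] by (simp add: B3)

lemma lt_Suc: "x \<sqsubset> x \<oplus> \<one>"
  using B11 nle_refl by blast

text \<open>A function symbol sees nothing but its arguments. The values of all variables of
  \<open>p\<close> are therefore passed to a minimization symbol whose formula is a renaming of
  \<open>p\<close>.\<close>

lemma least_mem:
  assumes "osub (case_nat t f) g p \<in> M"
  obtains m where "osub (case_nat m f) g p \<in> M"
    "\<And>z. qn z \<sqsubset> qn m \<Longrightarrow> osub (case_nat z f) g p \<notin> M"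
proof -
  define ns Xs where "ns = map f [0..<nvb_o p]" and "Xs = map g [0..<svb_o p]"
  \<comment> \<open>Argument 0 carries the known solution \<open>t\<close>, so the parameters of
    \<open>p\<close> move up by one. The search bound becomes \<open>t\<close> plus one, which
    leaves \<open>t\<close> itself within the range.\<close>
  let ?q = "osub (case_nat (NVar 0) (\<lambda>k. NVar (k + 2))) SVar p"
  define m where "m = NMin ?q (NVar 0 \<^bold>+ NOne) (t # ns) Xs"
  have q: "osub (case_nat z (argN (t # ns))) (argS Xs) ?q = osub (case_nat z f) g p" for z
    unfolding sub_sub
    by (rule sub_cong) (auto simp: argN_def argS_def ns_def Xs_def nth_default_def split: nat.split)
  have b: "nsub (argN (t # ns)) (argS Xs) (NVar 0 \<^bold>+ NOne) = t \<^bold>+ NOne"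
    by (simp add: argN_def nth_default_def)
  have holds: "qn m \<sqsubset> qn t \<oplus> \<one> \<Longrightarrow> osub (case_nat m f) g p \<in> M"
    using axiom_mem[OF min_holds, of ?q "NVar 0 \<^bold>+ NOne" "t # ns" Xs] unfolding q b m_def[symmetric]
    by (simp add: nless_def del: lt_mem_iff)
  have least: "qn z \<sqsubset> qn m \<Longrightarrow> osub (case_nat z f) g p \<notin> M" for z
    using axiom_mem[OF min_least, of z ?q "NVar 0 \<^bold>+ NOne" "t # ns" Xs] unfolding q m_def[symmetric]
    by (simp add: nless_def del: lt_mem_iff)
  have "qn m \<sqsubseteq> qn t \<oplus> \<one>"
    using axiom_mem[OF min_le, of ?q "NVar 0 \<^bold>+ NOne" "t # ns" Xs] unfolding b m_def[symmetric] by simp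
  moreover have "qn m \<noteq> qn t \<oplus> \<one>"
    using least[of t] lt_Suc[of "qn t"] assms by auto
  ultimately have "qn m \<sqsubset> qn t \<oplus> \<one>" by (simp add: nless_def del: lt_mem_iff)
  from that[OF holds[OF this] least] show thesis .
qed

text \<open>A least counterexample is not 0, hence it is a successor; its predecessor is smaller and
  satisfies \<open>p\<close>, and the step gives a contradiction.\<close>

lemma ind_mem:
  assumes "osub (case_nat NZero f) g p \<in> M"
    and "\<And>t. osub (case_nat t f) g p \<in> M \<Longrightarrow> osub (case_nat (t \<^bold>+ NOne) f) g p \<in> M"
  shows "osub (case_nat t f) g p \<in> M"
proof (rule ccontr)
  have cong: "osub (case_nat u f) g p \<in> M \<longleftrightarrow> osub (case_nat v f) g p \<in> M" if "qn u = qn v" for u v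
    using that by (intro mem_cong eqS_refl_mem) (simp split: nat.split)
  assume "osub (case_nat t f) g p \<notin> M"
  then have "osub (case_nat t f) g (\<^bold>\<not> p) \<in> M" by simp
  then obtain m where m: "osub (case_nat m f) g p \<notin> M"
    "\<And>z. qn z \<sqsubset> qn m \<Longrightarrow> osub (case_nat z f) g p \<in> M"
    by (rule least_mem) simp
  have "qn m \<noteq> \<zero>" using m(1) assms(1) cong[of m NZero] by auto
  then obtain y where y: "qn m = y \<oplus> \<one>" using pred_exists by blast
  then have "osub (case_nat (rn y \<^bold>+ NOne) f) g p \<in> M"
    using m(2)[of "rn y"] assms(2) lt_Suc[of y] by simp
  with m(1) cong[of m "rn y \<^bold>+ NOne"] y show False by simp
qed

text \<open>Here, as in the following laws, induction runs over variable 0 of an open equation and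
  the remaining variables hold the parameters.\<close>

lemma add_assoc': "(x \<oplus> y) \<oplus> z = x \<oplus> (y \<oplus> z)"
proof -
  have "osub (case_nat (rn z) (case_nat (rn x) (\<lambda>_. rn y))) SVar
     ((NVar 1 \<^bold>+ NVar (Suc 1)) \<^bold>+ NVar 0 \<^bold>= NVar 1 \<^bold>+ (NVar (Suc 1) \<^bold>+ NVar 0)) \<in> M"
    by (rule ind_mem) (simp_all add: B3 B4)
  then show ?thesis by simp
qed

lemma add_0': "\<zero> \<oplus> x = x"
proof -
  have "osub (case_nat (rn x) NVar) SVar (NZero \<^bold>+ NVar 0 \<^bold>= NVar 0) \<in> M"
    by (rule ind_mem) (simp_all add: B3 B4)
  then show ?thesis by simp
qed

lemma Suc_add: "(x \<oplus> \<one>) \<oplus> y = (x \<oplus> y) \<oplus> \<one>"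
proof -
  have "osub (case_nat (rn y) (\<lambda>_. rn x)) SVar
     ((NVar 1 \<^bold>+ NOne) \<^bold>+ NVar 0 \<^bold>= (NVar 1 \<^bold>+ NVar 0) \<^bold>+ NOne) \<in> M"
    by (rule ind_mem) (simp_all add: B3 B4)
  then show ?thesis by simp
qed

lemma add_comm': "x \<oplus> y = y \<oplus> x"
proof -
  have "osub (case_nat (rn y) (\<lambda>_. rn x)) SVar (NVar 1 \<^bold>+ NVar 0 \<^bold>= NVar 0 \<^bold>+ NVar 1) \<in> M"
    by (rule ind_mem) (simp_all add: B3 B4 add_0' Suc_add)
  then show ?thesis by simp
qed

lemma mult_0': "\<zero> \<otimes> x = \<zero>"
proof -
  have "osub (case_nat (rn x) NVar) SVar (NZero \<^bold>* NVar 0 \<^bold>= NZero) \<in> M"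
    by (rule ind_mem) (simp_all add: B3 B5 B6)
  then show ?thesis by simp
qed

lemma mult_1': "x \<otimes> \<one> = x"
  using B6[of x "\<zero>"] by (simp add: B5 add_0')

lemma add_left_comm': "x \<oplus> (y \<oplus> z) = y \<oplus> (x \<oplus> z)"
  by (metis add_assoc' add_comm')

lemma Suc_mult: "(x \<oplus> \<one>) \<otimes> y = (x \<otimes> y) \<oplus> y"
proof -
  have "osub (case_nat (rn y) (\<lambda>_. rn x)) SVar
     ((NVar 1 \<^bold>+ NOne) \<^bold>* NVar 0 \<^bold>= (NVar 1 \<^bold>* NVar 0) \<^bold>+ NVar 0) \<in> M"
    by (rule ind_mem) (simp_all add: B3 B5 B6 add_assoc', metis add_left_comm')
  then show ?thesis by simp
qed

lemma mult_comm': "x \<otimes> y = y \<otimes> x"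
proof -
  have "osub (case_nat (rn y) (\<lambda>_. rn x)) SVar (NVar 1 \<^bold>* NVar 0 \<^bold>= NVar 0 \<^bold>* NVar 1) \<in> M"
    by (rule ind_mem) (simp_all add: B5 B6 mult_0' Suc_mult)
  then show ?thesis by simp
qed

lemma distrib': "x \<otimes> (y \<oplus> z) = x \<otimes> y \<oplus> x \<otimes> z"
proof -
  have "osub (case_nat (rn z) (case_nat (rn x) (\<lambda>_. rn y))) SVar
     (NVar 1 \<^bold>* (NVar (Suc 1) \<^bold>+ NVar 0) \<^bold>= NVar 1 \<^bold>* NVar (Suc 1) \<^bold>+ NVar 1 \<^bold>* NVar 0) \<in> M"
    by (rule ind_mem) (simp add: B3 B5, simp, metis B4 B6 add_assoc')
  then show ?thesis by simp
qed

lemma mult_assoc': "(x \<otimes> y) \<otimes> z = x \<otimes> (y \<otimes> z)"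
proof -
  have "osub (case_nat (rn z) (case_nat (rn x) (\<lambda>_. rn y))) SVar
     ((NVar 1 \<^bold>* NVar (Suc 1)) \<^bold>* NVar 0 \<^bold>= NVar 1 \<^bold>* (NVar (Suc 1) \<^bold>* NVar 0)) \<in> M"
    by (rule ind_mem) (simp_all add: B5 B6 distrib' mult_1')
  then show ?thesis by simp
qed

lemma add_cancel': "x \<oplus> z = y \<oplus> z \<Longrightarrow> x = y"
proof -
  have "osub (case_nat (rn z) (case_nat (rn x) (\<lambda>_. rn y))) SVar
     (NVar 1 \<^bold>+ NVar 0 \<^bold>= NVar (Suc 1) \<^bold>+ NVar 0 \<^bold>\<longrightarrow> NVar 1 \<^bold>= NVar (Suc 1)) \<in> M"
    by (rule ind_mem) (use B2 in \<open>auto simp: B3 B4\<close>)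
  then show "x \<oplus> z = y \<oplus> z \<Longrightarrow> x = y" by simp
qed

lemma lt_imp_Suc_le: "x \<sqsubset> y \<Longrightarrow> x \<oplus> \<one> \<sqsubseteq> y"
  by (metis B10 B11 B7 nle_refl nless_def)

text \<open>The axioms provide only that a sum is at least its first summand. Conversely, let m be
  least with y at most x + m; such m exist because y is one. If m is 0, antisymmetry finishes;
  otherwise the predecessor of m falls short of y, so x + m does not exceed y.\<close>

lemma le_iff_add': "x \<sqsubseteq> y \<longleftrightarrow> (\<exists>z. y = x \<oplus> z)"
proof
  assume xy: "x \<sqsubseteq> y"
  have "osub (case_nat (rn y) (case_nat (rn y) (\<lambda>_. rn x))) SVar
      (NVar 1 \<^bold>\<le> NVar (Suc 1) \<^bold>+ NVar 0) \<in> M"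
    using B8[of y x] by (simp add: add_comm')
  then obtain m where m: "y \<sqsubseteq> x \<oplus> qn m" "\<And>z. qn z \<sqsubset> qn m \<Longrightarrow> \<not> y \<sqsubseteq> x \<oplus> qn z"
    by (rule least_mem) simp
  show "\<exists>z. y = x \<oplus> z"
  proof (cases "qn m = \<zero>")
    case True
    with m(1) xy show ?thesis by (metis B3 B7)
  next
    case False
    then obtain z where z: "qn m = z \<oplus> \<one>" using pred_exists by blast
    with m(2)[of "rn z"] have "\<not> y \<sqsubseteq> x \<oplus> z" using lt_Suc by simp
    then have "x \<oplus> z \<sqsubset> y" using B10 nle_refl nless_def by metis
    then have "x \<oplus> (z \<oplus> \<one>) \<sqsubseteq> y" using lt_imp_Suc_le B4 by simp
    with m(1) z B7 show ?thesis by metis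
  qed
next
  assume "\<exists>z. y = x \<oplus> z"
  then show "x \<sqsubseteq> y" using B8 by auto
qed

text \<open>Transitivity is not among the axioms; through differences it reduces to associativity of
  addition.\<close>

lemma nle_trans: "x \<sqsubseteq> y \<Longrightarrow> y \<sqsubseteq> z \<Longrightarrow> x \<sqsubseteq> z"
  unfolding le_iff_add' by (auto simp: add_assoc')

definition nminus :: "'n \<Rightarrow> 'n \<Rightarrow> 'n" (infixl "\<ominus>" 65) where
  "x \<ominus> y = (if y \<sqsubseteq> x then (THE z. y \<oplus> z = x) else \<zero>)"

lemma add_diff: "(x \<oplus> y) \<ominus> x = y"
  unfolding nminus_def using B8 add_cancel' add_comm' by (auto intro!: the_equality)

lemma le_add_diff: "x \<sqsubseteq> y \<Longrightarrow> (y \<ominus> x) \<oplus> x = y"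
  by (auto simp: le_iff_add' add_diff add_comm'[of _ x])

lemma zero_or_Suc: obtains "x = \<zero>" | y where "x = y \<oplus> \<one>"
  using pred_exists by blast

lemma mult_eq_0: "x \<otimes> y = \<zero> \<Longrightarrow> x = \<zero> \<or> y = \<zero>"
  by (metis B1 B4 B6 pred_exists)

lemma mult_strict: "x \<sqsubset> y \<Longrightarrow> \<zero> \<sqsubset> z \<Longrightarrow> z \<otimes> x \<sqsubset> z \<otimes> y"
proof -
  assume "x \<sqsubset> y" "\<zero> \<sqsubset> z"
  then obtain d e where d: "y = x \<oplus> (d \<oplus> \<one>)" and e: "z = e \<oplus> \<one>"
    by (metis B3 nless_def le_iff_add' pred_exists)
  have "z \<otimes> y = z \<otimes> x \<oplus> z \<otimes> (d \<oplus> \<one>)" unfolding d distrib' ..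
  moreover have "z \<otimes> (d \<oplus> \<one>) \<noteq> \<zero>" using mult_eq_0 B1 e by blast
  ultimately show "z \<otimes> x \<sqsubset> z \<otimes> y"
    unfolding nless_def by (metis B8 B3 add_cancel' add_comm')
qed

lemma le_cancel: "x \<oplus> y \<sqsubseteq> x \<oplus> z \<longleftrightarrow> y \<sqsubseteq> z"
  unfolding le_iff_add' by (metis add_assoc' add_cancel' add_comm')

lemma diff_self: "x \<ominus> x = \<zero>"
  using add_diff[of x "\<zero>"] by (simp add: B3)

lemma zero_diff: "\<zero> \<ominus> x = \<zero>"
  using B9[of x] B7[of x "\<zero>"] diff_self[of "\<zero>"] by (auto simp: nminus_def)

lemma diff_diff: "x \<ominus> y \<ominus> z = x \<ominus> (y \<oplus> z)"
proof (cases "y \<sqsubseteq> x")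
  case True
  then obtain d where x: "x = y \<oplus> d" by (auto simp: le_iff_add')
  show ?thesis
  proof (cases "z \<sqsubseteq> d")
    case True
    then obtain e where d: "d = z \<oplus> e" by (auto simp: le_iff_add')
    have "x \<ominus> (y \<oplus> z) = e"
      using add_diff[of "y \<oplus> z" e] by (simp add: x d add_assoc')
    then show ?thesis by (simp add: x d add_diff)
  next
    case False
    then have "d \<ominus> z = \<zero>" by (simp add: nminus_def)
    moreover have "x \<ominus> (y \<oplus> z) = \<zero>" using False by (simp add: x nminus_def le_cancel)
    ultimately show ?thesis by (simp add: x add_diff)
  qed
next
  case False
  have "\<not> y \<oplus> z \<sqsubseteq> x"
    using nle_trans[OF B8[of y z], of x] False by blast
  then show ?thesis using False zero_diff[of z] by (simp add: nminus_def[of x])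
qed

lemma mult_diff: "x \<otimes> (y \<ominus> z) = x \<otimes> y \<ominus> x \<otimes> z"
proof (cases "z \<sqsubseteq> y")
  case True
  then obtain d where "y = z \<oplus> d" by (auto simp: le_iff_add')
  then show ?thesis by (simp add: add_diff distrib')
next
  case False
  then have "y \<sqsubseteq> z" using B10 by blast
  then have "x \<otimes> y \<sqsubseteq> x \<otimes> z" by (auto simp: le_iff_add' distrib')
  then have "x \<otimes> y \<ominus> x \<otimes> z = \<zero>"
    using B7[of "x \<otimes> y" "x \<otimes> z"] diff_self[of "x \<otimes> z"] nminus_def[of "x \<otimes> y" "x \<otimes> z"]
    by (cases "x \<otimes> z \<sqsubseteq> x \<otimes> y") simp_all
  with False show ?thesis by (simp add: nminus_def[of y] B5)
qed

sublocale N: discrete_linordered_semidom "(\<oplus>)" "(\<ominus>)" "(\<sqsubseteq>)" "(\<sqsubset>)" "\<zero>" "(\<otimes>)" "\<one>"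
proof
  fix a b c :: 'n
  show "a \<oplus> b \<ominus> a = b" by (rule add_diff)
  show "a \<ominus> b \<ominus> c = a \<ominus> (b \<oplus> c)" by (rule diff_diff)
  show "a \<otimes> (b \<ominus> c) = a \<otimes> b \<ominus> a \<otimes> c" by (rule mult_diff)
  show "a \<sqsubset> b \<longleftrightarrow> a \<sqsubseteq> b \<and> \<not> b \<sqsubseteq> a" using B7 nle_refl by (auto simp: nless_def)
  show "(a \<oplus> b) \<otimes> c = a \<otimes> c \<oplus> b \<otimes> c" using distrib' mult_comm' by simp
  show "\<one> \<otimes> a = a" using mult_1' mult_comm' by simp
  show "\<zero> \<noteq> \<one>" using B1[of "\<zero>"] by (simp add: add_0')
  then show "\<zero> \<sqsubset> \<one>" using B9 by (simp add: nless_def)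
  show "a \<sqsubset> b \<longleftrightarrow> a \<oplus> \<one> \<sqsubseteq> b"
    using lt_imp_Suc_le[of a b] nle_trans[of a "a \<oplus> \<one>" b] B7[of a "a \<oplus> \<one>"] lt_Suc[of a] nle_refl
    by (auto simp: nless_def)
  show "a \<noteq> \<zero> \<Longrightarrow> b \<noteq> \<zero> \<Longrightarrow> a \<otimes> b \<noteq> \<zero>" using mult_eq_0 by blast
  show "a \<oplus> b \<oplus> c = a \<oplus> (b \<oplus> c)" by (rule add_assoc')
  show "a \<oplus> b = b \<oplus> a" by (rule add_comm')
  show "a \<otimes> b = b \<otimes> a" by (rule mult_comm')
  show "a \<sqsubseteq> a" by (rule nle_refl)
  show "a \<sqsubseteq> b \<Longrightarrow> b \<sqsubseteq> c \<Longrightarrow> a \<sqsubseteq> c" by (rule nle_trans)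
  show "a \<sqsubseteq> b \<Longrightarrow> b \<sqsubseteq> a \<Longrightarrow> a = b" by (rule B7)
  show "a \<sqsubseteq> b \<Longrightarrow> c \<oplus> a \<sqsubseteq> c \<oplus> b" by (simp add: le_cancel)
  show "a \<sqsubseteq> b \<or> b \<sqsubseteq> a" by (rule B10)
  show "\<zero> \<oplus> a = a" by (rule add_0')
  show "a \<otimes> b \<otimes> c = a \<otimes> (b \<otimes> c)" by (rule mult_assoc')
  show "\<zero> \<otimes> a = \<zero>" "a \<otimes> \<zero> = \<zero>" by (rule mult_0' B5)+
  show "a \<sqsubset> b \<Longrightarrow> \<zero> \<sqsubset> c \<Longrightarrow> c \<otimes> a \<sqsubset> c \<otimes> b" by (rule mult_strict)
  show "a \<otimes> (b \<oplus> c) = a \<otimes> b \<oplus> a \<otimes> c" by (rule distrib')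
  show "b \<sqsubseteq> a \<Longrightarrow> a \<ominus> b \<oplus> b = a" by (rule le_add_diff)
qed

sublocale N: ordered_cancel_comm_monoid_diff "(\<oplus>)" "\<zero>" "(\<sqsubseteq>)" "(\<sqsubset>)" "(\<ominus>)"
  by unfold_locales (rule zero_diff le_iff_add')+


section \<open>Evaluation of terms and formulas\<close>

text \<open>
  Strings become sets of numbers, but string variables are assigned terms rather than sets; this spares
  us the side condition that the assigned sets are elements of the model.
\<close>

definition qs :: "strm \<Rightarrow> 'n set" where "qs X = {x. (rn x \<^bold>\<in> X) \<in> M}"

lemma mem_mem_iff [simp]: "(t \<^bold>\<in> X) \<in> M \<longleftrightarrow> qn t \<in> qs X"
  using mem_cong[of "\<lambda>_. t" "\<lambda>_. rn (qn t)" "\<lambda>_. X" "\<lambda>_. X" "NVar 0 \<^bold>\<in> SVar 0"] eqS_refl_mem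
  by (simp add: qs_def)

lemma mem_qs_less_Len: "y \<in> qs X \<Longrightarrow> y \<sqsubset> qn (Len X)"
  using axiom_mem[OF L1, of "rn y" X] by (simp add: nless_def del: lt_mem_iff)

lemma Len_mem_qs: "qn (Len X) = y \<oplus> \<one> \<Longrightarrow> y \<in> qs X"
  using axiom_mem[OF L2, of "rn y" X] by simp

text \<open>By L1 and L2 the length is 0 or one more than the largest element.\<close>

lemma Len_le: "qs X \<subseteq> qs Y \<Longrightarrow> qn (Len X) \<sqsubseteq> qn (Len Y)"
proof (rule zero_or_Suc[of "qn (Len X)"])
  fix y assume "qs X \<subseteq> qs Y" and y: "qn (Len X) = y \<oplus> \<one>"
  then have "y \<sqsubset> qn (Len Y)" using mem_qs_less_Len Len_mem_qs by blast
  then show ?thesis unfolding y by (simp add: lt_imp_Suc_le)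
qed (simp add: B9)

text \<open>Extensionality. The axiom SE asks for equal lengths and agreement at the single place
  \<open>nse X Y\<close>; both follow if the sets of elements are equal.\<close>

lemma eqS_mem_iff [simp]: "(X \<^bold>=\<^bold>= Y) \<in> M \<longleftrightarrow> qs X = qs Y"
proof
  assume XY: "(X \<^bold>=\<^bold>= Y) \<in> M"
  have "(rn x \<^bold>\<in> X) \<in> M \<longleftrightarrow> (rn x \<^bold>\<in> Y) \<in> M" for x
    using mem_cong[of "\<lambda>_. rn x" "\<lambda>_. rn x" "\<lambda>_. X" "\<lambda>_. Y" "NVar 0 \<^bold>\<in> SVar 0"] XY by simp
  then show "qs X = qs Y" by (auto simp: set_eq_iff)
next
  assume XY: "qs X = qs Y"
  then have "qn (Len X) = qn (Len Y)" using Len_le by (simp add: B7)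
  with XY axiom_mem[OF SE, of X Y] show "(X \<^bold>=\<^bold>= Y) \<in> M" by auto
qed

definition nval :: "(nat \<Rightarrow> 'n) \<Rightarrow> (nat \<Rightarrow> strm) \<Rightarrow> ntrm \<Rightarrow> 'n" where
  "nval \<nu> \<sigma> t = qn (nsub (\<lambda>k. rn (\<nu> k)) \<sigma> t)"
definition sterm :: "(nat \<Rightarrow> 'n) \<Rightarrow> (nat \<Rightarrow> strm) \<Rightarrow> strm \<Rightarrow> strm" where
  "sterm \<nu> \<sigma> X = ssub (\<lambda>k. rn (\<nu> k)) \<sigma> X"
definition oval :: "(nat \<Rightarrow> 'n) \<Rightarrow> (nat \<Rightarrow> strm) \<Rightarrow> oform \<Rightarrow> bool" where
  "oval \<nu> \<sigma> p \<longleftrightarrow> osub (\<lambda>k. rn (\<nu> k)) \<sigma> p \<in> M"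
abbreviation sval :: "(nat \<Rightarrow> 'n) \<Rightarrow> (nat \<Rightarrow> strm) \<Rightarrow> strm \<Rightarrow> 'n set" where
  "sval \<nu> \<sigma> X \<equiv> qs (sterm \<nu> \<sigma> X)"

lemma nval_simps [simp]:
  "nval \<nu> \<sigma> (NVar k) = \<nu> k" "nval \<nu> \<sigma> NZero = \<zero>" "nval \<nu> \<sigma> NOne = \<one>"
  "nval \<nu> \<sigma> (t \<^bold>+ u) = nval \<nu> \<sigma> t \<oplus> nval \<nu> \<sigma> u"
  "nval \<nu> \<sigma> (t \<^bold>* u) = nval \<nu> \<sigma> t \<otimes> nval \<nu> \<sigma> u"
  "nval \<nu> \<sigma> (Len X) = qn (Len (sterm \<nu> \<sigma> X))"
  by (simp_all add: nval_def sterm_def)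

lemma sterm_simps [simp]: "sterm \<nu> \<sigma> (SVar k) = \<sigma> k"
  by (simp add: sterm_def)

lemma oval_simps [simp]:
  "oval \<nu> \<sigma> (t \<^bold>= u) \<longleftrightarrow> nval \<nu> \<sigma> t = nval \<nu> \<sigma> u"
  "oval \<nu> \<sigma> (t \<^bold>\<le> u) \<longleftrightarrow> nval \<nu> \<sigma> t \<sqsubseteq> nval \<nu> \<sigma> u"
  "oval \<nu> \<sigma> (t \<^bold>\<in> X) \<longleftrightarrow> nval \<nu> \<sigma> t \<in> sval \<nu> \<sigma> X"
  "oval \<nu> \<sigma> (X \<^bold>=\<^bold>= Y) \<longleftrightarrow> sval \<nu> \<sigma> X = sval \<nu> \<sigma> Y"
  "\<not> oval \<nu> \<sigma> OFalse" "oval \<nu> \<sigma> OTrue"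
  "oval \<nu> \<sigma> (\<^bold>\<not> p) \<longleftrightarrow> \<not> oval \<nu> \<sigma> p"
  "oval \<nu> \<sigma> (p \<^bold>\<and> q) \<longleftrightarrow> oval \<nu> \<sigma> p \<and> oval \<nu> \<sigma> q"
  "oval \<nu> \<sigma> (p \<^bold>\<or> q) \<longleftrightarrow> oval \<nu> \<sigma> p \<or> oval \<nu> \<sigma> q"
  by (simp_all add: oval_def nval_def sterm_def)

lemma oval_less [simp]: "oval \<nu> \<sigma> (t \<^bold>< u) \<longleftrightarrow> nval \<nu> \<sigma> t \<sqsubset> nval \<nu> \<sigma> u"
  by (simp add: nless_def del: lt_mem_iff)

lemma val_cong:
  assumes "\<And>k. qs (\<sigma> k) = qs (\<tau> k)"
  shows "nval \<nu> \<sigma> t = nval \<nu> \<tau> t" "sval \<nu> \<sigma> X = sval \<nu> \<tau> X" "oval \<nu> \<sigma> p = oval \<nu> \<tau> p"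
proof -
  have eq: "(\<sigma> k \<^bold>=\<^bold>= \<tau> k) \<in> M" for k using assms by simp
  show "nval \<nu> \<sigma> t = nval \<nu> \<tau> t" unfolding nval_def by (rule qn_cong[OF refl eq])
  show "sval \<nu> \<sigma> X = sval \<nu> \<tau> X"
    unfolding sterm_def eqS_mem_iff[symmetric] by (rule sub_cong_mem(2)[OF eqN_refl_mem eq])
  show "oval \<nu> \<sigma> p = oval \<nu> \<tau> p" unfolding oval_def by (rule mem_cong[OF refl eq])
qed

lemma val_sub:
  "nval \<nu> \<sigma> (nsub f g t) = nval (\<lambda>k. nval \<nu> \<sigma> (f k)) (\<lambda>k. sterm \<nu> \<sigma> (g k)) t"
  "sval \<nu> \<sigma> (ssub f g X) = sval (\<lambda>k. nval \<nu> \<sigma> (f k)) (\<lambda>k. sterm \<nu> \<sigma> (g k)) X"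
  "oval \<nu> \<sigma> (osub f g p) = oval (\<lambda>k. nval \<nu> \<sigma> (f k)) (\<lambda>k. sterm \<nu> \<sigma> (g k)) p"
  unfolding nval_def sterm_def oval_def sub_sub
  by (rule qn_cong[OF _ eqS_refl_mem] eqS_mem_iff[THEN iffD1, OF sub_cong_mem(2)[OF _ eqS_refl_mem]]
      mem_cong[OF _ eqS_refl_mem], simp)+

lemma nval_lift [simp]:
  "nval (case_nat z \<nu>) \<sigma> (nsub (\<lambda>k. NVar (Suc k)) SVar t) = nval \<nu> \<sigma> t"
  by (simp add: val_sub)

lemma oval_lift [simp]:
  "oval (case_nat z \<nu>) \<sigma> (osub (\<lambda>k. NVar (Suc k)) SVar p) = oval \<nu> \<sigma> p"
  by (simp add: val_sub)

lemma sterm_lift [simp]: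
  "sterm (case_nat z \<nu>) \<sigma> (ssub (\<lambda>k. NVar (Suc k)) SVar X) = sterm \<nu> \<sigma> X"
  by (simp add: sterm_def sub_sub)

lemma lift2 [simp]:
  "nval (case_nat y (case_nat z \<nu>)) \<sigma> (nsub (\<lambda>k. NVar (Suc (Suc k))) SVar t) = nval \<nu> \<sigma> t"
  "oval (case_nat y (case_nat z \<nu>)) \<sigma> (osub (\<lambda>k. NVar (Suc (Suc k))) SVar p) = oval \<nu> \<sigma> p"
  "sterm (case_nat y (case_nat z \<nu>)) \<sigma> (ssub (\<lambda>k. NVar (Suc (Suc k))) SVar X) = sterm \<nu> \<sigma> X"
  by (simp_all add: sterm_def val_sub sub_sub)

abbreviation nargs :: "'n list \<Rightarrow> nat \<Rightarrow> 'n" where "nargs \<equiv> nth_default \<zero>"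
abbreviation sargs :: "strm list \<Rightarrow> nat \<Rightarrow> strm" where "sargs \<equiv> nth_default SEmpty"

text \<open>The default for missing arguments is the same before and after evaluation, namely 0 and
  the empty string, so no length conditions arise.\<close>

lemma args_sub:
  fixes \<nu> \<sigma> ns Xs
  defines "f \<equiv> \<lambda>k. rn (\<nu> k)"
  shows "qn (argN (map (nsub f \<sigma>) ns) k) = nargs (map (nval \<nu> \<sigma>) ns) k"
    and "argS (map (ssub f \<sigma>) Xs) = sargs (map (sterm \<nu> \<sigma>) Xs)"
  by (simp_all add: argN_def argS_def nth_default_def nval_def sterm_def f_def cong: map_cong)

lemma args_val:
  fixes \<nu> \<sigma> ns Xs
  defines "f \<equiv> \<lambda>k. rn (\<nu> k)"
  shows "qn (nsub (argN (map (nsub f \<sigma>) ns)) (argS (map (ssub f \<sigma>) Xs)) t)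
      = nval (nargs (map (nval \<nu> \<sigma>) ns)) (sargs (map (sterm \<nu> \<sigma>) Xs)) t"
    and "osub (case_nat z (argN (map (nsub f \<sigma>) ns))) (argS (map (ssub f \<sigma>) Xs)) p \<in> M
      \<longleftrightarrow> oval (case_nat (qn z) (nargs (map (nval \<nu> \<sigma>) ns))) (sargs (map (sterm \<nu> \<sigma>) Xs)) p"
  unfolding nval_def[of _ "sargs (map (sterm \<nu> \<sigma>) Xs)"] oval_def f_def args_sub
  by (auto intro!: qn_cong mem_cong simp: args_sub eqS_refl_mem simp del: eqS_mem_iff split: nat.split)

lemma sval_SComp [simp]:
  "sval \<nu> \<sigma> (SComp p b ns Xs) =
    {z. z \<sqsubset> nval (nargs (map (nval \<nu> \<sigma>) ns)) (sargs (map (sterm \<nu> \<sigma>) Xs)) b \<and>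
        oval (case_nat z (nargs (map (nval \<nu> \<sigma>) ns))) (sargs (map (sterm \<nu> \<sigma>) Xs)) p}"
proof (intro set_eqI)
  fix z
  show "z \<in> sval \<nu> \<sigma> (SComp p b ns Xs) \<longleftrightarrow> z \<in> {z. z \<sqsubset> nval (nargs (map (nval \<nu> \<sigma>) ns)) (sargs (map (sterm \<nu> \<sigma>) Xs)) b \<and>
        oval (case_nat z (nargs (map (nval \<nu> \<sigma>) ns))) (sargs (map (sterm \<nu> \<sigma>) Xs)) p}"
    using axiom_mem[OF comp, of "rn z" p b "map (nsub (\<lambda>k. rn (\<nu> k)) \<sigma>) ns" "map (ssub (\<lambda>k. rn (\<nu> k)) \<sigma>) Xs"]
    by (simp add: args_val sterm_def[of _ _ "SComp p b ns Xs"] nless_def del: lt_mem_iff)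
      blast
qed

lemma nval_NMin:
  fixes \<nu> \<sigma> p b ns Xs
  defines "E z \<equiv> oval (case_nat z (nargs (map (nval \<nu> \<sigma>) ns))) (sargs (map (sterm \<nu> \<sigma>) Xs)) p"
    and "B \<equiv> nval (nargs (map (nval \<nu> \<sigma>) ns)) (sargs (map (sterm \<nu> \<sigma>) Xs)) b"
    and "m \<equiv> nval \<nu> \<sigma> (NMin p b ns Xs)"
  shows "m \<sqsubseteq> B" and "m \<sqsubset> B \<Longrightarrow> E m" and "z \<sqsubset> m \<Longrightarrow> \<not> E z"
proof -
  let ?ns = "map (nsub (\<lambda>k. rn (\<nu> k)) \<sigma>) ns" and ?Xs = "map (ssub (\<lambda>k. rn (\<nu> k)) \<sigma>) Xs"
  have m: "qn (NMin p b ?ns ?Xs) = m" by (simp add: m_def nval_def)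
  show "m \<sqsubseteq> B" "m \<sqsubset> B \<Longrightarrow> E m" "z \<sqsubset> m \<Longrightarrow> \<not> E z"
    using axiom_mem[OF min_le, of p b ?ns ?Xs] axiom_mem[OF min_holds, of p b ?ns ?Xs]
      axiom_mem[OF min_least, of "rn z" p b ?ns ?Xs]
    by (auto simp: args_val m E_def B_def nless_def simp del: lt_mem_iff)
qed

text \<open>The three axioms on \<open>NMin\<close> determine its value; exhibiting any number with
  these properties computes it.\<close>

lemma least_unique:
  assumes "v \<sqsubseteq> B" "v \<sqsubset> B \<Longrightarrow> E v" "\<And>z. z \<sqsubset> v \<Longrightarrow> \<not> E z"
    and "m \<sqsubseteq> B" "E m \<or> m = B" "\<And>z. z \<sqsubset> m \<Longrightarrow> \<not> E z"
  shows "v = m"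
proof (rule N.linorder_cases[of v m])
  assume "v \<sqsubset> m"
  then show ?thesis using assms(2,4,6) N.less_le_trans by blast
next
  assume "m \<sqsubset> v"
  then show ?thesis using assms(1,3,5) N.leD by blast
qed

lemma nval_NMin_eqI:
  assumes "m \<sqsubseteq> nval (nargs (map (nval \<nu> \<sigma>) ns)) (sargs (map (sterm \<nu> \<sigma>) Xs)) b"
    and "oval (case_nat m (nargs (map (nval \<nu> \<sigma>) ns))) (sargs (map (sterm \<nu> \<sigma>) Xs)) p
      \<or> m = nval (nargs (map (nval \<nu> \<sigma>) ns)) (sargs (map (sterm \<nu> \<sigma>) Xs)) b"
    and "\<And>z. z \<sqsubset> m \<Longrightarrow> \<not> oval (case_nat z (nargs (map (nval \<nu> \<sigma>) ns))) (sargs (map (sterm \<nu> \<sigma>) Xs)) p"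
  shows "nval \<nu> \<sigma> (NMin p b ns Xs) = m"
  by (rule least_unique[OF nval_NMin assms])

text \<open>\<open>mu\<close> and \<open>compr\<close> pass the variables of the context, in order,
  as arguments. Evaluation over these arguments thus restores the surrounding valuation for every
  variable that occurs. The additional variable of \<open>p\<close> is the bound one, hence
  \<open>Suc k\<close>.\<close>

lemma vars_args:
  assumes "nvb_o p \<le> Suc k" "svb_o p \<le> l"
  shows "oval (case_nat z (nargs (map (nval \<nu> \<sigma>) (map NVar [0..<k])))) (sargs (map (sterm \<nu> \<sigma>) (map SVar [0..<l]))) p
    = oval (case_nat z \<nu>) \<sigma> p"
  unfolding oval_def
  by (rule arg_cong[of _ _ "\<lambda>q. q \<in> M"], rule sub_cong) (use assms in \<open>auto simp: nth_default_def split: nat.split\<close>)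

lemma vars_args_bound:
  assumes "nvb_n b \<le> k" "svb_n b \<le> l"
  shows "nval (nargs (map (nval \<nu> \<sigma>) (map NVar [0..<k]))) (sargs (map (sterm \<nu> \<sigma>) (map SVar [0..<l]))) b
    = nval \<nu> \<sigma> b"
  unfolding nval_def[of _ _ b]
  by (rule arg_cong[of _ _ qn], rule sub_cong) (use assms in \<open>auto simp: nth_default_def\<close>)

lemma nval_mu:
  fixes \<nu> \<sigma> p b
  defines "m \<equiv> nval \<nu> \<sigma> (mu b p)"
  shows "m \<sqsubseteq> nval \<nu> \<sigma> b" "m \<sqsubset> nval \<nu> \<sigma> b \<Longrightarrow> oval (case_nat m \<nu>) \<sigma> p"
    "z \<sqsubset> m \<Longrightarrow> \<not> oval (case_nat z \<nu>) \<sigma> p"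
  using nval_NMin[where \<nu>=\<nu> and \<sigma>=\<sigma> and p=p and b=b
      and ns="map NVar [0..<max (nvb_n b) (nvb_o p)]" and Xs="map SVar [0..<max (svb_n b) (svb_o p)]"]
  by (simp_all only: mu_def[symmetric] m_def[symmetric] vars_args vars_args_bound le_SucI max.cobounded1 max.cobounded2
      not_False_eq_True)

lemma nval_mu_eqI:
  assumes "m \<sqsubseteq> nval \<nu> \<sigma> b" "oval (case_nat m \<nu>) \<sigma> p \<or> m = nval \<nu> \<sigma> b"
    and "\<And>z. z \<sqsubset> m \<Longrightarrow> \<not> oval (case_nat z \<nu>) \<sigma> p"
  shows "nval \<nu> \<sigma> (mu b p) = m"
  by (rule least_unique[OF nval_mu assms])

lemma oval_obex [simp]: "oval \<nu> \<sigma> (obex b p) \<longleftrightarrow> (\<exists>z. z \<sqsubset> nval \<nu> \<sigma> b \<and> oval (case_nat z \<nu>) \<sigma> p)"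
proof
  assume "oval \<nu> \<sigma> (obex b p)"
  then show "\<exists>z. z \<sqsubset> nval \<nu> \<sigma> b \<and> oval (case_nat z \<nu>) \<sigma> p"
    unfolding obex_def oval_less using nval_mu(2) by blast
next
  assume "\<exists>z. z \<sqsubset> nval \<nu> \<sigma> b \<and> oval (case_nat z \<nu>) \<sigma> p"
  then obtain z where "z \<sqsubset> nval \<nu> \<sigma> b" "oval (case_nat z \<nu>) \<sigma> p" by blast
  then have "nval \<nu> \<sigma> (mu b p) \<sqsubseteq> z" using nval_mu(3) N.not_less by blast
  then show "oval \<nu> \<sigma> (obex b p)"
    unfolding obex_def oval_less using \<open>z \<sqsubset> _\<close> N.le_less_trans by blast
qed

lemma oval_oball [simp]: "oval \<nu> \<sigma> (oball b p) \<longleftrightarrow> (\<forall>z. z \<sqsubset> nval \<nu> \<sigma> b \<longrightarrow> oval (case_nat z \<nu>) \<sigma> p)"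
  by (auto simp: oball_def)

lemma sval_compr [simp]: "sval \<nu> \<sigma> (compr b p) = {z. z \<sqsubset> nval \<nu> \<sigma> b \<and> oval (case_nat z \<nu>) \<sigma> p}"
  unfolding compr_def sval_SComp
  by (simp only: vars_args vars_args_bound le_SucI max.cobounded1 max.cobounded2)

text \<open>All later inductions on elements of the model go through this lemma, so their claims
  have to be spelled out as open formulas.\<close>

lemma oval_ind:
  assumes "oval (case_nat \<zero> \<nu>) \<sigma> p"
    and "\<And>z. oval (case_nat z \<nu>) \<sigma> p \<Longrightarrow> oval (case_nat (z \<oplus> \<one>) \<nu>) \<sigma> p"
  shows "oval (case_nat z \<nu>) \<sigma> p"
proof -
  have eq: "osub (case_nat t (\<lambda>k. rn (\<nu> k))) \<sigma> p \<in> M \<longleftrightarrow> oval (case_nat (qn t) \<nu>) \<sigma> p" for t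
    unfolding oval_def by (intro mem_cong eqS_refl_mem) (simp split: nat.split)
  have "osub (case_nat (rn z) (\<lambda>k. rn (\<nu> k))) \<sigma> p \<in> M"
    by (rule ind_mem) (use assms in \<open>simp_all add: eq\<close>)
  then show ?thesis by (simp add: eq)
qed


section \<open>Pairing and matrix codes\<close>

text \<open>Twice the Cantor pairing function, which avoids halving.\<close>

definition pr :: "'n \<Rightarrow> 'n \<Rightarrow> 'n" where
  "pr x y = (x \<oplus> y) \<otimes> (x \<oplus> y \<oplus> \<one>) \<oplus> (\<one> \<oplus> \<one>) \<otimes> y"

lemma nval_pair [simp]: "nval \<nu> \<sigma> (pair x y) = pr (nval \<nu> \<sigma> x) (nval \<nu> \<sigma> y)"
  by (simp add: pair_def pr_def)

lemma less_Suc_iff [simp]: "x \<sqsubset> y \<oplus> \<one> \<longleftrightarrow> x \<sqsubseteq> y"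
  using B11 by blast

declare N.one_add_one [simp del]

lemma zero_eq_iff [simp]: "\<zero> = x \<longleftrightarrow> x = \<zero>"
  by auto

lemma zero_less_iff [simp]: "\<zero> \<sqsubset> x \<longleftrightarrow> x \<noteq> \<zero>"
  by (rule N.zero_less_iff_neq_zero)

lemma le_addI [simp]: "x \<sqsubseteq> y \<Longrightarrow> x \<sqsubseteq> y \<oplus> z" "x \<sqsubseteq> z \<Longrightarrow> x \<sqsubseteq> y \<oplus> z"
  by (simp_all add: N.add_increasing N.add_increasing2)

lemma less_addI: "x \<sqsubset> y \<Longrightarrow> x \<sqsubset> y \<oplus> z" "x \<sqsubset> z \<Longrightarrow> x \<sqsubset> y \<oplus> z"
  using N.less_le_trans[of x y "y \<oplus> z"] N.less_le_trans[of x z "y \<oplus> z"] by simp_all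

lemma pr_mono: "x \<sqsubseteq> x' \<Longrightarrow> y \<sqsubseteq> y' \<Longrightarrow> pr x y \<sqsubseteq> pr x' y'"
  unfolding pr_def by (intro N.add_mono N.mult_mono) simp_all

lemma pr_ge: "x \<sqsubseteq> pr x y" "y \<sqsubseteq> pr x y"
proof -
  have "x \<oplus> y \<sqsubseteq> (x \<oplus> y) \<otimes> (x \<oplus> y \<oplus> \<one>)"
    by (simp add: N.distrib_left N.add_increasing)
  then have "x \<oplus> y \<sqsubseteq> pr x y"
    unfolding pr_def using N.order_trans N.le_iff_add by blast
  moreover have "x \<sqsubseteq> x \<oplus> y" "y \<sqsubseteq> x \<oplus> y" by (simp_all add: N.add_increasing)
  ultimately show "x \<sqsubseteq> pr x y" "y \<sqsubseteq> pr x y" using N.order_trans by blast+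
qed

text \<open>On the diagonal s = x + y the values are at most s(s+1) + 2s, which is below (s+1)(s+2),
  a lower bound on all later diagonals.\<close>

lemma pr_less:
  assumes "x \<oplus> y \<sqsubset> x' \<oplus> y'" shows "pr x y \<sqsubset> pr x' y'"
proof -
  let ?s = "x \<oplus> y"
  have "?s \<oplus> \<one> \<sqsubseteq> x' \<oplus> y'" using assms by (simp add: lt_imp_Suc_le)
  then have "(?s \<oplus> \<one>) \<otimes> (?s \<oplus> \<one> \<oplus> \<one>) \<sqsubseteq> (x' \<oplus> y') \<otimes> (x' \<oplus> y' \<oplus> \<one>)"
    by (intro N.mult_mono) simp_all
  also have "\<dots> \<sqsubseteq> pr x' y'" by (simp add: pr_def)
  finally have 1: "(?s \<oplus> \<one>) \<otimes> (?s \<oplus> \<one> \<oplus> \<one>) \<sqsubseteq> pr x' y'" .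
  have "pr x y \<sqsubseteq> ?s \<otimes> (?s \<oplus> \<one>) \<oplus> (\<one> \<oplus> \<one>) \<otimes> ?s"
    unfolding pr_def by (intro N.add_mono N.mult_mono) simp_all
  also have "\<dots> \<sqsubset> ?s \<otimes> (?s \<oplus> \<one>) \<oplus> (\<one> \<oplus> \<one>) \<otimes> (?s \<oplus> \<one>)"
    by (simp add: N.distrib_left)
  also have "\<dots> = (?s \<oplus> \<one>) \<otimes> (?s \<oplus> \<one> \<oplus> \<one>)"
    by (simp add: algebra_simps)
  finally show ?thesis using 1 by simp
qed

text \<open>Equal values lie on the same diagonal by \<open>pr_less\<close>; there the summand 2y
  determines y.\<close>

lemma pr_inj [simp]: "pr x y = pr x' y' \<longleftrightarrow> x = x' \<and> y = y'"
proof
  assume eq: "pr x y = pr x' y'"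
  then have s: "x \<oplus> y = x' \<oplus> y'"
    using pr_less[of x y x' y'] pr_less[of x' y' x y] by (cases rule: N.linorder_cases[of "x \<oplus> y" "x' \<oplus> y'"]) auto
  then have "(\<one> \<oplus> \<one>) \<otimes> y = (\<one> \<oplus> \<one>) \<otimes> y'"
    using eq by (simp add: pr_def)
  then have "y \<oplus> y = y' \<oplus> y'" by (simp add: N.distrib_right)
  then have "y = y'"
    using N.add_strict_mono[of y y' y y'] N.add_strict_mono[of y' y y' y]
    by (cases rule: N.linorder_cases[of y y']) auto
  with s show "x = x' \<and> y = y'" by simp
qed simp

lemma nval_npd [simp]: "nval \<nu> \<sigma> (npd x) = nval \<nu> \<sigma> x \<ominus> \<one>"
  unfolding npd_def
  by (rule nval_NMin_eqI; rule zero_or_Suc[of "nval \<nu> \<sigma> x"]) auto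

lemma nval_nmonus [simp]: "nval \<nu> \<sigma> (nmonus x y) = nval \<nu> \<sigma> x \<ominus> nval \<nu> \<sigma> y"
  unfolding nmonus_def
proof (cases "nval \<nu> \<sigma> y \<sqsubseteq> nval \<nu> \<sigma> x")
  case True
  then obtain d where "nval \<nu> \<sigma> x = nval \<nu> \<sigma> y \<oplus> d" by (auto simp: le_iff_add')
  then show "nval \<nu> \<sigma> (NMin (NVar 1 \<^bold>\<le> NVar 2 \<^bold>+ NVar 0) (NVar 0) [x, y] []) = nval \<nu> \<sigma> x \<ominus> nval \<nu> \<sigma> y"
    by (intro nval_NMin_eqI) auto
next
  case False
  then show "nval \<nu> \<sigma> (NMin (NVar 1 \<^bold>\<le> NVar 2 \<^bold>+ NVar 0) (NVar 0) [x, y] []) = nval \<nu> \<sigma> x \<ominus> nval \<nu> \<sigma> y"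
    by (intro nval_NMin_eqI) (auto simp: nminus_def)
qed

lemma nval_nmax [simp]:
  "nval \<nu> \<sigma> (nmax x y) = (if nval \<nu> \<sigma> x \<sqsubseteq> nval \<nu> \<sigma> y then nval \<nu> \<sigma> y else nval \<nu> \<sigma> x)"
  unfolding nmax_def
  by (rule nval_NMin_eqI) (auto split: if_splits)

text \<open>The value of the symbol at two variables. Division can remain an opaque function of two
  numbers that is characterized, for a nonzero divisor, by \<open>dv_bounds\<close>.\<close>

definition dv :: "'n \<Rightarrow> 'n \<Rightarrow> 'n" where
  "dv x y = nval (case_nat x (\<lambda>_. y)) SVar (ndiv (NVar 0) (NVar 1))"

lemma nval_ndiv [simp]: "nval \<nu> \<sigma> (ndiv x y) = dv (nval \<nu> \<sigma> x) (nval \<nu> \<sigma> y)"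
proof -
  have "ndiv x y = nsub (case_nat x (\<lambda>_. y)) SVar (ndiv (NVar 0) (NVar 1))"
    by (simp add: ndiv_def)
  then show ?thesis
    unfolding dv_def by (simp add: val_sub) (simp add: ndiv_def nval_def)
qed

lemma dv_bounds:
  assumes "y \<noteq> \<zero>"
  shows "y \<otimes> dv x y \<sqsubseteq> x" "x \<sqsubset> y \<otimes> (dv x y \<oplus> \<one>)"
proof -
  let ?\<nu> = "case_nat x (\<lambda>_. y)"
  note m = nval_NMin[where \<nu>="?\<nu>" and \<sigma>=SVar and ns="[NVar 0, NVar 1]" and Xs="[]" and
      p="NVar 2 \<^bold>= NZero \<^bold>\<or> NVar 1 \<^bold>< NVar 2 \<^bold>* (NVar 0 \<^bold>+ NOne)" and b="NVar 0 \<^bold>+ NOne",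
      folded ndiv_def dv_def]
  have le: "dv x y \<sqsubseteq> x \<oplus> \<one>" using m(1) by simp
  have holds: "dv x y \<sqsubset> x \<oplus> \<one> \<Longrightarrow> x \<sqsubset> y \<otimes> (dv x y \<oplus> \<one>)"
    using m(2) assms by (simp add: nless_def[of x])
  have least: "z \<sqsubset> dv x y \<Longrightarrow> \<not> x \<sqsubset> y \<otimes> (z \<oplus> \<one>)" for z
    using m(3)[of z] assms by (simp add: nless_def[of x])
  obtain y' where y': "y = y' \<oplus> \<one>" using pred_exists assms by blast
  \<comment> \<open>As y is at least 1, the candidate x meets the search condition. Hence the search
    does not end at its bound x + 1.\<close>
  have "x \<sqsubset> y \<otimes> (x \<oplus> \<one>)"
    by (simp add: y' N.distrib_right less_addI)
  then have "dv x y \<noteq> x \<oplus> \<one>" using least[of x] by auto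
  with le have "dv x y \<sqsubset> x \<oplus> \<one>" by (simp add: nless_def del: less_Suc_iff)
  then show "x \<sqsubset> y \<otimes> (dv x y \<oplus> \<one>)" by (rule holds)
  show "y \<otimes> dv x y \<sqsubseteq> x"
  proof (rule zero_or_Suc[of "dv x y"])
    fix z assume "dv x y = z \<oplus> \<one>"
    with least[of z] show ?thesis by simp
  qed simp
qed

lemma nval_nrem [simp]: "nval \<nu> \<sigma> (nrem x y) = nval \<nu> \<sigma> x \<ominus> nval \<nu> \<sigma> y \<otimes> dv (nval \<nu> \<sigma> x) (nval \<nu> \<sigma> y)"
  by (simp add: nrem_def)

lemma nval_ncond [simp]: "nval \<nu> \<sigma> (ncond p m n) = (if oval \<nu> \<sigma> p then nval \<nu> \<sigma> m else nval \<nu> \<sigma> n)"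
  unfolding ncond_def by (rule nval_mu_eqI) auto

lemma mem_less_Len: "z \<in> sval \<nu> \<sigma> X \<Longrightarrow> z \<sqsubset> qn (Len (sterm \<nu> \<sigma> X))"
  by (rule mem_qs_less_Len)

lemma sval_scond [simp]: "sval \<nu> \<sigma> (scond p X Y) = (if oval \<nu> \<sigma> p then sval \<nu> \<sigma> X else sval \<nu> \<sigma> Y)"
  unfolding scond_def using mem_less_Len[of _ \<nu> \<sigma> X] mem_less_Len[of _ \<nu> \<sigma> Y]
  by (auto intro: less_addI)

section \<open>Matrix codes as sets of numbers\<close>

definition cell :: "'n \<Rightarrow> 'n \<Rightarrow> 'n \<Rightarrow> 'n \<Rightarrow> bool" where
  "cell a b i j \<longleftrightarrow> i \<noteq> \<zero> \<and> i \<sqsubseteq> a \<and> j \<noteq> \<zero> \<and> j \<sqsubseteq> b"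

lemma oval_in_cells [simp]:
  "oval \<nu> \<sigma> (in_cells m n z p) \<longleftrightarrow> (\<exists>i j. cell (nval \<nu> \<sigma> m) (nval \<nu> \<sigma> n) i j \<and>
     nval \<nu> \<sigma> z = pr i j \<and> oval (case_nat j (case_nat i \<nu>)) \<sigma> p)"
  by (auto simp: in_cells_def cell_def)

definition is_mat :: "'n set \<Rightarrow> bool" where
  "is_mat A \<longleftrightarrow> (\<exists>a b. pr \<zero> (pr a b) \<in> A \<and>
     (\<forall>z\<in>A. z = pr \<zero> (pr a b) \<or> (\<exists>i j. cell a b i j \<and> z = pr i j)))"
text \<open>The header has first component 0 and cells have nonzero row numbers, so the two kinds of
  elements cannot be confused.\<close>

definition code :: "'n \<Rightarrow> 'n \<Rightarrow> ('n \<Rightarrow> 'n \<Rightarrow> bool) \<Rightarrow> 'n set" where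
  "code a b E = insert (pr \<zero> (pr a b)) {pr i j |i j. cell a b i j \<and> E i j}"
definition mrow :: "'n set \<Rightarrow> 'n" where
  "mrow A = (if is_mat A then THE a. \<exists>b. pr \<zero> (pr a b) \<in> A else \<zero>)"
definition mcol :: "'n set \<Rightarrow> 'n" where
  "mcol A = (if is_mat A then THE b. \<exists>a. pr \<zero> (pr a b) \<in> A else \<zero>)"
definition ment :: "'n set \<Rightarrow> 'n \<Rightarrow> 'n \<Rightarrow> bool" where
  "ment A i j \<longleftrightarrow> pr i j \<in> A \<and> i \<noteq> \<zero> \<and> j \<noteq> \<zero> \<and> is_mat A"

lemma pr_0_mem_code [simp]: "pr \<zero> z \<in> code a b E \<longleftrightarrow> z = pr a b"
  by (auto simp: code_def cell_def)

lemma is_mat_code [simp]: "is_mat (code a b E)"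
  unfolding is_mat_def by (rule exI[of _ a], rule exI[of _ b]) (auto simp: code_def)

lemma mrow_code [simp]: "mrow (code a b E) = a" and mcol_code [simp]: "mcol (code a b E) = b"
  by (simp_all add: mrow_def mcol_def)

lemma ment_code [simp]: "ment (code a b E) i j \<longleftrightarrow> cell a b i j \<and> E i j"
  by (auto simp: ment_def) (auto simp: code_def cell_def)

lemma code_cong: "(\<And>i j. cell a b i j \<Longrightarrow> E i j \<longleftrightarrow> E' i j) \<Longrightarrow> code a b E = code a b E'"
  by (auto simp: code_def)

lemma is_mat_obtain:
  assumes "is_mat A" obtains a b E where "A = code a b E"
proof -
  from assms obtain a b where ab: "pr \<zero> (pr a b) \<in> A"
    "\<And>z. z \<in> A \<Longrightarrow> z = pr \<zero> (pr a b) \<or> (\<exists>i j. cell a b i j \<and> z = pr i j)"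
    unfolding is_mat_def by blast
  then have "A = code a b (\<lambda>i j. pr i j \<in> A)"
    by (fastforce simp: code_def)
  then show thesis by (rule that)
qed

lemma code_eq:
  assumes "is_mat A" shows "code (mrow A) (mcol A) (ment A) = A"
proof -
  from is_mat_obtain[OF assms] obtain a b E where "A = code a b E" .
  then show ?thesis by simp (rule code_cong, simp)
qed

lemma ment_imp_cell: "ment A i j \<Longrightarrow> cell (mrow A) (mcol A) i j"
  by (metis code_eq ment_code ment_def)

lemma not_mat [simp]: "\<not> is_mat A \<Longrightarrow> mrow A = \<zero>" "\<not> is_mat A \<Longrightarrow> mcol A = \<zero>" "\<not> is_mat A \<Longrightarrow> \<not> ment A i j"
  by (simp_all add: mrow_def mcol_def ment_def)

lemma header_mem: "is_mat A \<Longrightarrow> pr \<zero> (pr a b) \<in> A \<longleftrightarrow> a = mrow A \<and> b = mcol A"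
  using code_eq pr_0_mem_code by (metis pr_inj)

text \<open>Both dimensions are below the length of the string, so the bounded searches in
  \<open>isMatrix2\<close>, \<open>nrow\<close> and \<open>ncol\<close> miss nothing.\<close>

lemma header_bounds:
  assumes "pr \<zero> (pr a b) \<in> sval \<nu> \<sigma> X"
  shows "a \<sqsubseteq> qn (Len (sterm \<nu> \<sigma> X))" "b \<sqsubseteq> qn (Len (sterm \<nu> \<sigma> X))"
proof -
  have "pr \<zero> (pr a b) \<sqsubseteq> qn (Len (sterm \<nu> \<sigma> X))" using mem_less_Len[OF assms] by (simp add: nless_def)
  then have "pr a b \<sqsubseteq> qn (Len (sterm \<nu> \<sigma> X))" using pr_ge N.order_trans by blast
  then show "a \<sqsubseteq> qn (Len (sterm \<nu> \<sigma> X))" "b \<sqsubseteq> qn (Len (sterm \<nu> \<sigma> X))"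
    using pr_ge N.order_trans by blast+
qed

lemma oval_isMatrix2 [simp]: "oval \<nu> \<sigma> (isMatrix2 X) \<longleftrightarrow> is_mat (sval \<nu> \<sigma> X)"
  using header_bounds[of _ _ \<nu> \<sigma> X] mem_less_Len[of _ \<nu> \<sigma> X]
  by (simp add: isMatrix2_def val_sub is_mat_def) blast

lemma nval_nrow [simp]: "nval \<nu> \<sigma> (nrow X) = mrow (sval \<nu> \<sigma> X)"
  using header_bounds[of _ _ \<nu> \<sigma> X]
  unfolding nrow_def
  by (intro nval_NMin_eqI; cases "is_mat (sval \<nu> \<sigma> X)") (auto simp: header_mem)

lemma nval_ncol [simp]: "nval \<nu> \<sigma> (ncol X) = mcol (sval \<nu> \<sigma> X)"
  using header_bounds[of _ _ \<nu> \<sigma> X]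
  unfolding ncol_def
  by (intro nval_NMin_eqI; cases "is_mat (sval \<nu> \<sigma> X)") (auto simp: header_mem)

lemma oval_oentry [simp]: "oval \<nu> \<sigma> (oentry X m n) \<longleftrightarrow> ment (sval \<nu> \<sigma> X) (nval \<nu> \<sigma> m) (nval \<nu> \<sigma> n)"
  by (simp add: oentry_def ment_def)

lemma sval_smatrix [simp]: "sval \<nu> \<sigma> (smatrix m n p) =
  code (nval \<nu> \<sigma> m) (nval \<nu> \<sigma> n) (\<lambda>i j. oval (case_nat j (case_nat i \<nu>)) \<sigma> p)"
proof -
  have env: "(\<lambda>k. case_nat j (case_nat i (case_nat z \<nu>)) (if k < 2 then k else Suc k)) =
      case_nat j (case_nat i \<nu>)" for i j z
    by (auto simp: fun_eq_iff numeral_2_eq_2 split: nat.split)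
  \<comment> \<open>The comprehension in \<open>smatrix\<close> ends at the header, so the code of
    every cell has to be at most the header.\<close>
  have "pr i j \<sqsubseteq> pr \<zero> (pr a b)" if "cell a b i j" for a b i j
    using that pr_mono[of i a j b] pr_ge(2)[of "pr a b" \<zero>] N.order_trans by (auto simp: cell_def)
  then show ?thesis
    by (auto simp: smatrix_def code_def val_sub if_distrib[of "nval _ _"] env cong: if_cong)
qed

lemma sval_spad [simp]: "sval \<nu> \<sigma> (spad s X) =
  {pr i j |i j. i \<sqsubset> nval \<nu> \<sigma> s \<and> j \<sqsubset> nval \<nu> \<sigma> s \<and> pr (i \<oplus> \<one>) (j \<oplus> \<one>) \<in> sval \<nu> \<sigma> X}"
  by (auto simp: spad_def pr_less N.add_strict_mono)


section \<open>Parity\<close>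

text \<open>Parity as a property of sets; it is false by default for sets that are not given by a
  string.\<close>

definition parity :: "'n set \<Rightarrow> bool" where
  "parity A \<longleftrightarrow> (\<exists>X. qs X = A \<and> PAR X \<in> M)"

abbreviation intern :: "'n set \<Rightarrow> bool" where
  "intern A \<equiv> A \<in> range qs"

lemma PAR_mem_iff: "PAR X \<in> M \<longleftrightarrow> parity (qs X)"
proof -
  have "PAR X \<in> M \<longleftrightarrow> PAR Y \<in> M" if "qs X = qs Y" for Y
    using val_cong(3)[of "\<lambda>_. X" "\<lambda>_. Y" "\<lambda>_. \<zero>" "PAR (SVar 0)"] that
    by (simp add: oval_def PAR_def del: mem_mem_iff)
  then show ?thesis unfolding parity_def by metis
qed

lemma oval_PAR [simp]: "oval \<nu> \<sigma> (PAR X) \<longleftrightarrow> parity (sval \<nu> \<sigma> X)"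
  unfolding PAR_mem_iff[symmetric] by (simp add: oval_def sterm_def PAR_def del: mem_mem_iff)

lemma intern_compr: "intern {z. z \<sqsubset> nval \<nu> \<sigma> b \<and> oval (case_nat z \<nu>) \<sigma> p}"
  unfolding sval_compr[symmetric] by (rule rangeI)

text \<open>The running parity: the parity of the number of elements of \<open>X\<close> below
  \<open>x\<close>. It is read from the string of length parameter \<open>x\<close>; by
  \<open>in_SParity\<close> any larger parameter gives the same.\<close>

definition par :: "'n \<Rightarrow> strm \<Rightarrow> bool" where
  "par x X \<longleftrightarrow> x \<in> qs (SParity (rn x) X)"

lemma SParity_cong: "qs (SParity t (sterm \<nu> \<sigma> X)) = qs (SParity (rn (qn t)) (sterm \<nu> \<sigma> X))"
  unfolding eqS_mem_iff[symmetric]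
  using sub_cong_mem(2)[of "\<lambda>_. t" "\<lambda>_. rn (qn t)" "\<lambda>_. sterm \<nu> \<sigma> X" "\<lambda>_. sterm \<nu> \<sigma> X" "SParity (NVar 0) (SVar 0)"]
    eqS_refl_mem by simp

lemma sval_SParity [simp]: "sval \<nu> \<sigma> (SParity t X) = qs (SParity (rn (nval \<nu> \<sigma> t)) (sterm \<nu> \<sigma> X))"
  using SParity_cong[of "nsub (\<lambda>k. rn (\<nu> k)) \<sigma> t" \<nu> \<sigma> X] by (simp add: sterm_def nval_def)

lemma zero_notin_SParity: "\<zero> \<notin> qs (SParity x X)"
  using axiom_mem[OF parity_0, of x X] by simp

lemma Suc_in_SParity:
  "z \<sqsubset> x \<Longrightarrow> z \<oplus> \<one> \<in> qs (SParity (rn x) X) \<longleftrightarrow> (z \<in> qs X) \<noteq> (z \<in> qs (SParity (rn x) X))"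
  using axiom_mem[OF parity_Suc, of "rn z" "rn x" X] by (auto simp: nless_def simp del: lt_mem_iff)

lemma Suc_leD: "x \<oplus> \<one> \<sqsubseteq> y \<Longrightarrow> x \<sqsubseteq> y"
  using N.order_trans[of x "x \<oplus> \<one>" y] by simp

lemma in_SParity [simp]:
  assumes "z \<sqsubseteq> x" shows "z \<in> qs (SParity (rn x) X) \<longleftrightarrow> par z X"
proof -
  \<comment> \<open>The strings with parameters x and z obey the same recursion as long as both are
    defined by it, so they agree there by induction.\<close>
  have "oval (case_nat z (case_nat x (\<lambda>_. z))) (\<lambda>_. X)
    (NVar 0 \<^bold>\<le> NVar 1 \<^bold>\<and> NVar 0 \<^bold>\<le> NVar (Suc 1) \<^bold>\<longrightarrow>
     (NVar 0 \<^bold>\<in> SParity (NVar 1) (SVar 0) \<^bold>\<longleftrightarrow> NVar 0 \<^bold>\<in> SParity (NVar (Suc 1)) (SVar 0)))"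
  proof (rule oval_ind, goal_cases)
    case 1
    show ?case by (simp add: zero_notin_SParity)
  next
    case (2 y)
    then show ?case
      using Suc_leD[of y x] Suc_leD[of y z] by (auto simp: Suc_in_SParity N.less_iff_succ_less_eq)
  qed
  then show ?thesis using assms by (auto simp: par_def)
qed

lemma par_0 [simp]: "\<not> par \<zero> X"
  by (simp add: par_def zero_notin_SParity)

lemma par_Suc [simp]: "par (z \<oplus> \<one>) X \<longleftrightarrow> (z \<in> qs X) \<noteq> par z X"
  using Suc_in_SParity[of z "z \<oplus> \<one>" X] by simp

abbreviation opar :: "ntrm \<Rightarrow> strm \<Rightarrow> oform" where "opar t X \<equiv> t \<^bold>\<in> SParity t X"

lemma oval_opar [simp]: "oval \<nu> \<sigma> (opar t X) \<longleftrightarrow> par (nval \<nu> \<sigma> t) (sterm \<nu> \<sigma> X)"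
  by simp

text \<open>\<open>PAR\<close> reads the running parity at the length of \<open>X\<close>. Beyond
  the length no element is met, so by induction on the distance the running parity no longer
  changes. This allows parities of different strings to be compared at a common bound.\<close>

lemma parity_eq_par:
  assumes "\<And>z. z \<in> qs X \<Longrightarrow> z \<sqsubset> b" shows "parity (qs X) \<longleftrightarrow> par b X"
proof -
  let ?l = "qn (Len X)"
  have "?l \<sqsubseteq> b"
    using assms Len_mem_qs[of X] by (cases rule: zero_or_Suc[of ?l]) (auto simp: lt_imp_Suc_le)
  then obtain d where d: "b = ?l \<oplus> d" by (auto simp: le_iff_add')
  have "oval (case_nat d (\<lambda>_. ?l)) (\<lambda>_. X) (opar (NVar 1 \<^bold>+ NVar 0) (SVar 0) \<^bold>\<longleftrightarrow> opar (NVar 1) (SVar 0))"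
  proof (rule oval_ind)
    fix z
    have "?l \<oplus> z \<notin> qs X" using mem_qs_less_Len[of "?l \<oplus> z" X] N.leD by auto
    then show "oval (case_nat z (\<lambda>_. ?l)) (\<lambda>_. X) (opar (NVar 1 \<^bold>+ NVar 0) (SVar 0) \<^bold>\<longleftrightarrow> opar (NVar 1) (SVar 0)) \<Longrightarrow>
      oval (case_nat (z \<oplus> \<one>) (\<lambda>_. ?l)) (\<lambda>_. X) (opar (NVar 1 \<^bold>+ NVar 0) (SVar 0) \<^bold>\<longleftrightarrow> opar (NVar 1) (SVar 0))"
      by (simp flip: add_assoc')
  qed simp
  then have "par b X \<longleftrightarrow> par ?l X" unfolding d by auto
  then show ?thesis
    using oval_PAR[of "\<lambda>_. \<zero>" "\<lambda>_. X" "SVar 0"] by (simp add: PAR_def)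
qed

lemma parity_empty [simp]: "\<not> parity {}"
proof -
  have "qs SEmpty = {}" using sval_SComp[of "\<lambda>_. \<zero>" SVar OFalse NZero "[]" "[]"] by (simp add: SEmpty_def sterm_def)
  then show ?thesis using parity_eq_par[of SEmpty \<zero>] by simp
qed

text \<open>Running parities of disjoint sets add up at each step; the length of the union is a
  bound at which all three can be read.\<close>

lemma parity_Un:
  assumes "intern A" "intern B" "intern (A \<union> B)" "A \<inter> B = {}"
  shows "parity (A \<union> B) \<longleftrightarrow> parity A \<noteq> parity B"
proof -
  from assms obtain X Y Z where X: "qs X = A" and Y: "qs Y = B" and Z: "qs Z = A \<union> B" by auto
  have *: "oval (case_nat b (\<lambda>_. \<zero>)) (case_nat X (case_nat Y (\<lambda>_. Z)))
    (opar (NVar 0) (SVar (Suc 1)) \<^bold>\<longleftrightarrow> (opar (NVar 0) (SVar 0) \<^bold>\<oplus> opar (NVar 0) (SVar 1)))" for b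
  proof (rule oval_ind, goal_cases)
    case (2 y)
    have "y \<in> qs Z \<longleftrightarrow> (y \<in> qs X) \<noteq> (y \<in> qs Y)" using assms(4) X Y Z by auto
    with 2 show ?case by auto
  qed simp
  let ?b = "qn (Len Z)"
  have b: "z \<sqsubset> ?b" if "z \<in> A \<union> B" for z using that mem_qs_less_Len[of z Z] Z by simp
  have "parity (qs X) \<longleftrightarrow> par ?b X" "parity (qs Y) \<longleftrightarrow> par ?b Y" "parity (qs Z) \<longleftrightarrow> par ?b Z"
    by (rule parity_eq_par, rule b, simp add: X Y Z)+
  with *[of ?b] show ?thesis unfolding X Y Z by auto
qed

lemma intern_singleton: "intern {x}"
  using intern_compr[of "\<lambda>_. x" SVar "NVar 0 \<^bold>+ NOne" "NVar 0 \<^bold>= NVar 1"]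
  by (rule back_subst[of intern]) auto

lemma less_Suc_disj: "x \<sqsubset> y \<oplus> \<one> \<longleftrightarrow> x \<sqsubset> y \<or> x = y"
  using nle_refl[of y] by (auto simp: nless_def[of x y])

text \<open>The running parity of {x} at b is the truth value of x < b.\<close>

lemma parity_singleton [simp]: "parity {x}"
proof -
  obtain X where X: "qs X = {x}" using intern_singleton[of x] by auto
  have *: "oval (case_nat b (\<lambda>_. x)) (\<lambda>_. X) (opar (NVar 0) (SVar 0) \<^bold>\<longleftrightarrow> NVar 1 \<^bold>< NVar 0)" for b
  proof (rule oval_ind, goal_cases)
    case (2 y)
    with X show ?case by (simp add: less_Suc_disj nless_def[symmetric] del: less_Suc_iff) blast
  qed simp
  show ?thesis using *[of "x \<oplus> \<one>"] parity_eq_par[of X "x \<oplus> \<one>"] X by auto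
qed

lemma intern_Un:
  assumes "intern A" "intern B" shows "intern (A \<union> B)"
proof -
  from assms obtain X Y where X: "qs X = A" and Y: "qs Y = B" by auto
  show ?thesis
    using intern_compr[of "\<lambda>_. \<zero>" "case_nat X (\<lambda>_. Y)" "Len (SVar 0) \<^bold>+ Len (SVar 1)" "NVar 0 \<^bold>\<in> SVar 0 \<^bold>\<or> NVar 0 \<^bold>\<in> SVar 1"]
    by (rule back_subst[of intern]) (auto simp: X Y dest: mem_qs_less_Len[of _ X, unfolded X] mem_qs_less_Len[of _ Y, unfolded Y] intro: less_addI)
qed

lemma intern_Diff:
  assumes "intern A" "intern B" shows "intern (A - B)"
proof -
  from assms obtain X Y where X: "qs X = A" and Y: "qs Y = B" by auto
  show ?thesis
    using intern_compr[of "\<lambda>_. \<zero>" "case_nat X (\<lambda>_. Y)" "Len (SVar 0)" "NVar 0 \<^bold>\<in> SVar 0 \<^bold>\<and> \<^bold>\<not> NVar 0 \<^bold>\<in> SVar 1"]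
    by (rule back_subst[of intern]) (auto simp: X Y dest: mem_qs_less_Len[of _ X, unfolded X])
qed

lemma intern_insert: "intern A \<Longrightarrow> intern (insert x A)"
  using intern_Un[OF intern_singleton[of x]] by simp

lemma parity_insert: "intern A \<Longrightarrow> x \<notin> A \<Longrightarrow> parity (insert x A) \<longleftrightarrow> \<not> parity A"
  using parity_Un[of "{x}" A] intern_singleton[of x] intern_insert[of A x] by simp

text \<open>
  \<open>f\<close> need not be a function symbol; its graph being a string makes the images of initial segments of
  \<open>A\<close> strings, as required for the induction.
\<close>

lemma parity_image:
  assumes A: "intern A" and G: "intern G" "\<And>x y. x \<in> A \<Longrightarrow> pr x y \<in> G \<longleftrightarrow> y = f x"
    and inj: "inj_on f A"
  shows "parity (f ` A) \<longleftrightarrow> parity A" "intern (f ` A)"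
proof -
  from A G obtain X Z where X: "qs X = A" and Z: "qs Z = G" by auto
  let ?image = "compr (Len (SVar 1)) (obex (NVar 1) (NVar 0 \<^bold>\<in> SVar 0 \<^bold>\<and> bit2 (SVar 1) (NVar 0) (NVar 1)))"
  have f_less: "f x \<sqsubset> qn (Len Z)" if "x \<in> A" for x
  proof -
    have "pr x (f x) \<sqsubset> qn (Len Z)" using that G(2) Z by (intro mem_qs_less_Len) simp
    then show ?thesis using pr_ge N.le_less_trans by blast
  qed
  have image: "sval (case_nat b (\<lambda>_. \<zero>)) (case_nat X (\<lambda>_. Z)) ?image = f ` {x\<in>A. x \<sqsubset> b}" for b
    by (auto simp: X Z G(2) intro: f_less)
  have intern_image: "intern (f ` {x\<in>A. x \<sqsubset> b})" for b
    unfolding image[symmetric] by (rule rangeI)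
  \<comment> \<open>Claim for the induction on b: the image of the elements below b has the running
    parity of \<open>A\<close> at b. In the step at most the value of z is added, and by injectivity
    it is new.\<close>
  have *: "oval (case_nat b (\<lambda>_. \<zero>)) (case_nat X (\<lambda>_. Z)) (PAR ?image \<^bold>\<longleftrightarrow> opar (NVar 0) (SVar 0))" for b
  proof (rule oval_ind)
    fix z
    assume IH: "oval (case_nat z (\<lambda>_. \<zero>)) (case_nat X (\<lambda>_. Z)) (PAR ?image \<^bold>\<longleftrightarrow> opar (NVar 0) (SVar 0))"
    have "parity (f ` {x\<in>A. x \<sqsubset> z \<oplus> \<one>}) \<longleftrightarrow> (z \<in> A) \<noteq> parity (f ` {x\<in>A. x \<sqsubset> z})"
    proof (cases "z \<in> A")
      case True
      then have "{x\<in>A. x \<sqsubset> z \<oplus> \<one>} = insert z {x\<in>A. x \<sqsubset> z}" by (auto simp: less_Suc_disj simp del: less_Suc_iff)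
      moreover have "f z \<notin> f ` {x\<in>A. x \<sqsubset> z}" using True inj by (auto simp: inj_on_def)
      ultimately show ?thesis using parity_insert[OF intern_image] True by simp
    next
      case False
      then have "{x\<in>A. x \<sqsubset> z \<oplus> \<one>} = {x\<in>A. x \<sqsubset> z}" by (auto simp: less_Suc_disj simp del: less_Suc_iff)
      with False show ?thesis by simp
    qed
    with IH show "oval (case_nat (z \<oplus> \<one>) (\<lambda>_. \<zero>)) (case_nat X (\<lambda>_. Z)) (PAR ?image \<^bold>\<longleftrightarrow> opar (NVar 0) (SVar 0))"
      unfolding oval_simps oval_PAR image oval_opar by (auto simp: X)
  qed (unfold oval_simps oval_PAR image oval_opar, simp)
  let ?b = "qn (Len X)"
  have A_bounded: "{x\<in>A. x \<sqsubset> ?b} = A" using mem_qs_less_Len[of _ X] X by auto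
  then show "parity (f ` A) \<longleftrightarrow> parity A"
    using *[of ?b] parity_eq_par[of X ?b] mem_qs_less_Len[of _ X] unfolding oval_simps oval_PAR image oval_opar
    by (auto simp: X)
  show "intern (f ` A)" using intern_image[of ?b] by (simp only: A_bounded)
qed


section \<open>Sums and powers of matrices\<close>

definition cells :: "'n \<Rightarrow> 'n \<Rightarrow> ('n \<Rightarrow> 'n \<Rightarrow> bool) \<Rightarrow> 'n set" where
  "cells a b E = {pr i j |i j. cell a b i j \<and> E i j}"
text \<open>The header is one extra element of the code, so an odd number of ones makes the set
  even; hence the negation.\<close>

definition msum :: "'n set \<Rightarrow> bool" where
  "msum A \<longleftrightarrow> is_mat A \<and> \<not> parity A"

lemma code_eq_insert: "code a b E = insert (pr \<zero> (pr a b)) (cells a b E)"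
  by (auto simp: code_def cells_def)

lemma header_notin_cells: "pr \<zero> z \<notin> cells a b E"
  by (auto simp: cells_def cell_def)

lemma intern_cells: "intern (code a b E) \<Longrightarrow> intern (cells a b E)"
  using intern_Diff[OF _ intern_singleton, of "code a b E" "pr \<zero> (pr a b)"]
  by (simp add: code_eq_insert header_notin_cells)

lemma msum_code: "intern (code a b E) \<Longrightarrow> msum (code a b E) \<longleftrightarrow> parity (cells a b E)"
  using parity_insert[OF intern_cells, of a b E "pr \<zero> (pr a b)"]
  by (simp add: msum_def header_notin_cells flip: code_eq_insert)

text \<open>Re-indexing of cells. Since the map is given by a term \<open>t\<close>, with row and
  column as its variables 1 and 0, its graph on the cells is definable, and the bound
  \<open>c\<close> makes the graph a string.\<close>

lemma parity_cells_image:
  fixes t \<nu> \<sigma>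
  defines "f i j \<equiv> nval (case_nat j (case_nat i \<nu>)) \<sigma> t"
  assumes A: "intern (cells a b E)"
    and inj: "\<And>i j i' j'. cell a b i j \<Longrightarrow> cell a b i' j' \<Longrightarrow> f i j = f i' j' \<Longrightarrow> i = i' \<and> j = j'"
    and bound: "\<And>i j. cell a b i j \<Longrightarrow> f i j \<sqsubseteq> c"
  shows "parity {f i j |i j. cell a b i j \<and> E i j} \<longleftrightarrow> parity (cells a b E)"
    and "intern {f i j |i j. cell a b i j \<and> E i j}"
proof -
  let ?\<nu> = "case_nat a (case_nat b (case_nat c \<nu>))"
  \<comment> \<open>The outer variables of \<open>t\<close> skip four places: the element variable
    of the comprehension and the parameters a, b, c.\<close>
  let ?t = "nsub (\<lambda>k. NVar (if k < 2 then k else k + 4)) SVar t"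
  let ?p = "obex (NVar 1 \<^bold>+ NOne) (obex (NVar 3 \<^bold>+ NOne)
    (NZero \<^bold>< NVar 1 \<^bold>\<and> NZero \<^bold>< NVar 0 \<^bold>\<and> NVar 2 \<^bold>= pair (pair (NVar 1) (NVar 0)) ?t))"
  let ?G = "compr (pair (pair (NVar 0) (NVar 1)) (NVar 2) \<^bold>+ NOne) ?p"
  \<comment> \<open>\<open>F\<close> is the map of two indices viewed as a map on the numbers that
    encode the cells.\<close>
  define F where "F x = (THE y. \<exists>i j. x = pr i j \<and> y = f i j)" for x
  have F: "F (pr i j) = f i j" for i j by (simp add: F_def)
  have env: "(\<lambda>k. case_nat j (case_nat i (case_nat z ?\<nu>)) (if k < 2 then k else k + 4)) =
      case_nat j (case_nat i \<nu>)" for i j z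
    by (auto simp: fun_eq_iff numeral_2_eq_2 eval_nat_numeral split: nat.split)
  have t: "nval (case_nat j (case_nat i (case_nat z ?\<nu>))) \<sigma> ?t = f i j" for i j z
    by (simp add: val_sub if_distrib[of "nval _ _"] f_def env cong: if_cong)
  have mono: "pr (pr i j) (f i j) \<sqsubseteq> pr (pr a b) c" if "cell a b i j" for i j
    using that bound[OF that] by (auto simp: cell_def intro!: pr_mono)
  have G: "sval ?\<nu> \<sigma> ?G = {pr (pr i j) (f i j) |i j. cell a b i j}"
    using mono by (auto simp: t cell_def)
  have img: "F ` cells a b E = {f i j |i j. cell a b i j \<and> E i j}"
  proof -
    have "F (pr i j) \<in> F ` cells a b E" if "cell a b i j" "E i j" for i j
      using that by (intro imageI) (auto simp: cells_def)
    moreover have "F x \<in> {f i j |i j. cell a b i j \<and> E i j}" if x: "x \<in> cells a b E" for x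
    proof -
      from x obtain i j where "x = pr i j" "cell a b i j" "E i j" unfolding cells_def by blast
      then show ?thesis using F by blast
    qed
    ultimately show ?thesis by (auto simp: F)
  qed
  have "intern (sval ?\<nu> \<sigma> ?G)" by (rule rangeI)
  moreover have "x \<in> cells a b E \<Longrightarrow> pr x y \<in> sval ?\<nu> \<sigma> ?G \<longleftrightarrow> y = F x" for x y
    unfolding G by (auto simp: cells_def F)
  moreover have "inj_on F (cells a b E)"
    by (rule inj_onI) (auto simp: cells_def F dest: inj)
  ultimately have "parity (F ` cells a b E) \<longleftrightarrow> parity (cells a b E)" "intern (F ` cells a b E)"
    using parity_image[OF A] by blast+
  then show "parity {f i j |i j. cell a b i j \<and> E i j} \<longleftrightarrow> parity (cells a b E)"
    "intern {f i j |i j. cell a b i j \<and> E i j}"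
    unfolding img by auto
qed

text \<open>Moves a block of a matrix to its place in the whole matrix without changing its
  parity.\<close>

lemma parity_cells_shift:
  assumes "intern (cells a b E)"
  shows "parity {pr (i \<oplus> d) (j \<oplus> e) |i j. cell a b i j \<and> E i j} \<longleftrightarrow> parity (cells a b E)"
    and "intern {pr (i \<oplus> d) (j \<oplus> e) |i j. cell a b i j \<and> E i j}"
  using parity_cells_image[OF assms, of "case_nat d (\<lambda>_. e)" SVar
      "pair (NVar 1 \<^bold>+ NVar 2) (NVar 0 \<^bold>+ NVar 3)" "pr (a \<oplus> d) (b \<oplus> e)"]
  by (auto simp: cell_def eval_nat_numeral intro!: pr_mono N.add_mono)

lemma parity_cells_transpose:
  assumes "intern (cells a b E)"
  shows "parity (cells b a (\<lambda>i j. E j i)) \<longleftrightarrow> parity (cells a b E)"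
proof -
  have "cells b a (\<lambda>i j. E j i) = {pr j i |i j. cell a b i j \<and> E i j}"
    by (auto simp: cells_def cell_def)
  then show ?thesis
    using parity_cells_image(1)[OF assms, of "\<lambda>_. \<zero>" SVar "pair (NVar 0) (NVar 1)" "pr b a"]
    by (auto simp: cell_def intro!: pr_mono)
qed

lemma le_one_iff: "x \<sqsubseteq> \<one> \<longleftrightarrow> x = \<zero> \<or> x = \<one>"
  by (rule zero_or_Suc[of x]) auto

lemma cell_1 [simp]:
  "cell a \<one> i j \<longleftrightarrow> i \<noteq> \<zero> \<and> i \<sqsubseteq> a \<and> j = \<one>" "cell \<one> b i j \<longleftrightarrow> i = \<one> \<and> j \<noteq> \<zero> \<and> j \<sqsubseteq> b"
  by (auto simp: cell_def le_one_iff)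

text \<open>LAP sums an n by 1 matrix numbered from 1, while \<open>InnerProd\<close> is a set of
  numbers counted from 0. The injection sending the cell in row i to i - 1 reconciles them.\<close>

lemma parity_column:
  assumes "intern (cells n \<one> E)"
  shows "parity (cells n \<one> E) \<longleftrightarrow> parity {k. k \<sqsubset> n \<and> E (k \<oplus> \<one>) \<one>}"
proof -
  have pred: "i \<ominus> \<one> \<oplus> \<one> = i" if "i \<noteq> \<zero>" for i
    using that by (cases rule: zero_or_Suc[of i]) auto
  have "{k. k \<sqsubset> n \<and> E (k \<oplus> \<one>) \<one>} = {i \<ominus> \<one> |i j. cell n \<one> i j \<and> E i j}" (is "?A = ?B")
  proof
    show "?A \<subseteq> ?B"
    proof
      fix k assume "k \<in> ?A"
      then show "k \<in> ?B"
        by (intro CollectI exI[of _ "k \<oplus> \<one>"] exI[of _ \<one>]) (auto simp: lt_imp_Suc_le)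
    qed
    show "?B \<subseteq> ?A"
      using pred by (auto simp: N.less_iff_succ_less_eq)
  qed
  moreover have "i = i'" if "i \<noteq> \<zero>" "i' \<noteq> \<zero>" "i \<ominus> \<one> = i' \<ominus> \<one>" for i i'
    using pred that by metis
  moreover have "i \<ominus> \<one> \<sqsubseteq> n" if "i \<sqsubseteq> n" "i \<noteq> \<zero>" for i
    using Suc_leD[of "i \<ominus> \<one>" n] that by (simp add: pred)
  ultimately show ?thesis
    using parity_cells_image(1)[OF assms, of "\<lambda>_. \<zero>" SVar "npd (NVar 1)" n] by auto
qed

section \<open>Products and powers over the two-element field\<close>

definition prod2 :: "'n \<Rightarrow> 'n set \<Rightarrow> 'n set \<Rightarrow> 'n set" where
  "prod2 n A B = {pr i j |i j. i \<sqsubset> n \<and> j \<sqsubset> n \<and> parity {k. k \<sqsubset> n \<and> pr i k \<in> A \<and> pr k j \<in> B}}"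

lemma sval_ID [simp]: "sval \<nu> \<sigma> (ID n) = {pr i i |i. i \<sqsubset> nval \<nu> \<sigma> n}"
  by (auto simp: ID_def pr_less N.add_strict_mono)

lemma sval_InnerProd [simp]: "sval \<nu> \<sigma> (InnerProd n i j X Y) =
  {k. k \<sqsubset> nval \<nu> \<sigma> n \<and> pr (nval \<nu> \<sigma> i) k \<in> sval \<nu> \<sigma> X \<and> pr k (nval \<nu> \<sigma> j) \<in> sval \<nu> \<sigma> Y}"
  by (auto simp: InnerProd_def eval_nat_numeral)

lemma sval_Prod2 [simp]: "sval \<nu> \<sigma> (Prod2 n X Y) = prod2 (nval \<nu> \<sigma> n) (sval \<nu> \<sigma> X) (sval \<nu> \<sigma> Y)"
  by (auto simp: Prod2_def prod2_def eval_nat_numeral pr_less N.add_strict_mono)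

lemma sval_Row [simp]: "sval \<nu> \<sigma> (Row x Z) = {w. pr (nval \<nu> \<sigma> x) w \<in> sval \<nu> \<sigma> Z}"
proof -
  have "w \<sqsubset> qn (Len (sterm \<nu> \<sigma> Z))" if "pr (nval \<nu> \<sigma> x) w \<in> sval \<nu> \<sigma> Z" for w
    using mem_less_Len[OF that] pr_ge(2) N.le_less_trans by blast
  then show ?thesis by (auto simp: Row_def)
qed

abbreviation idN :: "nat \<Rightarrow> 'n" where "idN \<equiv> \<lambda>k. qn (NVar k)"

text \<open>When variables stand for themselves, evaluation is membership in \<open>M\<close>. This
  turns axioms and open sequents into statements about values.\<close>

lemma val_id:
  "nval idN SVar t = qn t" "sval idN SVar X = qs X" "oval idN SVar p \<longleftrightarrow> p \<in> M"
proof -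
  show "nval idN SVar t = qn t"
    using qn_cong[of "\<lambda>k. rn (idN k)" NVar SVar SVar t] eqS_refl_mem by (simp add: nval_def sub_id)
  show "sval idN SVar X = qs X"
    using sub_cong_mem(2)[of "\<lambda>k. rn (idN k)" NVar SVar SVar X] eqS_refl_mem
    by (simp add: sterm_def sub_id)
  show "oval idN SVar p \<longleftrightarrow> p \<in> M"
    using mem_cong[of "\<lambda>k. rn (idN k)" NVar SVar SVar p] eqS_refl_mem by (simp add: oval_def sub_id)
qed

abbreviation powseq :: "'n \<Rightarrow> 'n \<Rightarrow> strm \<Rightarrow> 'n \<Rightarrow> 'n set" where
  "powseq n k X z \<equiv> {w. pr z w \<in> qs (SPowSeq (rn n) (rn k) X)}"

lemma powseq_0: "powseq n k X \<zero> = {pr i i |i. i \<sqsubset> n}"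
  using axiom_mem[OF VParL_axiom.powseq_0, of "rn n" "rn k" X]
  unfolding val_id(3)[symmetric] by (simp add: val_id)

lemma powseq_Suc: "z \<sqsubset> k \<Longrightarrow> powseq n k X (z \<oplus> \<one>) = prod2 n (powseq n k X z) (qs X)"
  using axiom_mem[OF VParL_axiom.powseq_Suc, of "rn z" "rn k" "rn n" X]
  unfolding val_id(3)[symmetric] by (simp add: val_id nless_def)

lemma sterm_SPowSeq [simp]:
  "sterm \<nu> \<sigma> (SPowSeq (NVar a) (NVar b) (SVar c)) = SPowSeq (rn (\<nu> a)) (rn (\<nu> b)) (\<sigma> c)"
  by (simp add: sterm_def)

text \<open>\<open>Pow2\<close> takes the power from a sequence whose length depends on the
  exponent. The powers themselves do not depend on the length, so consecutive exponents are related
  by the recursion within one sequence.\<close>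

lemma powseq_indep:
  assumes "z \<sqsubseteq> k" "z \<sqsubseteq> l" shows "powseq n k X z = powseq n l X z"
proof -
  let ?S = "\<lambda>i. Row (NVar 0) (SPowSeq (NVar 3) (NVar i) (SVar 0))"
  have "oval (case_nat z (case_nat k (case_nat l (\<lambda>_. n)))) (\<lambda>_. X)
    (NVar 0 \<^bold>\<le> NVar 1 \<^bold>\<and> NVar 0 \<^bold>\<le> NVar 2 \<^bold>\<longrightarrow> ?S 1 \<^bold>=\<^bold>= ?S 2)"
  proof (rule oval_ind, goal_cases)
    case 1
    show ?case by (simp add: powseq_0)
  next
    case (2 y)
    then show ?case
      using Suc_leD[of y k] Suc_leD[of y l]
      by (auto simp: powseq_Suc N.less_iff_succ_less_eq eval_nat_numeral)
  qed
  with assms show ?thesis by (simp add: eval_nat_numeral)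
qed

definition rs :: "'n set \<Rightarrow> strm" where "rs A = (SOME X. qs X = A)"
text \<open>\<open>Pow2\<close> as a function of sets: \<open>rs\<close> supplies some string with
  the given elements, and by \<open>val_cong\<close> the value depends on these elements
  only.\<close>

definition powm :: "'n \<Rightarrow> 'n \<Rightarrow> 'n set \<Rightarrow> 'n set" where
  "powm n k A = sval (case_nat n (\<lambda>_. k)) (\<lambda>_. rs A) (Pow2 (NVar 0) (NVar 1) (SVar 0))"

lemma qs_rs [simp]: "qs (rs (qs X)) = qs X"
  unfolding rs_def by (rule someI[of _ X]) simp

lemma sval_Pow2 [simp]: "sval \<nu> \<sigma> (Pow2 n k X) = powm (nval \<nu> \<sigma> n) (nval \<nu> \<sigma> k) (sval \<nu> \<sigma> X)"
proof -
  let ?P = "Pow2 (NVar 0) (NVar 1) (SVar 0)"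
  have "Pow2 n k X = ssub (case_nat n (\<lambda>_. k)) (\<lambda>_. X) ?P"
    by (simp add: Pow2_def Row_def)
  then have "sval \<nu> \<sigma> (Pow2 n k X) = sval (\<lambda>i. nval \<nu> \<sigma> (case_nat n (\<lambda>_. k) i)) (\<lambda>_. sterm \<nu> \<sigma> X) ?P"
    by (simp only: val_sub)
  also have "(\<lambda>i. nval \<nu> \<sigma> (case_nat n (\<lambda>_. k) i)) = case_nat (nval \<nu> \<sigma> n) (\<lambda>_. nval \<nu> \<sigma> k)"
    by (auto split: nat.split)
  finally show ?thesis
    unfolding powm_def using val_cong(2)[of "\<lambda>_. rs (sval \<nu> \<sigma> X)" "\<lambda>_. sterm \<nu> \<sigma> X"] by simp
qed

lemma powm_eq: "powm n z (qs X) = powseq n z X z"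
  using sval_Pow2[of "case_nat n (\<lambda>_. z)" "\<lambda>_. X" "NVar 0" "NVar 1" "SVar 0"]
  by (simp add: Pow2_def)

lemma powm_0 [simp]: "powm n \<zero> (qs X) = {pr i i |i. i \<sqsubset> n}"
  by (simp add: powm_eq powseq_0)

lemma powm_Suc: "powm n (z \<oplus> \<one>) (qs X) = prod2 n (powm n z (qs X)) (qs X)"
  using powseq_indep[of z "z \<oplus> \<one>" z n X] by (simp add: powm_eq powseq_Suc)

definition pad :: "'n \<Rightarrow> 'n set \<Rightarrow> 'n set" where
  "pad s A = {pr i j |i j. i \<sqsubset> s \<and> j \<sqsubset> s \<and> pr (i \<oplus> \<one>) (j \<oplus> \<one>) \<in> A}"
definition nmx :: "'n \<Rightarrow> 'n \<Rightarrow> 'n" where "nmx x y = (if x \<sqsubseteq> y then y else x)"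
definition mpow :: "'n \<Rightarrow> 'n set \<Rightarrow> 'n set" where
  "mpow m A = (if \<not> is_mat A then code \<zero> \<zero> (\<lambda>i j. False)
    else if m = \<zero> then code (mrow A) (mrow A) (=)
    else let s = nmx (mrow A) (mcol A) in
      code (mrow A) (mcol A) (\<lambda>i j. pr (i \<ominus> \<one>) (j \<ominus> \<one>) \<in> powm s m (pad s A)))"

section \<open>Decompositions of sums\<close>

lemma msum_single:
  assumes "intern (code \<one> \<one> E)" shows "msum (code \<one> \<one> E) \<longleftrightarrow> E \<one> \<one>"
proof -
  have "cells \<one> \<one> E = (if E \<one> \<one> then {pr \<one> \<one>} else {})" by (auto simp: cells_def le_one_iff)
  then show ?thesis by (simp add: msum_code assms)
qed

lemma msum_empty:
  assumes "intern (code a b E)" "a = \<zero> \<or> b = \<zero>" shows "\<not> msum (code a b E)"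
proof -
  have "cells a b E = {}" using assms(2) by (auto simp: cells_def cell_def)
  then show ?thesis by (simp add: msum_code assms(1))
qed

lemma msum_transpose:
  assumes "intern (code a b E)" "intern (code b a (\<lambda>i j. E j i))"
  shows "msum (code b a (\<lambda>i j. E j i)) \<longleftrightarrow> msum (code a b E)"
  using parity_cells_transpose[OF intern_cells[OF assms(1)]] by (simp add: msum_code assms)

lemma le_Suc_iff: "x \<sqsubseteq> y \<oplus> \<one> \<longleftrightarrow> x \<sqsubseteq> y \<or> x = y \<oplus> \<one>"
  using less_Suc_iff[of x y] nle_refl[of "y \<oplus> \<one>"] unfolding nless_def by blast

lemma intern_empty: "intern {}"
  using intern_Diff[OF intern_singleton intern_singleton, of \<zero> \<zero>] by simp

lemma msum_last:
  assumes "intern (code \<one> (b \<oplus> \<one>) E)" "intern (code \<one> b E)"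
  shows "msum (code \<one> (b \<oplus> \<one>) E) \<longleftrightarrow> msum (code \<one> b E) \<noteq> E \<one> (b \<oplus> \<one>)"
proof -
  let ?L = "if E \<one> (b \<oplus> \<one>) then {pr \<one> (b \<oplus> \<one>)} else {}"
  have eq: "cells \<one> (b \<oplus> \<one>) E = cells \<one> b E \<union> ?L"
    by (auto simp: cells_def le_Suc_iff)
  have L: "intern ?L" using intern_singleton intern_empty by simp
  have "cells \<one> b E \<inter> ?L = {}" by (auto simp: cells_def)
  then have "parity (cells \<one> (b \<oplus> \<one>) E) \<longleftrightarrow> parity (cells \<one> b E) \<noteq> parity ?L"
    unfolding eq using intern_cells[OF assms(1)] intern_cells[OF assms(2)] L by (intro parity_Un) (simp_all add: eq)
  then show ?thesis by (simp add: msum_code assms)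
qed

lemma msum_blocks:
  assumes "intern (code (a \<oplus> \<one>) (b \<oplus> \<one>) E)"
    and "intern (code \<one> b (\<lambda>i j. E \<one> (j \<oplus> \<one>)))" (is "intern (code _ _ ?R)")
    and "intern (code a \<one> (\<lambda>i j. E (i \<oplus> \<one>) \<one>))" (is "intern (code _ _ ?S)")
    and "intern (code a b (\<lambda>i j. E (i \<oplus> \<one>) (j \<oplus> \<one>)))" (is "intern (code _ _ ?M)")
  shows "msum (code (a \<oplus> \<one>) (b \<oplus> \<one>) E) \<longleftrightarrow>
    (((E \<one> \<one> \<noteq> msum (code \<one> b ?R)) \<noteq> msum (code a \<one> ?S)) \<noteq> msum (code a b ?M))"
proof -
  let ?L = "if E \<one> \<one> then {pr \<one> \<one>} else {}"
  \<comment> \<open>A block of one row keeps its row number 1 and moves only in the column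
    direction; for one column it is the reverse.\<close>
  let ?C1 = "{pr (i \<oplus> \<zero>) (j \<oplus> \<one>) |i j. cell \<one> b i j \<and> ?R i j}"
  let ?C2 = "{pr (i \<oplus> \<one>) (j \<oplus> \<zero>) |i j. cell a \<one> i j \<and> ?S i j}"
  let ?C3 = "{pr (i \<oplus> \<one>) (j \<oplus> \<one>) |i j. cell a b i j \<and> ?M i j}"
  have eq: "cells (a \<oplus> \<one>) (b \<oplus> \<one>) E = ?L \<union> ?C1 \<union> ?C2 \<union> ?C3"
  proof (intro set_eqI iffI)
    fix z assume "z \<in> cells (a \<oplus> \<one>) (b \<oplus> \<one>) E"
    then obtain i' j' where z': "z = pr i' j'" "cell (a \<oplus> \<one>) (b \<oplus> \<one>) i' j'" "E i' j'"
      unfolding cells_def by blast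
    \<comment> \<open>With indices lowered by one, the vanishing of i and of j tells to which block
      the cell belongs.\<close>
    then obtain i j where ij: "i' = i \<oplus> \<one>" "j' = j \<oplus> \<one>"
      using pred_exists unfolding cell_def by metis
    with z' have z: "z = pr (i \<oplus> \<one>) (j \<oplus> \<one>)" "i \<sqsubseteq> a" "j \<sqsubseteq> b" "E (i \<oplus> \<one>) (j \<oplus> \<one>)"
      by (auto simp: cell_def)
    show "z \<in> ?L \<union> ?C1 \<union> ?C2 \<union> ?C3"
    proof (cases "i = \<zero>"; cases "j = \<zero>")
      assume "i = \<zero>" "j \<noteq> \<zero>"
      then have "z \<in> ?C1" using z by (intro CollectI exI[of _ \<one>] exI[of _ j]) auto
      then show ?thesis by blast
    next
      assume "i \<noteq> \<zero>" "j = \<zero>"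
      then have "z \<in> ?C2" using z by (intro CollectI exI[of _ i] exI[of _ \<one>]) auto
      then show ?thesis by blast
    next
      assume "i \<noteq> \<zero>" "j \<noteq> \<zero>"
      then have "z \<in> ?C3" using z by (intro CollectI exI[of _ i] exI[of _ j]) (auto simp: cell_def)
      then show ?thesis by blast
    qed (use z in auto)
  next
    fix z assume "z \<in> ?L \<union> ?C1 \<union> ?C2 \<union> ?C3"
    then show "z \<in> cells (a \<oplus> \<one>) (b \<oplus> \<one>) E"
      by (auto simp: cells_def cell_def le_one_iff split: if_splits)
  qed
  have disj: "?L \<inter> ?C1 = {}" "(?L \<union> ?C1) \<inter> ?C2 = {}" "(?L \<union> ?C1 \<union> ?C2) \<inter> ?C3 = {}"
    by (auto simp: cell_def)
  have L: "intern ?L" using intern_singleton intern_empty by simp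
  note C1 = parity_cells_shift[OF intern_cells[OF assms(2)], of \<zero> \<one>]
  note C2 = parity_cells_shift[OF intern_cells[OF assms(3)], of \<one> \<zero>]
  note C3 = parity_cells_shift[OF intern_cells[OF assms(4)], of \<one> \<one>]
  have i1: "intern (?L \<union> ?C1)" by (rule intern_Un[OF L C1(2)])
  have i2: "intern (?L \<union> ?C1 \<union> ?C2)" by (rule intern_Un[OF i1 C2(2)])
  have i3: "intern (?L \<union> ?C1 \<union> ?C2 \<union> ?C3)" by (rule intern_Un[OF i2 C3(2)])
  have "parity (cells (a \<oplus> \<one>) (b \<oplus> \<one>) E) \<longleftrightarrow> (((parity ?L \<noteq> parity ?C1) \<noteq> parity ?C2) \<noteq> parity ?C3)"
    unfolding eq parity_Un[OF i2 C3(2) i3 disj(3)] parity_Un[OF i1 C2(2) i2 disj(2)] parity_Un[OF L C1(2) i1 disj(1)] ..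
  then show ?thesis
    unfolding C1(1) C2(1) C3(1) msum_code[OF assms(1)] msum_code[OF assms(2)] msum_code[OF assms(3)] msum_code[OF assms(4)]
    by simp
qed

lemma sval_spower [simp]: "sval \<nu> \<sigma> (spower m X) = mpow (nval \<nu> \<sigma> m) (sval \<nu> \<sigma> X)"
  by (simp add: spower_def mpow_def Let_def nmx_def pad_def)


section \<open>Validity of LAP in a model\<close>

text \<open>
  Matrix equality does not imply equality of strings: strings that are not codes, and the code of any
  matrix with \<open>0\<close> rows and columns, are all equal as matrices.
\<close>

definition meq :: "'n set \<Rightarrow> 'n set \<Rightarrow> bool" where
  "meq A B \<longleftrightarrow> mrow A = mrow B \<and> mcol A = mcol B \<and> (\<forall>i j. ment A i j \<longleftrightarrow> ment B i j)"

abbreviation vi :: "(nat \<Rightarrow> 'n) \<Rightarrow> (nat \<Rightarrow> strm) \<Rightarrow> lidx \<Rightarrow> 'n" where "vi \<nu> \<sigma> m \<equiv> nval \<nu> \<sigma> (tr_idx m)"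
abbreviation vk :: "(nat \<Rightarrow> 'n) \<Rightarrow> (nat \<Rightarrow> strm) \<Rightarrow> lfld \<Rightarrow> bool" where "vk \<nu> \<sigma> t \<equiv> oval \<nu> \<sigma> (tr_fld t)"
abbreviation vm :: "(nat \<Rightarrow> 'n) \<Rightarrow> (nat \<Rightarrow> strm) \<Rightarrow> lmat \<Rightarrow> 'n set" where "vm \<nu> \<sigma> T \<equiv> sval \<nu> \<sigma> (tr_mat T)"
abbreviation vc :: "(nat \<Rightarrow> 'n) \<Rightarrow> (nat \<Rightarrow> strm) \<Rightarrow> lcnd \<Rightarrow> bool" where "vc \<nu> \<sigma> c \<equiv> oval \<nu> \<sigma> (tr_cnd c)"

primrec lval :: "(nat \<Rightarrow> 'n) \<Rightarrow> (nat \<Rightarrow> strm) \<Rightarrow> lfml \<Rightarrow> bool" where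
  "lval \<nu> \<sigma> (LEqI m n) \<longleftrightarrow> vi \<nu> \<sigma> m = vi \<nu> \<sigma> n"
| "lval \<nu> \<sigma> (LLe m n) \<longleftrightarrow> vi \<nu> \<sigma> m \<sqsubseteq> vi \<nu> \<sigma> n"
| "lval \<nu> \<sigma> (LEqK t u) \<longleftrightarrow> vk \<nu> \<sigma> t = vk \<nu> \<sigma> u"
| "lval \<nu> \<sigma> (LEqM T U) \<longleftrightarrow> meq (vm \<nu> \<sigma> T) (vm \<nu> \<sigma> U)"
| "lval \<nu> \<sigma> (LNot a) \<longleftrightarrow> \<not> lval \<nu> \<sigma> a"
| "lval \<nu> \<sigma> (LAnd a b) \<longleftrightarrow> lval \<nu> \<sigma> a \<and> lval \<nu> \<sigma> b"
| "lval \<nu> \<sigma> (LOr a b) \<longleftrightarrow> lval \<nu> \<sigma> a \<or> lval \<nu> \<sigma> b"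

lemma val_ren:
  "vi \<nu> \<sigma> (iren r m) = vi (\<lambda>k. \<nu> (r k)) \<sigma> m"
  "vk \<nu> \<sigma> (kren r t) = vk (\<lambda>k. \<nu> (r k)) \<sigma> t"
  "vm \<nu> \<sigma> (mren r T) = vm (\<lambda>k. \<nu> (r k)) \<sigma> T"
  "vc \<nu> \<sigma> (cren r c) = vc (\<lambda>k. \<nu> (r k)) \<sigma> c"
proof (induction m and t and T and c arbitrary: \<nu> r and \<nu> r and \<nu> r and \<nu> r)
  case (MLam m n t)
  have "(\<lambda>k. case_nat j (case_nat i \<nu>) (ren_up2 r k)) = case_nat j (case_nat i (\<lambda>k. \<nu> (r k)))" for i j
    by (auto simp: fun_eq_iff ren_up2_def numeral_2_eq_2 split: nat.split)
  then show ?case by (simp add: MLam)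
qed simp_all

lemma val_lift2 [simp]:
  "vi (case_nat j (case_nat i \<nu>)) \<sigma> (iren (\<lambda>k. Suc (Suc k)) m) = vi \<nu> \<sigma> m"
  "vm (case_nat j (case_nat i \<nu>)) \<sigma> (mren (\<lambda>k. Suc (Suc k)) T) = vm \<nu> \<sigma> T"
  by (simp_all add: val_ren)

lemma val_isub:
  "vi \<nu> \<sigma> (isub s m) = vi (\<lambda>k. vi \<nu> \<sigma> (s k)) \<sigma> m"
  "vk \<nu> \<sigma> (ksub s t) = vk (\<lambda>k. vi \<nu> \<sigma> (s k)) \<sigma> t"
  "vm \<nu> \<sigma> (msub s T) = vm (\<lambda>k. vi \<nu> \<sigma> (s k)) \<sigma> T"
  "vc \<nu> \<sigma> (csub s c) = vc (\<lambda>k. vi \<nu> \<sigma> (s k)) \<sigma> c"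
proof (induction m and t and T and c arbitrary: \<nu> s and \<nu> s and \<nu> s and \<nu> s)
  case (MLam m n t)
  have "(\<lambda>k. vi (case_nat j (case_nat i \<nu>)) \<sigma> (sub_up2 s k)) = case_nat j (case_nat i (\<lambda>k. vi \<nu> \<sigma> (s k)))" for i j
    by (auto simp: fun_eq_iff sub_up2_def numeral_2_eq_2 val_ren split: nat.split)
  then show ?case by (simp add: MLam)
qed simp_all

lemma lval_lsub: "lval \<nu> \<sigma> (lsub s a) \<longleftrightarrow> lval (\<lambda>k. vi \<nu> \<sigma> (s k)) \<sigma> a"
  by (induction a) (simp_all add: val_isub)

lemma lval_fml_of_cnd [simp]: "lval \<nu> \<sigma> (fml_of_cnd c) \<longleftrightarrow> vc \<nu> \<sigma> c"
  by (induction c) simp_all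

text \<open>Codes are determined by dimensions and entries. If one side is not a code, its
  dimensions are 0 by default and force those of the other side to be 0.\<close>

lemma meq_cases:
  assumes "meq A B"
  obtains "A = B" | "\<not> is_mat A" "mrow B = \<zero>" "mcol B = \<zero>" | "\<not> is_mat B" "mrow A = \<zero>" "mcol A = \<zero>"
proof (cases "is_mat A \<and> is_mat B")
  case True
  with assms have "A = B"
    using code_eq[of A] code_eq[of B] code_cong[of "mrow A" "mcol A" "ment A" "ment B"] by (auto simp: meq_def)
  then show ?thesis by (rule that)
next
  case False
  with assms that show ?thesis by (auto simp: meq_def)
qed

text \<open>In the degenerate cases both sums vanish: one side is not a code and the other has no
  cells.\<close>

lemma msum_meq:
  assumes "meq A B" "intern A" "intern B" shows "msum A \<longleftrightarrow> msum B"
proof -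
  have *: "\<not> msum C" if "intern C" "mrow C = \<zero>" for C
    using msum_empty[of "mrow C" "mcol C" "ment C"] that code_eq[of C] by (cases "is_mat C") (auto simp: msum_def)
  show ?thesis
    using assms(1) by (rule meq_cases) (use assms * in \<open>auto simp: msum_def\<close>)
qed

lemma mpow_meq: "meq A B \<Longrightarrow> meq (mpow m A) (mpow m B)"
  by (erule meq_cases) (auto simp: meq_def mpow_def cell_def Let_def)

lemma sval_lap_id [simp]: "vm \<nu> \<sigma> (lap_id m) = code (vi \<nu> \<sigma> m) (vi \<nu> \<sigma> m) (=)"
  by (simp add: lap_id_def)

lemma intern_sval [simp]: "intern (qs X)" by (rule rangeI)

lemma ment_outside: "i = \<zero> \<or> mrow A \<sqsubset> i \<or> j = \<zero> \<or> mcol A \<sqsubset> j \<Longrightarrow> \<not> ment A i j"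
  using ment_imp_cell[of A i j] N.leD by (auto simp: cell_def)

lemma msum_eq_code:
  assumes "intern A" shows "msum A \<longleftrightarrow> msum (code (mrow A) (mcol A) (ment A))" "is_mat A \<Longrightarrow> intern (code (mrow A) (mcol A) (ment A))"
proof -
  \<comment> \<open>For a string that is not a code, dimensions and entries rebuild the code of the
    0 by 0 matrix. It consists of its header alone and has sum 0, as does the string itself.\<close>
  have "code \<zero> \<zero> E = {pr \<zero> (pr \<zero> \<zero>)}" for E
    by (auto simp: code_def cell_def)
  then show "msum A \<longleftrightarrow> msum (code (mrow A) (mcol A) (ment A))"
    by (cases "is_mat A") (auto simp: code_eq msum_def)
qed (simp add: code_eq assms)

text \<open>The core of A36. The product in LAP sums over the columns of the m-th power,
  \<open>Prod2\<close> over all k below max(r, c). The additional terms vanish: for m = 0 only k = i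
  contributes, and for positive m the columns of the padded power beyond c are zero.\<close>

lemma mpow_Suc:
  assumes X: "A = qs X"
    and C: "C = code (mrow (mpow m A)) (mcol A) (\<lambda>i j. msum (D i j))"
    and D: "\<And>i j. D i j = code (mcol (mpow m A)) \<one> (\<lambda>k l. ment (mpow m A) i k \<and> ment A k j)"
    and D_intern: "\<And>i j. intern (D i j)"
    and P: "intern (pad (nmx (mrow A) (mcol A)) A)"
  shows "meq (mpow (m \<oplus> \<one>) A) C"
proof (cases "is_mat A")
  case False
  then show ?thesis unfolding C by (auto simp: meq_def mpow_def cell_def)
next
  case True
  let ?r = "mrow A" and ?c = "mcol A"
  let ?s = "nmx ?r ?c" and ?P = "pad (nmx ?r ?c) A"
  have rs: "?r \<sqsubseteq> ?s" and cs: "?c \<sqsubseteq> ?s" using N.linear[of ?r ?c] by (auto simp: nmx_def)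
  have row: "mrow (mpow m A) = ?r" for m using True by (simp add: mpow_def Let_def)
  have col: "mcol (mpow (m \<oplus> \<one>) A) = ?c" using True by (simp add: mpow_def Let_def B1)
  have pad: "pr k j \<in> ?P \<longleftrightarrow> k \<sqsubset> ?s \<and> j \<sqsubset> ?s \<and> ment A (k \<oplus> \<one>) (j \<oplus> \<one>)" for k j
    using True by (auto simp: pad_def ment_def)
  have "pr i j \<in> powm ?s (m \<oplus> \<one>) ?P \<longleftrightarrow> msum (D (i \<oplus> \<one>) (j \<oplus> \<one>))" if ij: "i \<sqsubset> ?r" "j \<sqsubset> ?c" for i j
  proof -
    obtain Y where Y: "?P = qs Y" using P by auto
    have ir: "i \<sqsubset> ?s" and js: "j \<sqsubset> ?s" using ij rs cs N.less_le_trans by blast+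
    let ?K = "{k. k \<sqsubset> ?s \<and> pr i k \<in> powm ?s m ?P \<and> pr k j \<in> ?P}"
    let ?L = "{k. k \<sqsubset> mcol (mpow m A) \<and> ment (mpow m A) (i \<oplus> \<one>) (k \<oplus> \<one>) \<and> ment A (k \<oplus> \<one>) (j \<oplus> \<one>)}"
    have "pr i j \<in> powm ?s (m \<oplus> \<one>) ?P \<longleftrightarrow> parity ?K"
      unfolding Y powm_Suc using ir js by (auto simp: prod2_def)
    moreover have "msum (D (i \<oplus> \<one>) (j \<oplus> \<one>)) \<longleftrightarrow> parity ?L"
      using parity_column[OF intern_cells[OF D_intern[unfolded D]]] msum_code[OF D_intern[unfolded D]]
      by (simp add: D)
    moreover have "?K = ?L"
    proof (rule zero_or_Suc[of m])
      assume m: "m = \<zero>"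
      \<comment> \<open>The power 0 is the r by r identity, so the inner sum has length r and not
        c.\<close>
      have "mcol (mpow m A) = ?r" "ment (mpow m A) (i \<oplus> \<one>) (k \<oplus> \<one>) \<longleftrightarrow> i = k" for k
        using True m ij by (auto simp: mpow_def cell_def B1 N.less_iff_succ_less_eq)
      then show ?thesis
        using ir js ij unfolding Y m powm_0 unfolding Y[symmetric] pad by auto
    next
      fix m' assume m: "m = m' \<oplus> \<one>"
      have ent: "mcol (mpow m A) = ?c" "ment (mpow m A) (i \<oplus> \<one>) (k \<oplus> \<one>) \<longleftrightarrow> k \<sqsubset> ?c \<and> pr i k \<in> powm ?s m ?P" for k
        using True m ij by (auto simp: mpow_def Let_def cell_def B1 N.less_iff_succ_less_eq)
      \<comment> \<open>A nonzero entry in column k of a product requires a nonzero entry in column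
        k of its last factor, the padded matrix; this is why the truncation to c columns discards
        only zeros.\<close>
      have "k \<sqsubset> ?c" if "pr i k \<in> powm ?s m ?P" for k
      proof -
        from that have "parity {l. l \<sqsubset> ?s \<and> pr i l \<in> powm ?s m' ?P \<and> pr l k \<in> ?P}"
          unfolding m Y powm_Suc by (auto simp: prod2_def)
        then obtain l where "pr l k \<in> ?P" using parity_empty by fastforce
        then have "ment A (l \<oplus> \<one>) (k \<oplus> \<one>)" by (simp add: pad)
        then show ?thesis using ment_imp_cell by (auto simp: cell_def N.less_iff_succ_less_eq)
      qed
      moreover have "k \<sqsubset> ?s" if "k \<sqsubset> ?c" for k
        using that cs N.less_le_trans by blast
      ultimately show ?thesis
        unfolding ent pad using js by blast
    qed
    ultimately show ?thesis by simp
  qed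
  note entry = this
  have "ment (mpow (m \<oplus> \<one>) A) i j \<longleftrightarrow> ment C i j" for i j
  proof (cases "cell ?r ?c i j")
    case True
    then obtain i' j' where ij: "i = i' \<oplus> \<one>" "j = j' \<oplus> \<one>" "i' \<sqsubset> ?r" "j' \<sqsubset> ?c"
      unfolding cell_def using pred_exists N.less_iff_succ_less_eq by metis
    show ?thesis
      using entry[OF ij(3,4)] True \<open>is_mat A\<close> unfolding C row by (simp add: mpow_def Let_def B1 ij(1,2))
  next
    case False
    then show ?thesis using \<open>is_mat A\<close> unfolding C row by (simp add: mpow_def Let_def B1)
  qed
  then show ?thesis unfolding C meq_def row col using row by simp
qed


lemma one_le_iff: "\<one> \<sqsubseteq> x \<longleftrightarrow> x \<noteq> \<zero>"
  by (rule zero_or_Suc[of x]) auto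

lemma msum_fold: "\<not> parity A \<and> is_mat A \<longleftrightarrow> msum A"
  by (auto simp: msum_def)

lemma is_mat_row: "mrow A = a \<Longrightarrow> a \<noteq> \<zero> \<Longrightarrow> is_mat A" and is_mat_col: "mcol A = a \<Longrightarrow> a \<noteq> \<zero> \<Longrightarrow> is_mat A"
  by (metis not_mat)+

lemma one_neq_zero [simp]: "\<one> \<noteq> \<zero>"
  using B1[of \<zero>] by simp

lemma vm_lap_transpose: "vm \<nu> \<sigma> (lap_transpose T) = code (mcol (vm \<nu> \<sigma> T)) (mrow (vm \<nu> \<sigma> T)) (\<lambda>i j. ment (vm \<nu> \<sigma> T) j i)"
  by (simp add: lap_transpose_def)

lemma vm_lap_R: "vm \<nu> \<sigma> (lap_R T) = code \<one> (mcol (vm \<nu> \<sigma> T) \<ominus> \<one>) (\<lambda>i j. ment (vm \<nu> \<sigma> T) \<one> (j \<oplus> \<one>))"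
  by (simp add: lap_R_def)

lemma vm_lap_S: "vm \<nu> \<sigma> (lap_S T) = code (mrow (vm \<nu> \<sigma> T) \<ominus> \<one>) \<one> (\<lambda>i j. ment (vm \<nu> \<sigma> T) (i \<oplus> \<one>) \<one>)"
  by (simp add: lap_S_def)

lemma vm_lap_M: "vm \<nu> \<sigma> (lap_M T) = code (mrow (vm \<nu> \<sigma> T) \<ominus> \<one>) (mcol (vm \<nu> \<sigma> T) \<ominus> \<one>)
    (\<lambda>i j. ment (vm \<nu> \<sigma> T) (i \<oplus> \<one>) (j \<oplus> \<one>))"
  by (simp add: lap_M_def)

abbreviation lap_prods :: "lmat \<Rightarrow> lmat \<Rightarrow> lmat" where
  "lap_prods A B \<equiv> MLam (ilift2 (ICol A)) IOne
        (KMul (KEntry (mlift2 (mlift2 A)) (IVar 3) (IVar 1))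
              (KEntry (mlift2 (mlift2 B)) (IVar 1) (IVar 2)))"

lemma vm_lap_prods: "vm (case_nat j (case_nat i \<nu>)) \<sigma> (lap_prods A B) =
    code (mcol (vm \<nu> \<sigma> A)) \<one> (\<lambda>k l. ment (vm \<nu> \<sigma> A) i k \<and> ment (vm \<nu> \<sigma> B) k j)"
  by (simp add: eval_nat_numeral)

lemma vm_lap_mult: "vm \<nu> \<sigma> (lap_mult A B) = code (mrow (vm \<nu> \<sigma> A)) (mcol (vm \<nu> \<sigma> B))
    (\<lambda>i j. msum (vm (case_nat j (case_nat i \<nu>)) \<sigma> (lap_prods A B)))"
  unfolding lap_mult_def by (simp add: msum_fold del: tr_mat.simps(2) add: tr_mat.simps(2)[of "IRow A"])

lemma dv_remainder:
  assumes "y \<noteq> \<zero>"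
  shows "x \<ominus> y \<otimes> dv x y \<sqsubset> y" "x = y \<otimes> dv x y \<oplus> (x \<ominus> y \<otimes> dv x y)"
proof -
  obtain r where r: "x = y \<otimes> dv x y \<oplus> r"
    using dv_bounds(1)[OF assms, of x] by (auto simp: le_iff_add')
  then have d: "x \<ominus> y \<otimes> dv x y = r" using add_diff by metis
  have "y \<otimes> dv x y \<oplus> r \<sqsubset> y \<otimes> dv x y \<oplus> y"
    using dv_bounds(2)[OF assms, of x] r by (simp add: N.distrib_left)
  then have "r \<sqsubset> y" by simp
  then show "x \<ominus> y \<otimes> dv x y \<sqsubset> y" "x = y \<otimes> dv x y \<oplus> (x \<ominus> y \<otimes> dv x y)"
    unfolding d using r by simp_all
qed

lemma vk_sum: "vk \<nu> \<sigma> (KSum T) \<longleftrightarrow> msum (vm \<nu> \<sigma> T)"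
  by (auto simp: msum_def)

lemma vk_add: "vk \<nu> \<sigma> (KAdd t u) \<longleftrightarrow> vk \<nu> \<sigma> t \<noteq> vk \<nu> \<sigma> u"
  by auto

lemma vk_entry: "vk \<nu> \<sigma> (KEntry T m n) \<longleftrightarrow> ment (vm \<nu> \<sigma> T) (vi \<nu> \<sigma> m) (vi \<nu> \<sigma> n)"
  by simp

theorem LAP_axiom_valid:
  assumes "LAP_axiom \<Gamma> \<Delta>" "\<forall>\<alpha>\<in>set \<Gamma>. lval \<nu> \<sigma> \<alpha>"
  shows "\<exists>\<beta>\<in>set \<Delta>. lval \<nu> \<sigma> \<beta>"
  using assms
proof (induction rule: LAP_axiom.induct)
  case (A4_sum T U)
  then show ?case using msum_meq[of "vm \<nu> \<sigma> T" "vm \<nu> \<sigma> U"] by (simp add: msum_fold)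
next
  case (A4_pow m m' T U)
  then show ?case using mpow_meq[of "vm \<nu> \<sigma> T" "vm \<nu> \<sigma> U"] by simp
next
  case (A15a i j k)
  then have "vi \<nu> \<sigma> j = vi \<nu> \<sigma> i \<oplus> vi \<nu> \<sigma> k" by simp
  then show ?case by (simp add: add_diff)
next
  case (A15b i j)
  then show ?case by (auto simp: nminus_def)
next
  case (A16a j i)
  then show ?case using dv_remainder[of "vi \<nu> \<sigma> j" "vi \<nu> \<sigma> i"] by (simp add: LLt_def nless_def)
next
  case (A16b j i)
  then show ?case using dv_remainder[of "vi \<nu> \<sigma> j" "vi \<nu> \<sigma> i"] by simp
next
  case (A28 i T j)
  then show ?case using ment_outside[of "vi \<nu> \<sigma> i" "vm \<nu> \<sigma> T" "vi \<nu> \<sigma> j"]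
    by (auto simp: LLt_def nless_def)
next
  case (A29c i m j n t)
  have "(\<lambda>k. vi \<nu> \<sigma> (case_nat j (case_nat i IVar) k)) = case_nat (vi \<nu> \<sigma> j) (case_nat (vi \<nu> \<sigma> i) \<nu>)"
    by (auto simp: fun_eq_iff split: nat.split)
  with A29c show ?case by (simp add: val_isub cell_def one_le_iff)
next
  case (A30 T)
  let ?A = "vm \<nu> \<sigma> T"
  from A30 have "mrow ?A = \<one>" "mcol ?A = \<one>" by simp_all
  then have "intern (code \<one> \<one> (ment ?A))"
    using msum_eq_code(2)[of ?A] is_mat_row[of ?A \<one>] by simp
  then have "msum ?A \<longleftrightarrow> ment ?A \<one> \<one>"
    using msum_eq_code(1)[of ?A, OF intern_sval] msum_single[of "ment ?A"] \<open>mrow ?A = \<one>\<close> \<open>mcol ?A = \<one>\<close>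
    by (simp only:)
  then show ?case by (simp add: msum_fold)
next
  case (A31 T)
  let ?A = "vm \<nu> \<sigma> T" and ?L = "MLam IOne (IMinus (ICol T) IOne) (KEntry (mlift2 T) (IVar 1) (IVar 0))"
  from A31 obtain b where A: "mrow ?A = \<one>" "mcol ?A = b \<oplus> \<one>"
    using pred_exists[of "mcol ?A"] by (auto simp: LLt_def one_le_iff)
  then have L: "vm \<nu> \<sigma> ?L = code \<one> b (ment ?A)" by simp
  have "is_mat ?A" using is_mat_row[OF A(1)] by simp
  then have I: "intern (code \<one> (b \<oplus> \<one>) (ment ?A))"
    using msum_eq_code(2)[of ?A] A by simp
  have "intern (vm \<nu> \<sigma> ?L)" by (rule intern_sval)
  then have "msum (code \<one> (b \<oplus> \<one>) (ment ?A)) \<longleftrightarrow> msum (vm \<nu> \<sigma> ?L) \<noteq> ment ?A \<one> (b \<oplus> \<one>)"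
    unfolding L by (rule msum_last[OF I])
  then have "msum ?A \<longleftrightarrow> msum (vm \<nu> \<sigma> ?L) \<noteq> ment ?A (vi \<nu> \<sigma> IOne) (vi \<nu> \<sigma> (ICol T))"
    using msum_eq_code(1)[of ?A, OF intern_sval] A by simp
  then have "lval \<nu> \<sigma> (LEqK (KSum T) (KAdd (KSum ?L) (KEntry T IOne (ICol T))))"
    by (simp only: lval.simps vk_sum vk_add vk_entry)
  then show ?case by (rule bexI) (rule list.set_intros)
next
  case (A32 T)
  let ?A = "vm \<nu> \<sigma> T"
  from A32 have A: "mcol ?A = \<one>" by simp
  have I: "intern (code (mrow ?A) (mcol ?A) (ment ?A))"
    using msum_eq_code(2)[of ?A] is_mat_col[OF A] by simp
  have "intern (vm \<nu> \<sigma> (lap_transpose T))" by (rule intern_sval)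
  then have "msum (vm \<nu> \<sigma> (lap_transpose T)) \<longleftrightarrow> msum (code (mrow ?A) (mcol ?A) (ment ?A))"
    unfolding vm_lap_transpose by (rule msum_transpose[OF I])
  then have "msum ?A \<longleftrightarrow> msum (vm \<nu> \<sigma> (lap_transpose T))"
    using msum_eq_code(1)[of ?A, OF intern_sval] by (simp only:)
  then show ?case by (simp add: msum_fold)
next
  case (A33 T)
  let ?A = "vm \<nu> \<sigma> T"
  from A33 obtain a b where A: "mrow ?A = a \<oplus> \<one>" "mcol ?A = b \<oplus> \<one>"
    using pred_exists[of "mcol ?A"] pred_exists[of "mrow ?A"] by (auto simp: LLt_def one_le_iff)
  show ?case
  proof (rule bexI)
    have "is_mat ?A" using is_mat_row[OF A(1)] by (simp add: B1)
    then have I: "intern (code (a \<oplus> \<one>) (b \<oplus> \<one>) (ment ?A))"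
      using msum_eq_code(2)[of ?A] A by simp
    have RSM: "vm \<nu> \<sigma> (lap_R T) = code \<one> b (\<lambda>i j. ment ?A \<one> (j \<oplus> \<one>))"
      "vm \<nu> \<sigma> (lap_S T) = code a \<one> (\<lambda>i j. ment ?A (i \<oplus> \<one>) \<one>)"
      "vm \<nu> \<sigma> (lap_M T) = code a b (\<lambda>i j. ment ?A (i \<oplus> \<one>) (j \<oplus> \<one>))"
      by (simp_all add: vm_lap_R vm_lap_S vm_lap_M A)
    note blocks = msum_blocks[of a b "ment ?A", OF I, folded RSM, OF intern_sval intern_sval intern_sval]
    show "lval \<nu> \<sigma> (LEqK (KSum T) (KAdd (KAdd (KAdd (KEntry T IOne IOne) (KSum (lap_R T)))
        (KSum (lap_S T))) (KSum (lap_M T))))"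
      unfolding lval.simps vk_sum vk_add vk_entry
      using blocks msum_eq_code(1)[of ?A, OF intern_sval] A by simp
  qed (rule list.set_intros)
next
  case (A34 T)
  let ?A = "vm \<nu> \<sigma> T"
  from A34 have "mrow ?A = \<zero> \<or> mcol ?A = \<zero>" by simp
  moreover have "\<not> msum ?A" if "mrow ?A = \<zero> \<or> mcol ?A = \<zero>"
  proof (cases "is_mat ?A")
    case True
    with msum_empty[OF msum_eq_code(2)[OF intern_sval True] that] msum_eq_code(1)[of ?A, OF intern_sval]
    show ?thesis by blast
  qed (simp add: msum_def)
  ultimately show ?case by (simp add: msum_fold)
next
  case (A35 T)
  show ?case by (simp add: meq_def mpow_def cell_def)
next
  case (A36 n T)
  let ?A = "vm \<nu> \<sigma> T" and ?m = "vi \<nu> \<sigma> n"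
  let ?D = "\<lambda>i j. vm (case_nat j (case_nat i \<nu>)) \<sigma> (lap_prods (MPow n T) T)"
  have MP: "vm \<nu> \<sigma> (MPow n T) = mpow ?m ?A" by simp
  have "meq (mpow (?m \<oplus> \<one>) ?A) (vm \<nu> \<sigma> (lap_mult (MPow n T) T))"
  proof (rule mpow_Suc[OF refl])
    show "vm \<nu> \<sigma> (lap_mult (MPow n T) T) = code (mrow (mpow ?m ?A)) (mcol ?A) (\<lambda>i j. msum (?D i j))"
      by (simp only: vm_lap_mult MP)
    show "?D i j = code (mcol (mpow ?m ?A)) \<one> (\<lambda>k l. ment (mpow ?m ?A) i k \<and> ment ?A k j)" for i j
      by (simp only: vm_lap_prods MP)
    show "intern (?D i j)" for i j by (rule intern_sval)
    show "intern (pad (nmx (mrow ?A) (mcol ?A)) ?A)"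
      \<comment> \<open>The padded matrix is the value of \<open>spad\<close>, hence a string of the
        model.\<close>
      using intern_sval[of "sterm \<nu> \<sigma> (spad (nmax (nrow (tr_mat T)) (ncol (tr_mat T))) (tr_mat T))"]
      by (cases "mrow ?A \<sqsubseteq> mcol ?A") (simp_all add: nmx_def pad_def)
  qed
  then show ?case by simp
qed (auto simp: LLt_def meq_def B1 B3 B4 B5 B6 B7 B8 nle_refl)

end

section \<open>Quantifier-free form of the translation\<close>

definition oall2 :: "ntrm \<Rightarrow> oform \<Rightarrow> oform" where
  "oall2 b p = oball (b \<^bold>+ NOne) (oball (nlift 1 b \<^bold>+ NOne) p)"

abbreviation (input) fall2 :: "ntrm \<Rightarrow> oform \<Rightarrow> form" where
  "fall2 b p \<equiv> fball_le b (fball_le (nlift 1 b) (form_of p))"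

lemma (in vmodel) oval_oall2 [simp]:
  "oval \<nu> \<sigma> (oall2 b p) \<longleftrightarrow>
    (\<forall>x y. x \<sqsubseteq> nval \<nu> \<sigma> b \<longrightarrow> y \<sqsubseteq> nval \<nu> \<sigma> b \<longrightarrow> oval (case_nat y (case_nat x \<nu>)) \<sigma> p)"
  by (auto simp: oall2_def)

text \<open>In a countermodel supplied by completeness the free variables stand for themselves; this
  is the valuation \<open>idN\<close>, \<open>SVar\<close>.\<close>

lemma open_valid:
  assumes "\<And>M (qn :: ntrm \<Rightarrow> nat) \<nu> \<sigma>. vmodel M qn \<Longrightarrow> (\<And>p. p \<in> set \<Gamma> \<Longrightarrow> vmodel.oval M qn \<nu> \<sigma> p)
    \<Longrightarrow> \<exists>p\<in>set \<Delta>. vmodel.oval M qn \<nu> \<sigma> p"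
  shows "VParL_proves (map form_of \<Gamma>) (map form_of \<Delta>)"
proof (rule open_model_completeness)
  fix M and qn :: "ntrm \<Rightarrow> nat"
  assume M: "vmodel M qn" "set \<Gamma> \<subseteq> M"
  interpret vmodel M qn by fact
  from assms[OF M(1), of idN SVar] M(2) show "set \<Delta> \<inter> M \<noteq> {}" by (auto simp: val_id)
qed

text \<open>With eigenvariables for x and y the claim is an open sequent, provable because it is
  valid; the remaining rules restore the two quantifiers from inside out.\<close>

lemma oall2_imp_fall2: "VParL_proves [form_of (oall2 b p)] [fall2 b p]"
proof -
  let ?q = "olift 1 (olift 1 (oall2 b p))"
  let ?x = "\<^bold>\<not> NVar 1 \<^bold>\<le> nlift 1 (nlift 1 b)" and ?y = "\<^bold>\<not> NVar 0 \<^bold>\<le> nlift 1 (nlift 1 b)"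
  have "VParL_proves (map form_of [?q]) (map form_of [?y, p, ?x])"
  proof (rule open_valid)
    fix M and qn :: "ntrm \<Rightarrow> nat" and \<nu> \<sigma>
    assume M: "vmodel M qn" and h: "\<And>q. q \<in> set [?q] \<Longrightarrow> vmodel.oval M qn \<nu> \<sigma> q"
    interpret vmodel M qn by fact
    \<comment> \<open>Separates the values of the two eigenvariables from the valuation of the
      context.\<close>
    have "\<nu> = case_nat (\<nu> 0) (case_nat (\<nu> 1) (\<lambda>k. \<nu> (Suc (Suc k))))"
      by (auto simp: fun_eq_iff split: nat.split)
    then obtain x y \<mu> where \<nu>': "\<nu> = case_nat y (case_nat x \<mu>)" by blast
    have "oval \<nu> \<sigma> ?q" by (rule h) simp
    then show "\<exists>q\<in>set [?y, p, ?x]. oval \<nu> \<sigma> q"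
      unfolding \<nu>' by auto
  qed
  then have "VParL_proves [form_of ?q] [form_of ?y, form_of p, form_of ?x]"
    by (simp only: list.map)
  then have "VParL_proves [form_of ?q] [FOr (form_of ?y) (form_of p), form_of ?x]"
    by (rule VParL_proves.or_right)
  then have "VParL_proves (map fliftN [form_of (olift 1 (oall2 b p))])
      (FOr (form_of ?y) (form_of p) # map fliftN [FNot (FAtom (Le (NVar 0) (nlift 1 b)))])"
    by simp
  then have "VParL_proves [form_of (olift 1 (oall2 b p))]
      [FAllN (FOr (form_of ?y) (form_of p)), FNot (FAtom (Le (NVar 0) (nlift 1 b)))]"
    by (rule VParL_proves.allN_right)
  then have "VParL_proves [form_of (olift 1 (oall2 b p))]
      [FNot (FAtom (Le (NVar 0) (nlift 1 b))), FAllN (FOr (form_of ?y) (form_of p))]"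
    by (rule VParL_proves.structural) (simp_all only: list.set insert_commute order_refl)
  then have "VParL_proves [form_of (olift 1 (oall2 b p))]
      [FOr (FNot (FAtom (Le (NVar 0) (nlift 1 b)))) (FAllN (FOr (form_of ?y) (form_of p)))]"
    by (rule VParL_proves.or_right)
  then have "VParL_proves (map fliftN [form_of (oall2 b p)])
      (FOr (FNot (FAtom (Le (NVar 0) (nlift 1 b)))) (FAllN (FOr (form_of ?y) (form_of p))) # map fliftN [])"
    by simp
  then have "VParL_proves [form_of (oall2 b p)]
      [FAllN (FOr (FNot (FAtom (Le (NVar 0) (nlift 1 b)))) (FAllN (FOr (form_of ?y) (form_of p))))]"
    by (rule VParL_proves.allN_right)
  then show ?thesis by (simp only: fball_le_def form_of.simps)
qed

text \<open>
  The row and column of the first counterexample to \<open>\<forall>x y\<le>b. p\<close>: instantiated with these terms, the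
  quantified formula implies its open form.
\<close>

definition bad_row :: "ntrm \<Rightarrow> oform \<Rightarrow> ntrm" where
  "bad_row b p = mu (b \<^bold>+ NOne) (\<^bold>\<not> oball (nlift 1 b \<^bold>+ NOne) p)"
abbreviation row_of :: "ntrm \<Rightarrow> oform \<Rightarrow> oform" where
  "row_of b p \<equiv> osub (upN (case_nat (bad_row b p) NVar)) SVar p"
definition bad_col :: "ntrm \<Rightarrow> oform \<Rightarrow> ntrm" where
  "bad_col b p = mu (b \<^bold>+ NOne) (\<^bold>\<not> row_of b p)"

context vmodel
begin

lemma bad_row_large: "\<not> nval \<nu> \<sigma> (bad_row b p) \<sqsubseteq> nval \<nu> \<sigma> b \<Longrightarrow> oval \<nu> \<sigma> (oall2 b p)"
proof -
  assume large: "\<not> nval \<nu> \<sigma> (bad_row b p) \<sqsubseteq> nval \<nu> \<sigma> b"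
  have "oval (case_nat z \<nu>) \<sigma> (oball (nlift 1 b \<^bold>+ NOne) p)" if "z \<sqsubseteq> nval \<nu> \<sigma> b" for z
  proof -
    have "z \<sqsubset> nval \<nu> \<sigma> (bad_row b p)" using that large N.le_less_trans N.not_le by blast
    then show ?thesis unfolding bad_row_def using nval_mu(3) oval_simps(7) by blast
  qed
  then show ?thesis by simp
qed

text \<open>If the column found is within the bound, the assumed instance contradicts its choice as
  a counterexample. So the row found has no counterexample, which in turn means that it exceeds the
  bound and every row is correct.\<close>

lemma bad_entry:
  assumes "nval \<nu> \<sigma> (bad_col b p) \<sqsubseteq> nval \<nu> \<sigma> b \<Longrightarrow> oval \<nu> \<sigma> (osub (case_nat (bad_col b p) NVar) SVar (row_of b p))"
  shows "oval \<nu> \<sigma> (oall2 b p)"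
proof -
  let ?X = "nval \<nu> \<sigma> (bad_row b p)" and ?Y = "nval \<nu> \<sigma> (bad_col b p)" and ?B = "nval \<nu> \<sigma> b"
  have env: "(\<lambda>k. nval (case_nat z \<nu>) \<sigma> (upN (case_nat (bad_row b p) NVar) k)) = case_nat z (case_nat ?X \<nu>)" for z
    by (auto simp: fun_eq_iff upN_def split: nat.split)
  have row: "oval (case_nat z \<nu>) \<sigma> (row_of b p) \<longleftrightarrow> oval (case_nat z (case_nat ?X \<nu>)) \<sigma> p" for z
    by (simp add: val_sub env)
  have "(\<lambda>k. nval \<nu> \<sigma> (case_nat (bad_col b p) NVar k)) = case_nat ?Y \<nu>"
    by (auto simp: fun_eq_iff split: nat.split)
  then have "oval \<nu> \<sigma> (osub (case_nat (bad_col b p) NVar) SVar (row_of b p)) \<longleftrightarrow>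
      oval (case_nat ?Y \<nu>) \<sigma> (row_of b p)"
    by (simp add: val_sub(3)[of _ _ "case_nat (bad_col b p) NVar"])
  with assms have "\<not> ?Y \<sqsubseteq> ?B"
    using nval_mu(2)[where \<nu>=\<nu> and \<sigma>=\<sigma> and b="b \<^bold>+ NOne" and p="\<^bold>\<not> row_of b p", folded bad_col_def]
    by auto
  then have "oval (case_nat z (case_nat ?X \<nu>)) \<sigma> p" if "z \<sqsubseteq> ?B" for z
    using nval_mu(3)[where \<nu>=\<nu> and \<sigma>=\<sigma> and b="b \<^bold>+ NOne" and p="\<^bold>\<not> row_of b p" and z=z, folded bad_col_def]
      N.le_less_trans[OF that, of ?Y] row[of z] by (simp add: N.not_le)
  then have "\<not> ?X \<sqsubseteq> ?B"
    using nval_mu(2)[where \<nu>=\<nu> and \<sigma>=\<sigma> and b="b \<^bold>+ NOne" and p="\<^bold>\<not> oball (nlift 1 b \<^bold>+ NOne) p", folded bad_row_def]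
    by auto
  then show ?thesis by (rule bad_row_large)
qed

end

lemma fall2_imp_oall2: "VParL_proves [fall2 b p] [form_of (oall2 b p)]"
proof -
  let ?b' = "nlift 1 b" and ?x = "bad_row b p" and ?y = "bad_col b p"
  \<comment> \<open>The matrix left over after instantiating both quantifiers, the row first:
    \<open>bad_col\<close> is formed from the formula in which the row is already
    \<open>bad_row\<close>.\<close>
  let ?r = "(\<^bold>\<not> ?y \<^bold>\<le> b) \<^bold>\<or> osub (case_nat ?y NVar) SVar (row_of b p)"
  have "VParL_proves (map form_of [\<^bold>\<not> ?x \<^bold>\<le> b]) (map form_of [oall2 b p])"
  proof (rule open_valid)
    fix M and qn :: "ntrm \<Rightarrow> nat" and \<nu> \<sigma>
    assume M: "vmodel M qn" and h: "\<And>q. q \<in> set [\<^bold>\<not> ?x \<^bold>\<le> b] \<Longrightarrow> vmodel.oval M qn \<nu> \<sigma> q"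
    interpret vmodel M qn by fact
    have "oval \<nu> \<sigma> (\<^bold>\<not> ?x \<^bold>\<le> b)" by (rule h) simp
    then have "oval \<nu> \<sigma> (oall2 b p)" by (intro bad_row_large) (simp only: oval_simps not_False_eq_True)
    then show "\<exists>q\<in>set [oall2 b p]. oval \<nu> \<sigma> q" by (rule bexI) (rule list.set_intros)
  qed
  then have 1: "VParL_proves [FNot (FAtom (Le ?x b))] [form_of (oall2 b p)]" by simp
  have "VParL_proves (map form_of [?r]) (map form_of [oall2 b p])"
  proof (rule open_valid)
    fix M and qn :: "ntrm \<Rightarrow> nat" and \<nu> \<sigma>
    assume M: "vmodel M qn" and h: "\<And>q. q \<in> set [?r] \<Longrightarrow> vmodel.oval M qn \<nu> \<sigma> q"
    interpret vmodel M qn by fact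
    have "oval \<nu> \<sigma> ?r" by (rule h) simp
    then have "oval \<nu> \<sigma> (oall2 b p)" by (intro bad_entry) (simp only: oval_simps simp_thms)
    then show "\<exists>q\<in>set [oall2 b p]. oval \<nu> \<sigma> q" by (rule bexI) (rule list.set_intros)
  qed
  then have 2: "VParL_proves [form_of ?r] [form_of (oall2 b p)]" by simp
  have "form_of ?r = finstN ?y (FOr (FNot (FAtom (Le (NVar 0) ?b'))) (form_of (row_of b p)))"
    by (simp add: sub_id)
  with 2 have "VParL_proves [fball_le b (form_of (row_of b p))] [form_of (oall2 b p)]"
    unfolding fball_le_def by (intro VParL_proves.allN_left[of ?y]) simp
  with 1 have "VParL_proves [FOr (FNot (FAtom (Le ?x b))) (fball_le b (form_of (row_of b p)))] [form_of (oall2 b p)]"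
    by (rule VParL_proves.or_left)
  moreover have "FOr (FNot (FAtom (Le ?x b))) (fball_le b (form_of (row_of b p))) =
      finstN ?x (FOr (FNot (FAtom (Le (NVar 0) ?b'))) (fball_le ?b' (form_of p)))"
    by (simp add: fball_le_def sub_sub sub_id upN_def)
  ultimately show ?thesis
    unfolding fball_le_def[of b "fball_le _ _"] by (intro VParL_proves.allN_left[of ?x]) simp
qed

definition oeq_mat :: "strm \<Rightarrow> strm \<Rightarrow> oform" where
  "oeq_mat X Y = (nrow X \<^bold>= nrow Y \<^bold>\<and> ncol X \<^bold>= ncol Y \<^bold>\<and>
     oall2 (Len X \<^bold>+ Len Y) (oentry (slift 2 X) (NVar 1) (NVar 0) \<^bold>\<longleftrightarrow> oentry (slift 2 Y) (NVar 1) (NVar 0)))"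

primrec tr_open :: "lfml \<Rightarrow> oform" where
  "tr_open (LEqI m n) = (tr_idx m \<^bold>= tr_idx n)"
| "tr_open (LLe m n) = (tr_idx m \<^bold>\<le> tr_idx n)"
| "tr_open (LEqK t u) = (tr_fld t \<^bold>\<longleftrightarrow> tr_fld u)"
| "tr_open (LEqM T U) = oeq_mat (tr_mat T) (tr_mat U)"
| "tr_open (LNot a) = (\<^bold>\<not> tr_open a)"
| "tr_open (LAnd a b) = (tr_open a \<^bold>\<and> tr_open b)"
| "tr_open (LOr a b) = (tr_open a \<^bold>\<or> tr_open b)"

section \<open>Exchanging translations for their open forms inside sequents\<close>

definition fequiv :: "form \<Rightarrow> form \<Rightarrow> bool" where
  "fequiv A B \<longleftrightarrow> VParL_proves [A] [B] \<and> VParL_proves [B] [A]"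

lemma weaken: "VParL_proves [A] [B] \<Longrightarrow> A \<in> set \<Gamma> \<Longrightarrow> B \<in> set \<Delta> \<Longrightarrow> VParL_proves \<Gamma> \<Delta>"
  by (erule VParL_proves.structural) auto

lemma fequiv_refl: "fequiv A A"
  by (simp add: fequiv_def VParL_proves.initial)

lemma fequiv_not: "fequiv A B \<Longrightarrow> fequiv (FNot A) (FNot B)"
proof -
  have "VParL_proves [FNot A] [FNot B]" if "VParL_proves [B] [A]" for A B
  proof -
    have "VParL_proves [FNot A, B] []" using that by (rule VParL_proves.not_left)
    then have "VParL_proves [B, FNot A] []" by (rule VParL_proves.structural) auto
    then show ?thesis by (rule VParL_proves.not_right)
  qed
  then show "fequiv A B \<Longrightarrow> fequiv (FNot A) (FNot B)" by (simp add: fequiv_def)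
qed

lemma fequiv_and: "fequiv A B \<Longrightarrow> fequiv C D \<Longrightarrow> fequiv (FAnd A C) (FAnd B D)"
  unfolding fequiv_def
  by (intro conjI VParL_proves.and_left VParL_proves.and_right) (auto intro: weaken)

lemma fequiv_or: "fequiv A B \<Longrightarrow> fequiv C D \<Longrightarrow> fequiv (FOr A C) (FOr B D)"
  unfolding fequiv_def
  by (intro conjI VParL_proves.or_left VParL_proves.or_right) (auto intro: weaken)

lemma fequiv_eq_mat: "fequiv (feq_mat X Y) (form_of (oeq_mat X Y))"
proof -
  have "fequiv (FAnd (FAtom a) (FAnd (FAtom b) F)) (form_of (OAtom a \<^bold>\<and> OAtom b \<^bold>\<and> q))"
    if "fequiv F (form_of q)" for a b F q
    using that by (simp add: fequiv_and fequiv_refl)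
  then show ?thesis
    unfolding feq_mat_def oeq_mat_def using oall2_imp_fall2 fall2_imp_oall2 fequiv_def by blast
qed

lemma fequiv_tr_open: "fequiv (tr_fml a) (form_of (tr_open a))"
  by (induction a) (auto intro: fequiv_refl fequiv_not fequiv_and fequiv_or fequiv_eq_mat)

text \<open>One cut per formula. Each translated formula joins the side formulas, so \<Gamma> has to
  vary in the induction.\<close>

lemma replace_left:
  "VParL_proves (map (\<lambda>a. form_of (tr_open a)) L @ \<Gamma>) \<Delta> \<Longrightarrow> VParL_proves (map tr_fml L @ \<Gamma>) \<Delta>"
proof (induction L arbitrary: \<Gamma>)
  case (Cons a L)
  let ?R = "map (\<lambda>a. form_of (tr_open a)) L"
  have "VParL_proves [tr_fml a] [form_of (tr_open a)]"
    using fequiv_tr_open by (simp add: fequiv_def)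
  then have "VParL_proves (?R @ tr_fml a # \<Gamma>) (form_of (tr_open a) # \<Delta>)"
    by (rule weaken) auto
  moreover have "VParL_proves (form_of (tr_open a) # ?R @ tr_fml a # \<Gamma>) \<Delta>"
    using Cons.prems by (rule VParL_proves.structural) auto
  ultimately have "VParL_proves (?R @ tr_fml a # \<Gamma>) \<Delta>" by (rule VParL_proves.cut)
  then have "VParL_proves (map tr_fml L @ tr_fml a # \<Gamma>) \<Delta>" by (rule Cons.IH)
  then show ?case by (rule VParL_proves.structural) auto
qed simp

lemma replace_right:
  "VParL_proves \<Gamma> (map (\<lambda>a. form_of (tr_open a)) L @ \<Delta>) \<Longrightarrow> VParL_proves \<Gamma> (map tr_fml L @ \<Delta>)"
proof (induction L arbitrary: \<Delta>)
  case (Cons a L)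
  let ?R = "map (\<lambda>a. form_of (tr_open a)) L"
  have "VParL_proves [form_of (tr_open a)] [tr_fml a]"
    using fequiv_tr_open by (simp add: fequiv_def)
  then have "VParL_proves (form_of (tr_open a) # \<Gamma>) (?R @ tr_fml a # \<Delta>)"
    by (rule weaken) auto
  moreover have "VParL_proves \<Gamma> (form_of (tr_open a) # ?R @ tr_fml a # \<Delta>)"
    using Cons.prems by (rule VParL_proves.structural) auto
  ultimately have "VParL_proves \<Gamma> (?R @ tr_fml a # \<Delta>)" by (metis VParL_proves.cut)
  then have "VParL_proves \<Gamma> (map tr_fml L @ tr_fml a # \<Delta>)" by (rule Cons.IH)
  then show ?case by (rule VParL_proves.structural) auto
qed simp

section \<open>Soundness of the rules of LAP\<close>

context vmodel
begin

text \<open>Beyond the lengths of the strings all entries are 0, so the bounded quantifiers in the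
  translation of a matrix equation amount to unbounded ones.\<close>

lemma ment_bound: "ment (sval \<nu> \<sigma> X) i j \<Longrightarrow> i \<sqsubseteq> qn (Len (sterm \<nu> \<sigma> X)) \<and> j \<sqsubseteq> qn (Len (sterm \<nu> \<sigma> X))"
  using mem_less_Len[of "pr i j" \<nu> \<sigma> X] pr_ge[of i j] pr_ge[of j i] N.order_trans
  by (auto simp: ment_def nless_def)

lemma oval_tr_open: "oval \<nu> \<sigma> (tr_open a) \<longleftrightarrow> lval \<nu> \<sigma> a"
proof (induction a)
  case (LEqM T U)
  have "(\<forall>i j. i \<sqsubseteq> qn (Len (sterm \<nu> \<sigma> (tr_mat T))) \<oplus> qn (Len (sterm \<nu> \<sigma> (tr_mat U))) \<longrightarrow>
      j \<sqsubseteq> qn (Len (sterm \<nu> \<sigma> (tr_mat T))) \<oplus> qn (Len (sterm \<nu> \<sigma> (tr_mat U))) \<longrightarrow>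
      ment (vm \<nu> \<sigma> T) i j = ment (vm \<nu> \<sigma> U) i j) \<longleftrightarrow> (\<forall>i j. ment (vm \<nu> \<sigma> T) i j = ment (vm \<nu> \<sigma> U) i j)"
    using ment_bound[of \<nu> \<sigma> "tr_mat T"] ment_bound[of \<nu> \<sigma> "tr_mat U"] le_addI by blast
  then show ?case by (simp add: oeq_mat_def meq_def) blast
qed auto

text \<open>The valuation of index variables is generalized because the eigenvariables of the
  induction and matrix equality rules are index variables; field and matrix variables keep their
  values.\<close>

theorem LAP_valid:
  "LAP_proves \<Gamma> \<Delta> \<Longrightarrow> (\<And>\<alpha>. \<alpha> \<in> set \<Gamma> \<Longrightarrow> lval \<nu> \<sigma> \<alpha>) \<Longrightarrow> \<exists>\<beta>\<in>set \<Delta>. lval \<nu> \<sigma> \<beta>"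
proof (induction arbitrary: \<nu> rule: LAP_proves.induct)
  case ("axiom" \<Gamma> \<Delta>)
  then show ?case using LAP_axiom_valid by blast
next
  case (induction \<alpha> \<Gamma> \<Delta> n)
  show ?case
  proof (rule ccontr)
    assume "\<not> ?case"
    then have no: "\<not> lval \<nu> \<sigma> (linst n \<alpha>)" "\<And>\<beta>. \<beta> \<in> set \<Delta> \<Longrightarrow> \<not> lval \<nu> \<sigma> \<beta>" by auto
    have inst: "lval \<nu> \<sigma> (linst m \<alpha>) \<longleftrightarrow> lval (case_nat (vi \<nu> \<sigma> m) \<nu>) \<sigma> \<alpha>" for m
      unfolding lval_lsub by (rule arg_cong[of _ _ "\<lambda>\<nu>. lval \<nu> \<sigma> \<alpha>"]) (auto split: nat.split)
    have lift: "lval (case_nat z \<nu>) \<sigma> (llift 1 \<beta>) \<longleftrightarrow> lval \<nu> \<sigma> \<beta>" for z \<beta>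
      by (simp add: lval_lsub)
    have step: "lval (case_nat z \<nu>) \<sigma> (lsub (case_nat (IAdd (IVar 0) IOne) (\<lambda>k. IVar (Suc k))) \<alpha>) \<longleftrightarrow>
        lval (case_nat (z \<oplus> \<one>) \<nu>) \<sigma> \<alpha>" for z
      unfolding lval_lsub by (rule arg_cong[of _ _ "\<lambda>\<nu>. lval \<nu> \<sigma> \<alpha>"]) (auto split: nat.split)
    \<comment> \<open>Induction in the model is available because the open form of \<alpha>
      expresses its truth. The side formulas are settled beforehand: \<Gamma> holds and \<Delta>
      fails independently of z.\<close>
    have "oval (case_nat z \<nu>) \<sigma> (tr_open \<alpha>)" for z
    proof (rule oval_ind)
      show "oval (case_nat \<zero> \<nu>) \<sigma> (tr_open \<alpha>)"
        using induction.prems[of "linst IZero \<alpha>"] by (simp add: oval_tr_open inst)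
    next
      fix z assume "oval (case_nat z \<nu>) \<sigma> (tr_open \<alpha>)"
      then have "\<exists>\<beta>\<in>set (lsub (case_nat (IAdd (IVar 0) IOne) (\<lambda>k. IVar (Suc k))) \<alpha> # map (llift 1) \<Delta>).
          lval (case_nat z \<nu>) \<sigma> \<beta>"
        using induction.prems lift by (intro induction.IH) (auto simp: oval_tr_open)
      then show "oval (case_nat (z \<oplus> \<one>) \<nu>) \<sigma> (tr_open \<alpha>)"
        using no(2) lift step by (auto simp: oval_tr_open)
    qed
    then show False using no(1) inst by (simp add: oval_tr_open)
  qed
next
  case (matrix_eq \<Gamma> T U \<Delta>)
  show ?case
  proof (rule ccontr)
    assume "\<not> ?case"
    then have no: "\<not> meq (vm \<nu> \<sigma> T) (vm \<nu> \<sigma> U)" "\<And>\<beta>. \<beta> \<in> set \<Delta> \<Longrightarrow> \<not> lval \<nu> \<sigma> \<beta>" by auto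
    have lift: "lval (case_nat j (case_nat i \<nu>)) \<sigma> (llift 2 \<beta>) \<longleftrightarrow> lval \<nu> \<sigma> \<beta>" for i j \<beta>
      by (simp add: lval_lsub)
    have "ment (vm \<nu> \<sigma> T) i j \<longleftrightarrow> ment (vm \<nu> \<sigma> U) i j" for i j
    proof -
      let ?e = "LEqK (KEntry (mlift2 T) (IVar 1) (IVar 0)) (KEntry (mlift2 U) (IVar 1) (IVar 0))"
      have "\<exists>\<beta>\<in>set (?e # map (llift 2) \<Delta>). lval (case_nat j (case_nat i \<nu>)) \<sigma> \<beta>"
        using matrix_eq.prems lift by (intro matrix_eq.IH(1)) auto
      then have "lval (case_nat j (case_nat i \<nu>)) \<sigma> ?e"
        using no(2) lift by auto
      then show ?thesis by simp
    qed
    moreover have "mrow (vm \<nu> \<sigma> T) = mrow (vm \<nu> \<sigma> U)" "mcol (vm \<nu> \<sigma> T) = mcol (vm \<nu> \<sigma> U)"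
      using matrix_eq.IH(2)[of \<nu>] matrix_eq.IH(3)[of \<nu>] matrix_eq.prems no(2) by auto
    ultimately show False using no(1) by (simp add: meq_def)
  qed
next
  case (cut \<Gamma> \<alpha> \<Delta>)
  from cut.IH(1)[of \<nu>] cut.IH(2)[of \<nu>] cut.prems show ?case by auto
next
  case (structural \<Gamma> \<Delta> \<Gamma>' \<Delta>')
  then show ?case by blast
next
  case (initial \<alpha>)
  then show ?case by simp
next
  case (not_left \<Gamma> \<alpha> \<Delta>)
  then have "\<exists>\<beta>\<in>set (\<alpha> # \<Delta>). lval \<nu> \<sigma> \<beta>" by simp
  with not_left.prems[of "LNot \<alpha>"] show ?case by auto
next
  case (not_right \<alpha> \<Gamma> \<Delta>)
  then show ?case by (cases "lval \<nu> \<sigma> \<alpha>") auto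
next
  case (and_left \<alpha> \<beta> \<Gamma> \<Delta>)
  from and_left.prems[of "LAnd \<alpha> \<beta>"] and_left.prems show ?case
    by (intro and_left.IH) auto
next
  case (and_right \<Gamma> \<alpha> \<Delta> \<beta>)
  from and_right.IH(1)[of \<nu>] and_right.IH(2)[of \<nu>] and_right.prems show ?case by auto
next
  case (or_left \<alpha> \<Gamma> \<Delta> \<beta>)
  have "lval \<nu> \<sigma> \<alpha> \<or> lval \<nu> \<sigma> \<beta>" using or_left.prems[of "LOr \<alpha> \<beta>"] by simp
  then show ?case
    using or_left.IH(1)[of \<nu>] or_left.IH(2)[of \<nu>] or_left.prems by auto
next
  case (or_right \<Gamma> \<alpha> \<beta> \<Delta>)
  from or_right.IH[of \<nu>] or_right.prems show ?case by auto
qed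

end

theorem theorem4p1:
  fixes \<alpha>s \<beta>s :: "lfml list"
  assumes "LAP_proves \<alpha>s \<beta>s"
  shows "VParL_proves (map tr_fml \<alpha>s) (map tr_fml \<beta>s)"
proof -
  have "VParL_proves (map form_of (map tr_open \<alpha>s)) (map form_of (map tr_open \<beta>s))"
  proof (rule open_valid)
    fix M and qn :: "ntrm \<Rightarrow> nat" and \<nu> \<sigma>
    assume M: "vmodel M qn" and h: "\<And>p. p \<in> set (map tr_open \<alpha>s) \<Longrightarrow> vmodel.oval M qn \<nu> \<sigma> p"
    interpret vmodel M qn by fact
    show "\<exists>p\<in>set (map tr_open \<beta>s). oval \<nu> \<sigma> p"
    proof -
      have "lval \<nu> \<sigma> \<alpha>" if "\<alpha> \<in> set \<alpha>s" for \<alpha>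
        using h[of "tr_open \<alpha>"] that by (simp add: oval_tr_open)
      then have "\<exists>\<beta>\<in>set \<beta>s. lval \<nu> \<sigma> \<beta>" by (rule LAP_valid[OF assms])
      then show ?thesis by (auto simp: oval_tr_open)
    qed
  qed
  then have "VParL_proves (map tr_fml \<alpha>s) (map (\<lambda>a. form_of (tr_open a)) \<beta>s)"
    using replace_left[of \<alpha>s "[]"] by (simp add: comp_def)
  then show ?thesis using replace_right[of _ \<beta>s "[]"] by simp
qed

end
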